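(* Let $\mathcal T$ be a strict tensor $C^*$-category and $\mathcal F:\mathcal T\to\mathcal H$ a quasitensor $^*$-functor, with isometries $S_{\rho,\sigma}:\mathcal F(\rho)\otimes\mathcal F(\sigma)\to\mathcal F(\rho\otimes\sigma)$. If an object $\rho$ has a conjugate $\overline\rho$ in $\mathcal T$, then $\mathcal F(\rho)$ is finite dimensional and $\dim\mathcal F(\rho)=\dim\mathcal F(\overline\rho)$. Furthermore, if $\mathcal F(\rho)\ne0$ and if $R\in(\iota,\overline\rho\otimes\rho)$, $\overline R\in(\iota,\rho\otimes\overline\rho)$ is a solution of the conjugate equations for $\rho$ in $\mathcal T$, then $$\hat R:=S_{\overline\rho,\rho}^*\circ\mathcal F(R)\in\mathcal F(\overline\rho)\otimes\mathcal F(\rho),\qquad \hat{\overline R}:=S_{\rho,\overline\rho}^*\circ\mathcal F(\overline R)\in\mathcal F(\rho)\otimes\mathcal F(\overline\rho)$$ is a solution of the conjugate equations for $\mathcal F(\rho)$ in $\mathcal H$.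
   Context: $\mathcal H$ is the strict tensor $C^*$-category of Hilbert spaces and bounded linear maps. Tensor units are irreducible: $(\iota,\iota)=\mathbb C$. A map $\mathbb C\to H$ is identified with the vector that is the image of $1$. Quasitensor: a covariant $^*$-functor $\mathcal F:\mathcal T\to\mathcal H$ is quasitensor if $\mathcal F(\iota)=\mathbb C$ and there are isometries $S_{\rho,\sigma}:\mathcal F(\rho)\otimes\mathcal F(\sigma)\to\mathcal F(\rho\otimes\sigma)$ with: $S_{\rho,\iota}=S_{\iota,\rho}=1_{\mathcal F(\rho)}$; $S_{\rho\otimes\sigma,\tau}\circ(S_{\rho,\sigma}\otimes1_{\mathcal F(\tau)})=S_{\rho,\sigma\otimes\tau}\circ(1_{\mathcal F(\rho)}\otimes S_{\sigma,\tau})=:S_{\rho,\sigma,\tau}$; $E_{\rho\otimes\sigma,\tau}\circ E_{\rho,\sigma\otimes\tau}\le E_{\rho,\sigma,\tau}$, where $E_{\rho,\sigma}$, $E_{\rho,\sigma,\tau}$ are the range projections of $S_{\rho,\sigma}$, $S_{\rho,\sigma,\tau}$; $\mathcal F(S\otimes T)\circ S_{\rho,\sigma}=S_{\rho',\sigma'}\circ(\mathcal F(S)\otimes\mathcal F(T))$ for $S\in(\rho,\rho')$, $T\in(\sigma,\sigma')$. Conjugate equations for $\rho$ (with conjugate $\overline\rho$): $(\overline R^*\otimes1_\rho)\circ(1_\rho\otimes R)=1_\rho$ and $(R^*\otimes1_{\overline\rho})\circ(1_{\overline\rho}\otimes\overline R)=1_{\overline\rho}$; $\overline\rho$ is a conjugate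 of $\rho$ if a solution $R\in(\iota,\overline\rho\otimes\rho)$, $\overline R\in(\iota,\rho\otimes\overline\rho)$ exists. For $\mathcal F(\rho)$ in $\mathcal H$ the conjugate object is $\mathcal F(\overline\rho)$. *)

theory Defs
  imports "HOL-Analysis.Analysis"
begin

section \<open>Complex Banach and Hilbert spaces on carrier sets\<close>

locale cvector_space =
  fixes V :: "'a set"
    and add :: "'a \<Rightarrow> 'a \<Rightarrow> 'a"
    and zero :: "'a"
    and scl :: "complex \<Rightarrow> 'a \<Rightarrow> 'a"
  assumes zero_closed: "zero \<in> V"
    and add_closed: "\<lbrakk>x \<in> V; y \<in> V\<rbrakk> \<Longrightarrow> add x y \<in> V"
    and scl_closed: "x \<in> V \<Longrightarrow> scl a x \<in> V"
    and add_assoc: "\<lbrakk>x \<in> V; y \<in> V; z \<in> V\<rbrakk> \<Longrightarrow> add (add x y) z = add x (add y z)"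
    and add_comm: "\<lbrakk>x \<in> V; y \<in> V\<rbrakk> \<Longrightarrow> add x y = add y x"
    and add_zero: "x \<in> V \<Longrightarrow> add x zero = x"
    and add_inverse: "x \<in> V \<Longrightarrow> \<exists>y\<in>V. add x y = zero"
    and scl_one: "x \<in> V \<Longrightarrow> scl 1 x = x"
    and scl_scl: "x \<in> V \<Longrightarrow> scl a (scl b x) = scl (a * b) x"
    and scl_add_right: "\<lbrakk>x \<in> V; y \<in> V\<rbrakk> \<Longrightarrow> scl a (add x y) = add (scl a x) (scl a y)"
    and scl_add_left: "x \<in> V \<Longrightarrow> scl (a + b) x = add (scl a x) (scl b x)"

locale cbanach_space = cvector_space +
  fixes nrm :: "'a \<Rightarrow> real"
  assumes nrm_nonneg: "x \<in> V \<Longrightarrow> nrm x \<ge> 0"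
    and nrm_eq_zero: "\<lbrakk>x \<in> V; nrm x = 0\<rbrakk> \<Longrightarrow> x = zero"
    and nrm_scl: "x \<in> V \<Longrightarrow> nrm (scl a x) = cmod a * nrm x"
    and nrm_triangle: "\<lbrakk>x \<in> V; y \<in> V\<rbrakk> \<Longrightarrow> nrm (add x y) \<le> nrm x + nrm y"
    and nrm_complete:
      "\<lbrakk>\<And>n::nat. X n \<in> V;
        \<And>e. e > 0 \<Longrightarrow> \<exists>N. \<forall>m\<ge>N. \<forall>n\<ge>N. nrm (add (X m) (scl (-1) (X n))) < e\<rbrakk>
       \<Longrightarrow> \<exists>x\<in>V. (\<lambda>n. nrm (add (X n) (scl (-1) x))) \<longlonglongrightarrow> 0"

record 'a hilb =
  vecs :: "'a set"
  vadd :: "'a \<Rightarrow> 'a \<Rightarrow> 'a"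
  vzero :: "'a"
  vscale :: "complex \<Rightarrow> 'a \<Rightarrow> 'a"
  vinner :: "'a \<Rightarrow> 'a \<Rightarrow> complex"

definition vnorm :: "'a hilb \<Rightarrow> 'a \<Rightarrow> real" where
  "vnorm H x = sqrt (Re (vinner H x x))"

text \<open>Inner products are linear in the second argument.\<close>

locale hilbert_space =
  fixes H :: "'a hilb"
  assumes banach: "cbanach_space (vecs H) (vadd H) (vzero H) (vscale H) (vnorm H)"
    and inner_add: "\<lbrakk>x \<in> vecs H; y \<in> vecs H; z \<in> vecs H\<rbrakk>
          \<Longrightarrow> vinner H x (vadd H y z) = vinner H x y + vinner H x z"
    and inner_scale: "\<lbrakk>x \<in> vecs H; y \<in> vecs H\<rbrakk>
          \<Longrightarrow> vinner H x (vscale H a y) = a * vinner H x y"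
    and inner_commute: "\<lbrakk>x \<in> vecs H; y \<in> vecs H\<rbrakk>
          \<Longrightarrow> vinner H x y = cnj (vinner H y x)"
    and inner_nonneg: "x \<in> vecs H \<Longrightarrow> Re (vinner H x x) \<ge> 0"
    and inner_eq_zero: "\<lbrakk>x \<in> vecs H; vinner H x x = 0\<rbrakk> \<Longrightarrow> x = vzero H"

definition complex_hilb :: "complex hilb" where
  "complex_hilb = \<lparr>vecs = UNIV, vadd = (+), vzero = 0, vscale = (*), vinner = (\<lambda>a b. cnj a * b)\<rparr>"

definition is_onb :: "'a hilb \<Rightarrow> 'a set \<Rightarrow> bool" where
  "is_onb H B \<longleftrightarrow> B \<subseteq> vecs H \<and>
     (\<forall>x\<in>B. \<forall>y\<in>B. vinner H x y = (if x = y then 1 else 0)) \<and>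
     (\<forall>x\<in>vecs H. (\<forall>b\<in>B. vinner H b x = 0) \<longrightarrow> x = vzero H)"

definition onb :: "'a hilb \<Rightarrow> 'a set" where
  "onb H = (SOME B. is_onb H B)"

text \<open>Dimension is Hilbert space dimension, the cardinality of an orthonormal basis. The number
  \<open>hdim H\<close> is meaningful only together with \<open>finite_dimensional H\<close>.\<close>

definition finite_dimensional :: "'a hilb \<Rightarrow> bool" where
  "finite_dimensional H \<longleftrightarrow> finite (onb H)"

definition hdim :: "'a hilb \<Rightarrow> nat" where
  "hdim H = card (onb H)"


section \<open>Bounded linear maps\<close>

text \<open>A bounded operator carries its source and target and is \<open>undefined\<close> outside the source,
  so that equality of operators is equality of records.\<close>

record ('a, 'b) hmap =
  src :: "'a hilb"
  tgt :: "'b hilb"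
  act :: "'a \<Rightarrow> 'b"

definition bounded_maps :: "'a hilb \<Rightarrow> 'b hilb \<Rightarrow> ('a, 'b) hmap set" where
  "bounded_maps H K = {A. src A = H \<and> tgt A = K \<and> act A \<in> vecs H \<rightarrow>\<^sub>E vecs K \<and>
     (\<forall>x\<in>vecs H. \<forall>y\<in>vecs H. act A (vadd H x y) = vadd K (act A x) (act A y)) \<and>
     (\<forall>a. \<forall>x\<in>vecs H. act A (vscale H a x) = vscale K a (act A x)) \<and>
     (\<exists>C. \<forall>x\<in>vecs H. vnorm K (act A x) \<le> C * vnorm H x)}"

definition hid :: "'a hilb \<Rightarrow> ('a, 'a) hmap" where
  "hid H = \<lparr>src = H, tgt = H, act = (\<lambda>x\<in>vecs H. x)\<rparr>"

definition hcomp :: "('b, 'c) hmap \<Rightarrow> ('a, 'b) hmap \<Rightarrow> ('a, 'c) hmap" (infixl "\<circ>\<^sub>H" 65) where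
  "A \<circ>\<^sub>H B = \<lparr>src = src B, tgt = tgt A, act = (\<lambda>x\<in>vecs (src B). act A (act B x))\<rparr>"

definition hadd :: "('a, 'b) hmap \<Rightarrow> ('a, 'b) hmap \<Rightarrow> ('a, 'b) hmap" where
  "hadd A B = \<lparr>src = src A, tgt = tgt A,
     act = (\<lambda>x\<in>vecs (src A). vadd (tgt A) (act A x) (act B x))\<rparr>"

definition hscale :: "complex \<Rightarrow> ('a, 'b) hmap \<Rightarrow> ('a, 'b) hmap" where
  "hscale a A = \<lparr>src = src A, tgt = tgt A,
     act = (\<lambda>x\<in>vecs (src A). vscale (tgt A) a (act A x))\<rparr>"

definition hadj :: "('a, 'b) hmap \<Rightarrow> ('b, 'a) hmap" where
  "hadj A = \<lparr>src = tgt A, tgt = src A,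
     act = (\<lambda>y\<in>vecs (tgt A). THE x. x \<in> vecs (src A) \<and>
       (\<forall>z\<in>vecs (src A). vinner (src A) x z = vinner (tgt A) y (act A z)))\<rparr>"

definition isometry :: "('a, 'b) hmap \<Rightarrow> bool" where
  "isometry A \<longleftrightarrow> hadj A \<circ>\<^sub>H A = hid (src A)"

definition unitary :: "('a, 'b) hmap \<Rightarrow> bool" where
  "unitary A \<longleftrightarrow> hadj A \<circ>\<^sub>H A = hid (src A) \<and> A \<circ>\<^sub>H hadj A = hid (tgt A)"

text \<open>The projection onto the range of an isometry.\<close>

definition range_proj :: "('a, 'b) hmap \<Rightarrow> ('b, 'b) hmap" where
  "range_proj A = A \<circ>\<^sub>H hadj A"

text \<open>Operator order: the difference \<open>B - A\<close> is a positive operator.\<close>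

definition op_le :: "('a, 'a) hmap \<Rightarrow> ('a, 'a) hmap \<Rightarrow> bool" where
  "op_le A B \<longleftrightarrow> src A = src B \<and>
     (\<forall>x\<in>vecs (src B). \<exists>r\<ge>0. vinner (src B) x (act B x) - vinner (src B) x (act A x) = complex_of_real r)"


section \<open>Tensor products of Hilbert spaces\<close>

text \<open>The Hilbert space tensor product as the space of Hilbert-Schmidt functionals, following
  Kadison and Ringrose: bounded conjugate-bilinear functions on \<open>H \<times> K\<close> which are square summable
  on orthonormal bases. Neither this condition nor the inner product depends on the choice of the
  bases. The elementary tensor of \<open>x\<close> and \<open>y\<close> is the function sending \<open>(u, v)\<close> to the product of
  the inner products of \<open>u\<close> with \<open>x\<close> and of \<open>v\<close> with \<open>y\<close>.\<close>

definition hs_form :: "'a hilb \<Rightarrow> 'b hilb \<Rightarrow> ('a \<times> 'b \<Rightarrow> complex) \<Rightarrow> bool" where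
  "hs_form H K f \<longleftrightarrow> f \<in> extensional (vecs H \<times> vecs K) \<and>
     (\<forall>u\<in>vecs H. \<forall>u'\<in>vecs H. \<forall>v\<in>vecs K. f (vadd H u u', v) = f (u, v) + f (u', v)) \<and>
     (\<forall>u\<in>vecs H. \<forall>v\<in>vecs K. \<forall>v'\<in>vecs K. f (u, vadd K v v') = f (u, v) + f (u, v')) \<and>
     (\<forall>a. \<forall>u\<in>vecs H. \<forall>v\<in>vecs K. f (vscale H a u, v) = cnj a * f (u, v)) \<and>
     (\<forall>a. \<forall>u\<in>vecs H. \<forall>v\<in>vecs K. f (u, vscale K a v) = cnj a * f (u, v)) \<and>
     (\<exists>C. \<forall>u\<in>vecs H. \<forall>v\<in>vecs K. cmod (f (u, v)) \<le> C * vnorm H u * vnorm K v) \<and>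
     (\<lambda>p. (cmod (f p))\<^sup>2) summable_on (onb H \<times> onb K)"

definition htensor :: "'a hilb \<Rightarrow> 'b hilb \<Rightarrow> ('a \<times> 'b \<Rightarrow> complex) hilb" (infixr "\<otimes>\<^sub>H" 70) where
  "H \<otimes>\<^sub>H K = \<lparr>vecs = {f. hs_form H K f},
     vadd = (\<lambda>f g. \<lambda>p\<in>vecs H \<times> vecs K. f p + g p),
     vzero = (\<lambda>p\<in>vecs H \<times> vecs K. 0),
     vscale = (\<lambda>a f. \<lambda>p\<in>vecs H \<times> vecs K. a * f p),
     vinner = (\<lambda>f g. \<Sum>\<^sub>\<infinity>p\<in>onb H \<times> onb K. cnj (f p) * g p)\<rparr>"

definition vtensor :: "'a hilb \<Rightarrow> 'b hilb \<Rightarrow> 'a \<Rightarrow> 'b \<Rightarrow> ('a \<times> 'b \<Rightarrow> complex)" where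
  "vtensor H K x y = (\<lambda>(u, v)\<in>vecs H \<times> vecs K. vinner H u x * vinner K v y)"

definition map_tensor ::
  "('a, 'c) hmap \<Rightarrow> ('b, 'd) hmap \<Rightarrow> ('a \<times> 'b \<Rightarrow> complex, 'c \<times> 'd \<Rightarrow> complex) hmap"
  (infixr "\<otimes>\<^sub>M" 70) where
  "A \<otimes>\<^sub>M B = (THE C. C \<in> bounded_maps (src A \<otimes>\<^sub>H src B) (tgt A \<otimes>\<^sub>H tgt B) \<and>
     (\<forall>x\<in>vecs (src A). \<forall>y\<in>vecs (src B).
        act C (vtensor (src A) (src B) x y) = vtensor (tgt A) (tgt B) (act A x) (act B y)))"

text \<open>The canonical unitaries that make the Hilbert space tensor product associative and unital.\<close>

definition hassoc :: "'a hilb \<Rightarrow> 'b hilb \<Rightarrow> 'c hilb \<Rightarrow>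
  (('a \<times> 'b \<Rightarrow> complex) \<times> 'c \<Rightarrow> complex, 'a \<times> ('b \<times> 'c \<Rightarrow> complex) \<Rightarrow> complex) hmap" where
  "hassoc H K L = (THE A. A \<in> bounded_maps ((H \<otimes>\<^sub>H K) \<otimes>\<^sub>H L) (H \<otimes>\<^sub>H (K \<otimes>\<^sub>H L)) \<and>
     (\<forall>x\<in>vecs H. \<forall>y\<in>vecs K. \<forall>z\<in>vecs L.
        act A (vtensor (H \<otimes>\<^sub>H K) L (vtensor H K x y) z)
          = vtensor H (K \<otimes>\<^sub>H L) x (vtensor K L y z)))"

definition lunit :: "'a hilb \<Rightarrow> (complex \<times> 'a \<Rightarrow> complex, 'a) hmap" where
  "lunit H = (THE A. A \<in> bounded_maps (complex_hilb \<otimes>\<^sub>H H) H \<and>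
     (\<forall>a. \<forall>x\<in>vecs H. act A (vtensor complex_hilb H a x) = vscale H a x))"

definition runit :: "'a hilb \<Rightarrow> ('a \<times> complex \<Rightarrow> complex, 'a) hmap" where
  "runit H = (THE A. A \<in> bounded_maps (H \<otimes>\<^sub>H complex_hilb) H \<and>
     (\<forall>a. \<forall>x\<in>vecs H. act A (vtensor H complex_hilb x a) = vscale H a x))"

text \<open>The conjugate equations in the category of Hilbert spaces. The vectors \<open>R\<close> and \<open>Rb\<close> are
  given as maps from the complex numbers, and inverses of the canonical unitaries are written
  as adjoints.\<close>

definition hilb_conjugate_eqs :: "'a hilb \<Rightarrow> 'b hilb \<Rightarrow>
  (complex, 'b \<times> 'a \<Rightarrow> complex) hmap \<Rightarrow> (complex, 'a \<times> 'b \<Rightarrow> complex) hmap \<Rightarrow> bool" where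
  "hilb_conjugate_eqs H Hb R Rb \<longleftrightarrow>
     R \<in> bounded_maps complex_hilb (Hb \<otimes>\<^sub>H H) \<and>
     Rb \<in> bounded_maps complex_hilb (H \<otimes>\<^sub>H Hb) \<and>
     lunit H \<circ>\<^sub>H (hadj Rb \<otimes>\<^sub>M hid H) \<circ>\<^sub>H hadj (hassoc H Hb H) \<circ>\<^sub>H (hid H \<otimes>\<^sub>M R) \<circ>\<^sub>H hadj (runit H)
       = hid H \<and>
     lunit Hb \<circ>\<^sub>H (hadj R \<otimes>\<^sub>M hid Hb) \<circ>\<^sub>H hadj (hassoc Hb H Hb) \<circ>\<^sub>H (hid Hb \<otimes>\<^sub>M Rb) \<circ>\<^sub>H hadj (runit Hb)
       = hid Hb"


section \<open>Strict tensor C*-categories\<close>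

record ('o, 'm) tensor_category =
  Obj :: "'o set"
  Hom :: "'o \<Rightarrow> 'o \<Rightarrow> 'm set"
  Comp :: "'m \<Rightarrow> 'm \<Rightarrow> 'm" (infixl "\<cdot>\<index>" 65)
  Ident :: "'o \<Rightarrow> 'm"
  Add :: "'m \<Rightarrow> 'm \<Rightarrow> 'm"
  Zero :: "'o \<Rightarrow> 'o \<Rightarrow> 'm"
  Scale :: "complex \<Rightarrow> 'm \<Rightarrow> 'm"
  Star :: "'m \<Rightarrow> 'm"
  Norm :: "'m \<Rightarrow> real"
  Unit :: "'o"
  OTensor :: "'o \<Rightarrow> 'o \<Rightarrow> 'o" (infixr "\<otimes>\<^sub>o\<index>" 70)
  ATensor :: "'m \<Rightarrow> 'm \<Rightarrow> 'm" (infixr "\<otimes>\<^sub>a\<index>" 70)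

text \<open>\<open>Hom T \<rho> \<sigma>\<close> is the space of arrows from \<open>\<rho>\<close> to \<open>\<sigma>\<close>. Arrows determine their source and
  target, so \<open>Star\<close> and \<open>ATensor\<close> need no object arguments. Positivity of \<open>A* A\<close> is positivity in
  the C*-algebra of endomorphisms, that is, being of the form \<open>B* B\<close> there.\<close>

locale cstar_category =
  fixes T :: "('o, 'm) tensor_category" (structure)
  assumes hom_disjoint: "\<lbrakk>\<rho> \<in> Obj T; \<sigma> \<in> Obj T; \<rho>' \<in> Obj T; \<sigma>' \<in> Obj T;
        A \<in> Hom T \<rho> \<sigma>; A \<in> Hom T \<rho>' \<sigma>'\<rbrakk> \<Longrightarrow> \<rho> = \<rho>' \<and> \<sigma> = \<sigma>'"
    and hom_banach: "\<lbrakk>\<rho> \<in> Obj T; \<sigma> \<in> Obj T\<rbrakk>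
      \<Longrightarrow> cbanach_space (Hom T \<rho> \<sigma>) (Add T) (Zero T \<rho> \<sigma>) (Scale T) (Norm T)"
    and comp_closed: "\<lbrakk>\<rho> \<in> Obj T; \<sigma> \<in> Obj T; \<tau> \<in> Obj T; A \<in> Hom T \<sigma> \<tau>; B \<in> Hom T \<rho> \<sigma>\<rbrakk>
      \<Longrightarrow> A \<cdot> B \<in> Hom T \<rho> \<tau>"
    and comp_assoc: "\<lbrakk>\<rho> \<in> Obj T; \<sigma> \<in> Obj T; \<tau> \<in> Obj T; \<upsilon> \<in> Obj T;
        A \<in> Hom T \<tau> \<upsilon>; B \<in> Hom T \<sigma> \<tau>; C \<in> Hom T \<rho> \<sigma>\<rbrakk> \<Longrightarrow> (A \<cdot> B) \<cdot> C = A \<cdot> (B \<cdot> C)"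
    and ident_closed: "\<rho> \<in> Obj T \<Longrightarrow> Ident T \<rho> \<in> Hom T \<rho> \<rho>"
    and ident_left: "\<lbrakk>\<rho> \<in> Obj T; \<sigma> \<in> Obj T; A \<in> Hom T \<rho> \<sigma>\<rbrakk> \<Longrightarrow> Ident T \<sigma> \<cdot> A = A"
    and ident_right: "\<lbrakk>\<rho> \<in> Obj T; \<sigma> \<in> Obj T; A \<in> Hom T \<rho> \<sigma>\<rbrakk> \<Longrightarrow> A \<cdot> Ident T \<rho> = A"
    and comp_add_left: "\<lbrakk>\<rho> \<in> Obj T; \<sigma> \<in> Obj T; \<tau> \<in> Obj T;
        A \<in> Hom T \<sigma> \<tau>; A' \<in> Hom T \<sigma> \<tau>; B \<in> Hom T \<rho> \<sigma>\<rbrakk>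
      \<Longrightarrow> Add T A A' \<cdot> B = Add T (A \<cdot> B) (A' \<cdot> B)"
    and comp_add_right: "\<lbrakk>\<rho> \<in> Obj T; \<sigma> \<in> Obj T; \<tau> \<in> Obj T;
        A \<in> Hom T \<sigma> \<tau>; B \<in> Hom T \<rho> \<sigma>; B' \<in> Hom T \<rho> \<sigma>\<rbrakk>
      \<Longrightarrow> A \<cdot> Add T B B' = Add T (A \<cdot> B) (A \<cdot> B')"
    and comp_scale_left: "\<lbrakk>\<rho> \<in> Obj T; \<sigma> \<in> Obj T; \<tau> \<in> Obj T; A \<in> Hom T \<sigma> \<tau>; B \<in> Hom T \<rho> \<sigma>\<rbrakk>
      \<Longrightarrow> Scale T a A \<cdot> B = Scale T a (A \<cdot> B)"
    and comp_scale_right: "\<lbrakk>\<rho> \<in> Obj T; \<sigma> \<in> Obj T; \<tau> \<in> Obj T; A \<in> Hom T \<sigma> \<tau>; B \<in> Hom T \<rho> \<sigma>\<rbrakk>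
      \<Longrightarrow> A \<cdot> Scale T a B = Scale T a (A \<cdot> B)"
    and norm_comp: "\<lbrakk>\<rho> \<in> Obj T; \<sigma> \<in> Obj T; \<tau> \<in> Obj T; A \<in> Hom T \<sigma> \<tau>; B \<in> Hom T \<rho> \<sigma>\<rbrakk>
      \<Longrightarrow> Norm T (A \<cdot> B) \<le> Norm T A * Norm T B"
    and star_closed: "\<lbrakk>\<rho> \<in> Obj T; \<sigma> \<in> Obj T; A \<in> Hom T \<rho> \<sigma>\<rbrakk> \<Longrightarrow> Star T A \<in> Hom T \<sigma> \<rho>"
    and star_star: "\<lbrakk>\<rho> \<in> Obj T; \<sigma> \<in> Obj T; A \<in> Hom T \<rho> \<sigma>\<rbrakk> \<Longrightarrow> Star T (Star T A) = A"
    and star_add: "\<lbrakk>\<rho> \<in> Obj T; \<sigma> \<in> Obj T; A \<in> Hom T \<rho> \<sigma>; B \<in> Hom T \<rho> \<sigma>\<rbrakk>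
      \<Longrightarrow> Star T (Add T A B) = Add T (Star T A) (Star T B)"
    and star_scale: "\<lbrakk>\<rho> \<in> Obj T; \<sigma> \<in> Obj T; A \<in> Hom T \<rho> \<sigma>\<rbrakk>
      \<Longrightarrow> Star T (Scale T a A) = Scale T (cnj a) (Star T A)"
    and star_comp: "\<lbrakk>\<rho> \<in> Obj T; \<sigma> \<in> Obj T; \<tau> \<in> Obj T; A \<in> Hom T \<sigma> \<tau>; B \<in> Hom T \<rho> \<sigma>\<rbrakk>
      \<Longrightarrow> Star T (A \<cdot> B) = Star T B \<cdot> Star T A"
    and cstar_identity: "\<lbrakk>\<rho> \<in> Obj T; \<sigma> \<in> Obj T; A \<in> Hom T \<rho> \<sigma>\<rbrakk>
      \<Longrightarrow> Norm T (Star T A \<cdot> A) = (Norm T A)\<^sup>2"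
    and cstar_positive: "\<lbrakk>\<rho> \<in> Obj T; \<sigma> \<in> Obj T; A \<in> Hom T \<rho> \<sigma>\<rbrakk>
      \<Longrightarrow> \<exists>B\<in>Hom T \<rho> \<rho>. Star T A \<cdot> A = Star T B \<cdot> B"

locale strict_tensor_cstar_category = cstar_category +
  assumes unit_obj: "Unit T \<in> Obj T"
    and otensor_closed: "\<lbrakk>\<rho> \<in> Obj T; \<sigma> \<in> Obj T\<rbrakk> \<Longrightarrow> \<rho> \<otimes>\<^sub>o \<sigma> \<in> Obj T"
    and otensor_assoc: "\<lbrakk>\<rho> \<in> Obj T; \<sigma> \<in> Obj T; \<tau> \<in> Obj T\<rbrakk>
      \<Longrightarrow> (\<rho> \<otimes>\<^sub>o \<sigma>) \<otimes>\<^sub>o \<tau> = \<rho> \<otimes>\<^sub>o (\<sigma> \<otimes>\<^sub>o \<tau>)"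
    and otensor_unit_left: "\<rho> \<in> Obj T \<Longrightarrow> Unit T \<otimes>\<^sub>o \<rho> = \<rho>"
    and otensor_unit_right: "\<rho> \<in> Obj T \<Longrightarrow> \<rho> \<otimes>\<^sub>o Unit T = \<rho>"
    and atensor_closed: "\<lbrakk>\<rho> \<in> Obj T; \<rho>' \<in> Obj T; \<sigma> \<in> Obj T; \<sigma>' \<in> Obj T;
        A \<in> Hom T \<rho> \<rho>'; B \<in> Hom T \<sigma> \<sigma>'\<rbrakk> \<Longrightarrow> A \<otimes>\<^sub>a B \<in> Hom T (\<rho> \<otimes>\<^sub>o \<sigma>) (\<rho>' \<otimes>\<^sub>o \<sigma>')"
    and atensor_ident: "\<lbrakk>\<rho> \<in> Obj T; \<sigma> \<in> Obj T\<rbrakk>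
      \<Longrightarrow> Ident T \<rho> \<otimes>\<^sub>a Ident T \<sigma> = Ident T (\<rho> \<otimes>\<^sub>o \<sigma>)"
    and atensor_comp: "\<lbrakk>\<rho> \<in> Obj T; \<rho>' \<in> Obj T; \<rho>'' \<in> Obj T; \<sigma> \<in> Obj T; \<sigma>' \<in> Obj T; \<sigma>'' \<in> Obj T;
        A' \<in> Hom T \<rho>' \<rho>''; A \<in> Hom T \<rho> \<rho>'; B' \<in> Hom T \<sigma>' \<sigma>''; B \<in> Hom T \<sigma> \<sigma>'\<rbrakk>
      \<Longrightarrow> (A' \<cdot> A) \<otimes>\<^sub>a (B' \<cdot> B) = (A' \<otimes>\<^sub>a B') \<cdot> (A \<otimes>\<^sub>a B)"
    and atensor_add_left: "\<lbrakk>\<rho> \<in> Obj T; \<rho>' \<in> Obj T; \<sigma> \<in> Obj T; \<sigma>' \<in> Obj T;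
        A \<in> Hom T \<rho> \<rho>'; A' \<in> Hom T \<rho> \<rho>'; B \<in> Hom T \<sigma> \<sigma>'\<rbrakk>
      \<Longrightarrow> Add T A A' \<otimes>\<^sub>a B = Add T (A \<otimes>\<^sub>a B) (A' \<otimes>\<^sub>a B)"
    and atensor_add_right: "\<lbrakk>\<rho> \<in> Obj T; \<rho>' \<in> Obj T; \<sigma> \<in> Obj T; \<sigma>' \<in> Obj T;
        A \<in> Hom T \<rho> \<rho>'; B \<in> Hom T \<sigma> \<sigma>'; B' \<in> Hom T \<sigma> \<sigma>'\<rbrakk>
      \<Longrightarrow> A \<otimes>\<^sub>a Add T B B' = Add T (A \<otimes>\<^sub>a B) (A \<otimes>\<^sub>a B')"
    and atensor_scale_left: "\<lbrakk>\<rho> \<in> Obj T; \<rho>' \<in> Obj T; \<sigma> \<in> Obj T; \<sigma>' \<in> Obj T;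
        A \<in> Hom T \<rho> \<rho>'; B \<in> Hom T \<sigma> \<sigma>'\<rbrakk> \<Longrightarrow> Scale T a A \<otimes>\<^sub>a B = Scale T a (A \<otimes>\<^sub>a B)"
    and atensor_scale_right: "\<lbrakk>\<rho> \<in> Obj T; \<rho>' \<in> Obj T; \<sigma> \<in> Obj T; \<sigma>' \<in> Obj T;
        A \<in> Hom T \<rho> \<rho>'; B \<in> Hom T \<sigma> \<sigma>'\<rbrakk> \<Longrightarrow> A \<otimes>\<^sub>a Scale T a B = Scale T a (A \<otimes>\<^sub>a B)"
    and atensor_star: "\<lbrakk>\<rho> \<in> Obj T; \<rho>' \<in> Obj T; \<sigma> \<in> Obj T; \<sigma>' \<in> Obj T;
        A \<in> Hom T \<rho> \<rho>'; B \<in> Hom T \<sigma> \<sigma>'\<rbrakk> \<Longrightarrow> Star T (A \<otimes>\<^sub>a B) = Star T A \<otimes>\<^sub>a Star T B"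
    and atensor_assoc: "\<lbrakk>\<rho> \<in> Obj T; \<rho>' \<in> Obj T; \<sigma> \<in> Obj T; \<sigma>' \<in> Obj T; \<tau> \<in> Obj T; \<tau>' \<in> Obj T;
        A \<in> Hom T \<rho> \<rho>'; B \<in> Hom T \<sigma> \<sigma>'; C \<in> Hom T \<tau> \<tau>'\<rbrakk>
      \<Longrightarrow> (A \<otimes>\<^sub>a B) \<otimes>\<^sub>a C = A \<otimes>\<^sub>a (B \<otimes>\<^sub>a C)"
    and atensor_unit_left: "\<lbrakk>\<rho> \<in> Obj T; \<rho>' \<in> Obj T; A \<in> Hom T \<rho> \<rho>'\<rbrakk>
      \<Longrightarrow> Ident T (Unit T) \<otimes>\<^sub>a A = A"
    and atensor_unit_right: "\<lbrakk>\<rho> \<in> Obj T; \<rho>' \<in> Obj T; A \<in> Hom T \<rho> \<rho>'\<rbrakk>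
      \<Longrightarrow> A \<otimes>\<^sub>a Ident T (Unit T) = A"
    and unit_irreducible: "Hom T (Unit T) (Unit T) = range (\<lambda>a. Scale T a (Ident T (Unit T)))"
    and unit_nonzero: "Ident T (Unit T) \<noteq> Zero T (Unit T) (Unit T)"

definition conjugate_eqs :: "('o, 'm) tensor_category \<Rightarrow> 'o \<Rightarrow> 'o \<Rightarrow> 'm \<Rightarrow> 'm \<Rightarrow> bool" where
  "conjugate_eqs T \<rho> \<rho>b R Rb \<longleftrightarrow>
     R \<in> Hom T (Unit T) (\<rho>b \<otimes>\<^sub>o\<^bsub>T\<^esub> \<rho>) \<and> Rb \<in> Hom T (Unit T) (\<rho> \<otimes>\<^sub>o\<^bsub>T\<^esub> \<rho>b) \<and>
     (Star T Rb \<otimes>\<^sub>a\<^bsub>T\<^esub> Ident T \<rho>) \<cdot>\<^bsub>T\<^esub> (Ident T \<rho> \<otimes>\<^sub>a\<^bsub>T\<^esub> R) = Ident T \<rho> \<and>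
     (Star T R \<otimes>\<^sub>a\<^bsub>T\<^esub> Ident T \<rho>b) \<cdot>\<^bsub>T\<^esub> (Ident T \<rho>b \<otimes>\<^sub>a\<^bsub>T\<^esub> Rb) = Ident T \<rho>b"

definition is_conjugate :: "('o, 'm) tensor_category \<Rightarrow> 'o \<Rightarrow> 'o \<Rightarrow> bool" where
  "is_conjugate T \<rho> \<rho>b \<longleftrightarrow> (\<exists>R Rb. conjugate_eqs T \<rho> \<rho>b R Rb)"


section \<open>Functors to Hilbert spaces\<close>

locale star_functor = strict_tensor_cstar_category T
  for T :: "('o, 'm) tensor_category" (structure) +
  fixes Fo :: "'o \<Rightarrow> 'h hilb"
    and F :: "'m \<Rightarrow> ('h, 'h) hmap"
  assumes F_obj: "\<rho> \<in> Obj T \<Longrightarrow> hilbert_space (Fo \<rho>)"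
    and F_arr: "\<lbrakk>\<rho> \<in> Obj T; \<sigma> \<in> Obj T; A \<in> Hom T \<rho> \<sigma>\<rbrakk> \<Longrightarrow> F A \<in> bounded_maps (Fo \<rho>) (Fo \<sigma>)"
    and F_ident: "\<rho> \<in> Obj T \<Longrightarrow> F (Ident T \<rho>) = hid (Fo \<rho>)"
    and F_comp: "\<lbrakk>\<rho> \<in> Obj T; \<sigma> \<in> Obj T; \<tau> \<in> Obj T; A \<in> Hom T \<sigma> \<tau>; B \<in> Hom T \<rho> \<sigma>\<rbrakk>
      \<Longrightarrow> F (A \<cdot> B) = F A \<circ>\<^sub>H F B"
    and F_add: "\<lbrakk>\<rho> \<in> Obj T; \<sigma> \<in> Obj T; A \<in> Hom T \<rho> \<sigma>; B \<in> Hom T \<rho> \<sigma>\<rbrakk>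
      \<Longrightarrow> F (Add T A B) = hadd (F A) (F B)"
    and F_scale: "\<lbrakk>\<rho> \<in> Obj T; \<sigma> \<in> Obj T; A \<in> Hom T \<rho> \<sigma>\<rbrakk>
      \<Longrightarrow> F (Scale T a A) = hscale a (F A)"
    and F_star: "\<lbrakk>\<rho> \<in> Obj T; \<sigma> \<in> Obj T; A \<in> Hom T \<rho> \<sigma>\<rbrakk>
      \<Longrightarrow> F (Star T A) = hadj (F A)"

text \<open>The identification of the Hilbert space assigned to the unit object with the complex
  numbers is the unitary \<open>u\<close>. The associativity law holds in the strict sense after inserting
  the canonical associativity unitary, and similarly for the unit laws.\<close>

locale quasitensor_functor = star_functor T Fo F
  for T :: "('o, 'm) tensor_category" (structure)
    and Fo :: "'o \<Rightarrow> 'h hilb"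
    and F :: "'m \<Rightarrow> ('h, 'h) hmap" +
  fixes u :: "(complex, 'h) hmap"
    and S :: "'o \<Rightarrow> 'o \<Rightarrow> ('h \<times> 'h \<Rightarrow> complex, 'h) hmap"
  assumes u_map: "u \<in> bounded_maps complex_hilb (Fo (Unit T))"
    and u_unitary: "unitary u"
    and S_map: "\<lbrakk>\<rho> \<in> Obj T; \<sigma> \<in> Obj T\<rbrakk>
      \<Longrightarrow> S \<rho> \<sigma> \<in> bounded_maps (Fo \<rho> \<otimes>\<^sub>H Fo \<sigma>) (Fo (\<rho> \<otimes>\<^sub>o \<sigma>))"
    and S_isometry: "\<lbrakk>\<rho> \<in> Obj T; \<sigma> \<in> Obj T\<rbrakk> \<Longrightarrow> isometry (S \<rho> \<sigma>)"
    and S_unit_right: "\<rho> \<in> Obj T \<Longrightarrow> S \<rho> (Unit T) \<circ>\<^sub>H (hid (Fo \<rho>) \<otimes>\<^sub>M u) = runit (Fo \<rho>)"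
    and S_unit_left: "\<rho> \<in> Obj T \<Longrightarrow> S (Unit T) \<rho> \<circ>\<^sub>H (u \<otimes>\<^sub>M hid (Fo \<rho>)) = lunit (Fo \<rho>)"
    and S_assoc: "\<lbrakk>\<rho> \<in> Obj T; \<sigma> \<in> Obj T; \<tau> \<in> Obj T\<rbrakk>
      \<Longrightarrow> S (\<rho> \<otimes>\<^sub>o \<sigma>) \<tau> \<circ>\<^sub>H (S \<rho> \<sigma> \<otimes>\<^sub>M hid (Fo \<tau>))
        = S \<rho> (\<sigma> \<otimes>\<^sub>o \<tau>) \<circ>\<^sub>H (hid (Fo \<rho>) \<otimes>\<^sub>M S \<sigma> \<tau>) \<circ>\<^sub>H hassoc (Fo \<rho>) (Fo \<sigma>) (Fo \<tau>)"
    and S_range: "\<lbrakk>\<rho> \<in> Obj T; \<sigma> \<in> Obj T; \<tau> \<in> Obj T\<rbrakk>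
      \<Longrightarrow> op_le (range_proj (S (\<rho> \<otimes>\<^sub>o \<sigma>) \<tau>) \<circ>\<^sub>H range_proj (S \<rho> (\<sigma> \<otimes>\<^sub>o \<tau>)))
                (range_proj (S (\<rho> \<otimes>\<^sub>o \<sigma>) \<tau> \<circ>\<^sub>H (S \<rho> \<sigma> \<otimes>\<^sub>M hid (Fo \<tau>))))"
    and S_natural: "\<lbrakk>\<rho> \<in> Obj T; \<rho>' \<in> Obj T; \<sigma> \<in> Obj T; \<sigma>' \<in> Obj T;
        A \<in> Hom T \<rho> \<rho>'; B \<in> Hom T \<sigma> \<sigma>'\<rbrakk>
      \<Longrightarrow> F (A \<otimes>\<^sub>a B) \<circ>\<^sub>H S \<rho> \<sigma> = S \<rho>' \<sigma>' \<circ>\<^sub>H (F A \<otimes>\<^sub>M F B)"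

end

(*
  Put S1 = S_{rho rhob, rho}, S2 = S_{rho, rhob rho} and W = S_{rho, rhob, rho}. The range condition
  E1 E2 <= W W^* gives S1^* W W^* S2 = S1^* S2, that is, up to associativity,
  S1^* S2 = (S_{rho, rhob} (x) 1)(1 (x) S_{rhob, rho})^*. Hence the left-hand side of the first
  conjugate equation for the hatted vectors is, by naturality, the map F((Rb^* (x) 1)(1 (x) R)) = 1
  between the unit isomorphisms. The second equation follows by exchanging rho and rhob.

  For finite dimensionality, evaluate both equations on orthonormal bases (e_i) and (k_j): the numbers
  A_ij = cnj(rb(e_i, k_j)) and B_ji = r(k_j, e_i) are square summable with sum_j A_ij B_ji = 1 for each i,
  so sum_i 1 converges and equals the trace of A B; the other equation expresses the number of the k_j
  by the conjugate of the same sum.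

  Riesz representation, orthonormal bases and Parseval's identity are needed for Hilbert spaces on
  carrier sets. Bounded maps between tensor products are obtained from two families of vectors v_i, w_i
  with square-summable coefficients as f |-> sum_i <v_i, f> w_i, where the sum is defined weakly by Riesz.
*)
theory Submission
  imports Defs
begin

section \<open>Hilbert spaces on carrier sets\<close>

text \<open>Finite dimension is a conclusion, so the tensor calculus has to work for arbitrary
  Hilbert spaces. The operators \<open>map_tensor\<close>, \<open>hassoc\<close>,
  \<open>lunit\<close> and \<open>runit\<close> are definite descriptions, hence each needs a proof
  of existence and one of uniqueness. Both become manageable through one fact: evaluating a
  Hilbert-Schmidt form \<open>f\<close> at \<open>(x, y)\<close> is taking its inner product with
  the elementary tensor of \<open>x\<close> and \<open>y\<close>. Identities of vectors and
  operators are therefore checked on matrix elements, where adjoints can be moved freely, and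
  infinite sums of vectors never occur.

  On the categorical side a single number carries the argument: \<open><z, x>\<close> for
  \<open>x\<close> and \<open>z\<close> in \<open>Fo \<rho>\<close>, read as the inner product of
  \<open>F (Rb (x) 1) z\<close> and \<open>F (1 (x) R) x\<close>. Its expression through the hatted
  vectors gives the conjugate equations when \<open>x\<close> and \<open>z\<close> vary, and the
  dimension count when both are the same basis vector.\<close>

context hilbert_space
begin

sublocale cbanach_space "vecs H" "vadd H" "vzero H" "vscale H" "vnorm H"
  by (rule banach)

lemmas vec_closed [simp] = zero_closed add_closed scl_closed

lemma inner_add_left:
  assumes "x \<in> vecs H" "y \<in> vecs H" "z \<in> vecs H"
  shows "vinner H (vadd H x y) z = vinner H x z + vinner H y z"
proof -
  have "vinner H (vadd H x y) z = cnj (vinner H z (vadd H x y))"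
    using assms by (intro inner_commute) auto
  also have "\<dots> = cnj (vinner H z x) + cnj (vinner H z y)"
    using assms by (simp add: inner_add)
  finally show ?thesis
    using assms by (metis inner_commute)
qed

lemma inner_scale_left:
  assumes "x \<in> vecs H" "z \<in> vecs H"
  shows "vinner H (vscale H a x) z = cnj a * vinner H x z"
proof -
  have "vinner H (vscale H a x) z = cnj (vinner H z (vscale H a x))"
    using assms by (intro inner_commute) auto
  also have "\<dots> = cnj a * cnj (vinner H z x)"
    using assms by (simp add: inner_scale)
  finally show ?thesis
    using assms by (metis inner_commute)
qed

lemma inner_zero_right [simp]:
  assumes "x \<in> vecs H" shows "vinner H x (vzero H) = 0"
  using inner_add[OF assms zero_closed zero_closed] add_zero[OF zero_closed] by simp

lemma inner_zero_left [simp]: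
  assumes "x \<in> vecs H" shows "vinner H (vzero H) x = 0"
  using inner_commute[OF zero_closed assms] assms by simp

lemmas inner_simps = inner_add inner_scale inner_add_left inner_scale_left

text \<open>Obtained from definiteness: the inner product of this vector with itself has the factor
  0.\<close>

lemma scl_zero: "x \<in> vecs H \<Longrightarrow> vscale H 0 x = vzero H"
  by (rule inner_eq_zero) (auto simp: inner_simps)

text \<open>Testing the hypothesis on the difference of \<open>x\<close> and \<open>y\<close> makes
  its norm vanish. This is the standard way to compare vectors below, because vectors produced by
  Riesz representation are known only through inner products.\<close>

lemma vec_eqI:
  assumes x: "x \<in> vecs H" and y: "y \<in> vecs H"
    and eq: "\<And>z. z \<in> vecs H \<Longrightarrow> vinner H z x = vinner H z y"
  shows "x = y"
proof -
  let ?d = "vadd H x (vscale H (-1) y)"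
  have "?d = vzero H"
    using eq[of ?d] x y by (intro inner_eq_zero) (auto simp: inner_add inner_scale)
  moreover have "vadd H (vscale H (-1) y) y = vzero H"
    using scl_add_left[OF y, of "-1" 1] y by (simp add: scl_one scl_zero)
  ultimately show ?thesis
    using x y by (metis add_assoc add_comm add_zero scl_closed zero_closed)
qed

lemma vec_eqI_left:
  assumes "x \<in> vecs H" "y \<in> vecs H" "\<And>z. z \<in> vecs H \<Longrightarrow> vinner H x z = vinner H y z"
  shows "x = y"
  using assms by (intro vec_eqI) (metis inner_commute)+

lemma vnorm_power2: "x \<in> vecs H \<Longrightarrow> (vnorm H x)\<^sup>2 = Re (vinner H x x)"
  by (simp add: vnorm_def inner_nonneg)

lemma inner_self: "x \<in> vecs H \<Longrightarrow> vinner H x x = complex_of_real ((vnorm H x)\<^sup>2)"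
  using inner_commute[of x x] by (simp add: vnorm_power2 complex_eq_iff)

lemma vnorm_zero [simp]: "vnorm H (vzero H) = 0"
  by (simp add: vnorm_def)

lemma vnorm_add_power2:
  assumes "x \<in> vecs H" "y \<in> vecs H"
  shows "(vnorm H (vadd H x y))\<^sup>2 = (vnorm H x)\<^sup>2 + (vnorm H y)\<^sup>2 + 2 * Re (vinner H x y)"
  using inner_commute[of y x] assms by (simp add: vnorm_power2 inner_simps)

lemma Cauchy_Schwarz:
  assumes x: "x \<in> vecs H" and y: "y \<in> vecs H"
  shows "cmod (vinner H x y) \<le> vnorm H x * vnorm H y"
proof (cases "vnorm H x = 0")
  case True
  then have "x = vzero H" using x nrm_eq_zero by blast
  then show ?thesis using y by simp
next
  case False
  define n a where "n = (vnorm H x)\<^sup>2" and "a = vinner H x y"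
  have n: "n > 0" using False by (simp add: n_def)
  \<comment> \<open>The coefficient \<open>- a / n\<close> makes this vector the component of
    \<open>y\<close> orthogonal to \<open>x\<close>.\<close>
  have "0 \<le> (vnorm H (vadd H y (vscale H (- a / n) x)))\<^sup>2" by simp
  also have "\<dots> = (vnorm H y)\<^sup>2 + (cmod (a / n))\<^sup>2 * n + 2 * Re (- a / n * cnj a)"
    using x y inner_commute[of y x]
    by (simp add: vnorm_add_power2 nrm_scl power_mult_distrib inner_scale n_def a_def
        norm_divide power_divide)
  also have "Re (- a / n * cnj a) = - (cmod a)\<^sup>2 / n"
    using n by (simp add: cmod_power2 power2_eq_square[of "Re a"] power2_eq_square[of "Im a"] field_simps)
  also have "(cmod (a / n))\<^sup>2 * n = (cmod a)\<^sup>2 / n"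
    using n by (simp add: norm_divide power_divide power2_eq_square)
  finally have "(cmod a)\<^sup>2 / n \<le> (vnorm H y)\<^sup>2" by simp
  then have "(cmod a)\<^sup>2 \<le> (vnorm H x * vnorm H y)\<^sup>2"
    using n by (simp add: field_simps n_def)
  then show ?thesis
    unfolding a_def using nrm_nonneg x y by (metis mult_nonneg_nonneg power2_le_imp_le)
qed

text \<open>The representing vector minimises the functional \<open>\<parallel>x\<parallel>\<^sup>2 - 2 Re (\<phi> x)\<close>.\<close>

lemma Riesz:
  assumes add: "\<And>x y. \<lbrakk>x \<in> vecs H; y \<in> vecs H\<rbrakk> \<Longrightarrow> \<phi> (vadd H x y) = \<phi> x + \<phi> y"
    and scl: "\<And>a x. x \<in> vecs H \<Longrightarrow> \<phi> (vscale H a x) = a * \<phi> x"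
    and bdd: "\<And>x. x \<in> vecs H \<Longrightarrow> cmod (\<phi> x) \<le> C * vnorm H x"
  shows "\<exists>h\<in>vecs H. \<forall>x\<in>vecs H. \<phi> x = vinner H h x"
proof -
  define q where "q x = (vnorm H x)\<^sup>2 - 2 * Re (\<phi> x)" for x
  define s where "s = Inf (q ` vecs H)"
  \<comment> \<open>Completing the square: \<open>q x\<close> is at least
    \<open>(vnorm H x - C)^2 - C^2\<close>.\<close>
  have "q x \<ge> - C\<^sup>2" if "x \<in> vecs H" for x
  proof -
    have "Re (\<phi> x) \<le> C * vnorm H x"
      using bdd[OF that] complex_Re_le_cmod[of "\<phi> x"] by linarith
    moreover have "0 \<le> (vnorm H x - C)\<^sup>2" by simp
    ultimately show ?thesis by (simp add: q_def power2_diff mult.commute)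
  qed
  then have bddb: "bdd_below (q ` vecs H)" by (auto intro!: bdd_belowI)
  have s_le: "s \<le> q x" if "x \<in> vecs H" for x
    unfolding s_def using that bddb by (intro cInf_lower) auto
  have "\<exists>x\<in>vecs H. q x < s + 1 / Suc n" for n
  proof (rule ccontr)
    assume "\<not> ?thesis"
    then have "s + 1 / Suc n \<le> Inf (q ` vecs H)"
      using zero_closed by (intro cInf_greatest) (force simp: not_less)+
    then show False by (simp add: s_def)
  qed
  then obtain X where X: "\<And>n. X n \<in> vecs H" and qX: "\<And>n. q (X n) < s + 1 / Suc n"
    by metis
  \<comment> \<open>The parallelogram law for \<open>q\<close>: by additivity of
    \<open>\<phi>\<close> the linear terms of the two points and of their midpoint cancel. As the
    midpoint has value at least \<open>s\<close>, a minimising sequence is Cauchy.\<close>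
  have par: "(vnorm H (vadd H x (vscale H (-1) y)))\<^sup>2
      = 2 * q x + 2 * q y - 4 * q (vscale H (1/2) (vadd H x y))"
    if "x \<in> vecs H" "y \<in> vecs H" for x y
    using that inner_commute[of y x]
    by (simp add: q_def add scl vnorm_power2 inner_simps field_simps)
  have dist: "(vnorm H (vadd H (X m) (vscale H (-1) (X n))))\<^sup>2 \<le> 2 / Suc m + 2 / Suc n" for m n
    using par[of "X m" "X n"] qX[of m] qX[of n] X
      s_le[of "vscale H (1/2) (vadd H (X m) (X n))"] by simp
  have "\<exists>h\<in>vecs H. (\<lambda>n. vnorm H (vadd H (X n) (vscale H (-1) h))) \<longlonglongrightarrow> 0"
  proof (rule nrm_complete[OF X])
    fix e :: real assume e: "e > 0"
    obtain N where N: "4 / e\<^sup>2 < real N" using reals_Archimedean2 by blast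
    have "vnorm H (vadd H (X m) (vscale H (-1) (X n))) < e" if "m \<ge> N" "n \<ge> N" for m n
    proof -
      have p: "0 < 4 / e\<^sup>2" using e by simp
      then have N0: "0 < real N" using N by linarith
      have "2 / Suc k < e\<^sup>2 / 2" if "k \<ge> N" for k
      proof -
        have "4 / e\<^sup>2 < real (Suc k)" using N that by linarith
        then show ?thesis using e by (simp add: field_simps)
      qed
      from this[OF that(1)] this[OF that(2)]
      have "(vnorm H (vadd H (X m) (vscale H (-1) (X n))))\<^sup>2 < e\<^sup>2"
        using dist[of m n] by linarith
      then show ?thesis using e by (meson less_eq_real_def power2_less_imp_less)
    qed
    then show "\<exists>N. \<forall>m\<ge>N. \<forall>n\<ge>N. vnorm H (vadd H (X m) (vscale H (-1) (X n))) < e" by blast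
  qed
  then obtain h where h: "h \<in> vecs H"
    and lim: "(\<lambda>n. vnorm H (vadd H (X n) (vscale H (-1) h))) \<longlonglongrightarrow> 0" by blast
  define Y where "Y n = vadd H (X n) (vscale H (-1) h)" for n
  have Y: "Y n \<in> vecs H" for n using X h by (simp add: Y_def)
  \<comment> \<open>Expansion of \<open>q\<close> around the limit \<open>h\<close>. The cross terms
    are bounded by a multiple of \<open>vnorm H (Y n)\<close>, so in the limit \<open>h\<close>
    attains the infimum.\<close>
  have "q (X n) = q h + (vnorm H (Y n))\<^sup>2 + 2 * Re (vinner H h (Y n)) - 2 * Re (\<phi> (Y n))" for n
    using X[of n] h inner_commute[of h "X n"]
    by (simp add: q_def Y_def add scl vnorm_power2 inner_simps)
  moreover have "Re (vinner H h (Y n)) \<ge> - (vnorm H h * vnorm H (Y n))" for n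
    using Cauchy_Schwarz[OF h Y, of n] abs_Re_le_cmod[of "vinner H h (Y n)"] by linarith
  moreover have "Re (\<phi> (Y n)) \<le> C * vnorm H (Y n)" for n
    using bdd[OF Y, of n] abs_Re_le_cmod[of "\<phi> (Y n)"] by linarith
  ultimately have "q h \<le> q (X n) + 2 * (vnorm H h + C) * vnorm H (Y n)" for n
    using zero_le_power2[of "vnorm H (Y n)"] by (smt (verit) distrib_right mult.assoc)
  then have "q h \<le> (s + 1 / Suc n) + 2 * (vnorm H h + C) * vnorm H (Y n)" for n
    using qX[of n] by (smt (verit))
  moreover have "(\<lambda>n. (s + 1 / Suc n) + 2 * (vnorm H h + C) * vnorm H (Y n))
      \<longlonglongrightarrow> (s + 0) + 2 * (vnorm H h + C) * 0"
    using lim LIMSEQ_inverse_real_of_nat unfolding Y_def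
    by (intro tendsto_intros) (simp_all add: inverse_eq_divide)
  ultimately have "q h \<le> s"
    by (intro LIMSEQ_le_const[where a = "q h"]) auto
  have Re_eq: "Re (vinner H h y) = Re (\<phi> y)" if y: "y \<in> vecs H" for y
  proof -
    define d where "d = Re (vinner H h y) - Re (\<phi> y)"
    have pos: "0 \<le> 2 * t * d + t\<^sup>2 * (vnorm H y)\<^sup>2" for t :: real
    proof -
      have "q (vadd H h (vscale H t y)) = q h + 2 * t * d + t\<^sup>2 * (vnorm H y)\<^sup>2"
        using h y
        by (simp add: q_def d_def add scl vnorm_add_power2 nrm_scl inner_scale power_mult_distrib algebra_simps)
      then show ?thesis
        using s_le[of "vadd H h (vscale H t y)"] \<open>q h \<le> s\<close> h y by simp
    qed
    \<comment> \<open>Nonnegativity of the polynomial in \<open>t\<close> forces its linear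
      coefficient to vanish. The added 1 keeps the denominator of the test value
      \<open>t = - d / m\<close> positive when \<open>y\<close> is zero.\<close>
    define m where "m = (vnorm H y)\<^sup>2 + 1"
    have m: "m > 0" "(vnorm H y)\<^sup>2 = m - 1" by (auto simp: m_def add_nonneg_pos)
    have "2 * (- d / m) * d + (- d / m)\<^sup>2 * (m - 1) = - (d\<^sup>2 / m) - (d / m)\<^sup>2"
      using m(1) by (simp add: field_simps power2_eq_square)
    then have "d\<^sup>2 / m + (d / m)\<^sup>2 \<le> 0"
      using pos[of "- d / m"] unfolding m(2) by linarith
    then have "d = 0" using m(1)
      by (smt (verit) divide_nonneg_pos divide_eq_0_iff power2_eq_iff zero_le_power2 zero_eq_power2)
    then show ?thesis by (simp add: d_def)
  qed
  \<comment> \<open>Real parts determine everything: at \<open>- \<i>\<close> times \<open>y\<close>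
    they are the imaginary parts at \<open>y\<close>.\<close>
  have "\<phi> y = vinner H h y" if y: "y \<in> vecs H" for y
    using Re_eq[OF y] Re_eq[of "vscale H (- \<i>) y"] y h
    by (simp add: complex_eq_iff scl inner_scale)
  then show ?thesis using h by blast
qed

end

section \<open>Bounded maps and orthonormal bases\<close>

lemma bounded_maps_src: "A \<in> bounded_maps H K \<Longrightarrow> src A = H"
  and bounded_maps_tgt: "A \<in> bounded_maps H K \<Longrightarrow> tgt A = K"
  and act_closed: "A \<in> bounded_maps H K \<Longrightarrow> x \<in> vecs H \<Longrightarrow> act A x \<in> vecs K"
  and act_add: "A \<in> bounded_maps H K \<Longrightarrow> x \<in> vecs H \<Longrightarrow> y \<in> vecs H
    \<Longrightarrow> act A (vadd H x y) = vadd K (act A x) (act A y)"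
  and act_scale: "A \<in> bounded_maps H K \<Longrightarrow> x \<in> vecs H
    \<Longrightarrow> act A (vscale H a x) = vscale K a (act A x)"
  by (auto simp: bounded_maps_def)

lemma bounded_maps_eqI:
  assumes "A \<in> bounded_maps H K" "B \<in> bounded_maps H K"
    and "\<And>x. x \<in> vecs H \<Longrightarrow> act A x = act B x"
  shows "A = B"
proof -
  have "act A = act B"
    proof (rule extensionalityI)
    show "act A \<in> extensional (vecs H)" "act B \<in> extensional (vecs H)"
      using assms(1,2) by (simp_all add: bounded_maps_def PiE_def)
  qed (rule assms(3))
  then show ?thesis
    using assms(1,2) by (intro hmap.equality) (simp_all add: bounded_maps_def)
qed

lemma restrict_bounded_maps:
  assumes "\<And>x. x \<in> vecs H \<Longrightarrow> f x \<in> vecs K"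
    and "\<And>x y. x \<in> vecs H \<Longrightarrow> y \<in> vecs H \<Longrightarrow> f (vadd H x y) = vadd K (f x) (f y)"
    and "\<And>a x. x \<in> vecs H \<Longrightarrow> f (vscale H a x) = vscale K a (f x)"
    and "\<And>x. x \<in> vecs H \<Longrightarrow> vnorm K (f x) \<le> C * vnorm H x"
    and "hilbert_space H"
  shows "\<lparr>src = H, tgt = K, act = restrict f (vecs H)\<rparr> \<in> bounded_maps H K"
proof -
  interpret hilbert_space H by fact
  show ?thesis using assms(1-4) unfolding bounded_maps_def by fastforce
qed

lemma bounded_maps_bound:
  assumes "A \<in> bounded_maps H K" and "hilbert_space H"
  obtains C where "C \<ge> 0" and "\<And>x. x \<in> vecs H \<Longrightarrow> vnorm K (act A x) \<le> C * vnorm H x"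
proof -
  interpret hilbert_space H by fact
  have "\<exists>C. \<forall>x\<in>vecs H. vnorm K (act A x) \<le> C * vnorm H x"
    using assms(1) by (auto simp: bounded_maps_def)
  then obtain C where C: "\<And>x. x \<in> vecs H \<Longrightarrow> vnorm K (act A x) \<le> C * vnorm H x"
    by blast
  have "vnorm K (act A x) \<le> \<bar>C\<bar> * vnorm H x" if "x \<in> vecs H" for x
    using C[OF that] nrm_nonneg[OF that] by (smt (verit) mult_right_mono)
  then show ?thesis using that by (metis abs_ge_zero)
qed

lemma act_hid: "x \<in> vecs H \<Longrightarrow> act (hid H) x = x"
  by (simp add: hid_def)

lemma hid_bounded: "hilbert_space H \<Longrightarrow> hid H \<in> bounded_maps H H"
  unfolding hid_def
  by (rule restrict_bounded_maps[where C = 1]) auto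

lemma act_hcomp: "B \<in> bounded_maps H K \<Longrightarrow> x \<in> vecs H \<Longrightarrow> act (A \<circ>\<^sub>H B) x = act A (act B x)"
  by (simp add: hcomp_def bounded_maps_src)

lemma hcomp_bounded:
  assumes A: "A \<in> bounded_maps K L" and B: "B \<in> bounded_maps H K"
    and H: "hilbert_space H" and K: "hilbert_space K"
  shows "A \<circ>\<^sub>H B \<in> bounded_maps H L"
proof -
  obtain C where C: "C \<ge> 0" "\<And>x. x \<in> vecs K \<Longrightarrow> vnorm L (act A x) \<le> C * vnorm K x"
    using bounded_maps_bound[OF A K] by blast
  obtain D where D: "D \<ge> 0" "\<And>x. x \<in> vecs H \<Longrightarrow> vnorm K (act B x) \<le> D * vnorm H x"
    using bounded_maps_bound[OF B H] by blast
  have "vnorm L (act A (act B x)) \<le> C * D * vnorm H x" if "x \<in> vecs H" for x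
    using C(2)[OF act_closed[OF B that]] mult_left_mono[OF D(2)[OF that] C(1)] by simp
  then have "\<lparr>src = H, tgt = L, act = \<lambda>x\<in>vecs H. act A (act B x)\<rparr> \<in> bounded_maps H L"
    using A B H by (intro restrict_bounded_maps)
      (auto simp: act_closed[OF A] act_closed[OF B] act_add[OF A] act_add[OF B]
        act_scale[OF A] act_scale[OF B])
  then show ?thesis
    using A B by (simp add: hcomp_def bounded_maps_src bounded_maps_tgt)
qed

text \<open>The common source of operators that are given by their matrix elements: Riesz is applied
  for each fixed \<open>x\<close>, and linearity in \<open>x\<close> follows because the
  representing vector is unique.\<close>

lemma bounded_map_of_form:
  assumes H: "hilbert_space H" and K: "hilbert_space K"
    and add2: "\<And>x y y'. \<lbrakk>x \<in> vecs H; y \<in> vecs K; y' \<in> vecs K\<rbrakk>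
      \<Longrightarrow> \<phi> x (vadd K y y') = \<phi> x y + \<phi> x y'"
    and scl2: "\<And>a x y. \<lbrakk>x \<in> vecs H; y \<in> vecs K\<rbrakk> \<Longrightarrow> \<phi> x (vscale K a y) = a * \<phi> x y"
    and add1: "\<And>x x' y. \<lbrakk>x \<in> vecs H; x' \<in> vecs H; y \<in> vecs K\<rbrakk>
      \<Longrightarrow> \<phi> (vadd H x x') y = \<phi> x y + \<phi> x' y"
    and scl1: "\<And>a x y. \<lbrakk>x \<in> vecs H; y \<in> vecs K\<rbrakk> \<Longrightarrow> \<phi> (vscale H a x) y = cnj a * \<phi> x y"
    and bdd: "\<And>x y. \<lbrakk>x \<in> vecs H; y \<in> vecs K\<rbrakk> \<Longrightarrow> cmod (\<phi> x y) \<le> C * vnorm H x * vnorm K y"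
  shows "\<exists>A\<in>bounded_maps H K. \<forall>x\<in>vecs H. \<forall>y\<in>vecs K. vinner K (act A x) y = \<phi> x y"
proof -
  interpret H: hilbert_space H by fact
  interpret K: hilbert_space K by fact
  have "\<exists>h\<in>vecs K. \<forall>y\<in>vecs K. \<phi> x y = vinner K h y" if x: "x \<in> vecs H" for x
    using x by (intro K.Riesz[where C = "C * vnorm H x"]) (auto simp: add2 scl2 bdd)
  then obtain f where f: "\<And>x. x \<in> vecs H \<Longrightarrow> f x \<in> vecs K"
    and f_inner: "\<And>x y. x \<in> vecs H \<Longrightarrow> y \<in> vecs K \<Longrightarrow> vinner K (f x) y = \<phi> x y"
    by metis
  \<comment> \<open>Inserting \<open>y = f x\<close> into the form bounds the square norm of
    \<open>f x\<close> by \<open>C\<close> times both norms, and one factor cancels. The absolute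
    value settles the case where \<open>f x\<close> has norm 0 and \<open>C\<close> may be
    negative.\<close>
  have bound: "vnorm K (f x) \<le> \<bar>C\<bar> * vnorm H x" if x: "x \<in> vecs H" for x
  proof (cases "vnorm K (f x) = 0")
    case False
    have "(vnorm K (f x))\<^sup>2 = cmod (\<phi> x (f x))"
      using f_inner[OF x f[OF x]] K.inner_self[OF f[OF x]] by (metis norm_of_real abs_power2)
    also have "\<dots> \<le> C * vnorm H x * vnorm K (f x)" by (rule bdd) (auto simp: x f)
    finally have "vnorm K (f x) \<le> C * vnorm H x"
      using False K.nrm_nonneg[OF f[OF x]] by (simp add: power2_eq_square)
    also have "\<dots> \<le> \<bar>C\<bar> * vnorm H x" using H.nrm_nonneg[OF x] by (simp add: mult_right_mono)
    finally show ?thesis .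
  qed (simp add: H.nrm_nonneg x)
  have "\<lparr>src = H, tgt = K, act = restrict f (vecs H)\<rparr> \<in> bounded_maps H K"
    by (rule restrict_bounded_maps[OF f _ _ bound H];
        (assumption | rule K.vec_eqI_left, simp_all add: f f_inner K.inner_simps add1 scl1))
  moreover have "vinner K (act \<lparr>src = H, tgt = K, act = restrict f (vecs H)\<rparr> x) y = \<phi> x y"
    if "x \<in> vecs H" "y \<in> vecs K" for x y
    using that f_inner by simp
  ultimately show ?thesis by blast
qed

text \<open>A vector is determined by its inner products, so at each \<open>y\<close> the definite
  description in \<open>hadj\<close> has only one possible value. The existence proof for adjoints
  and the computation of explicit ones rest on this criterion.\<close>

lemma hadj_eqI:
  assumes H: "hilbert_space H" and A: "A \<in> bounded_maps H K" and B: "B \<in> bounded_maps K H"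
    and eq: "\<And>x y. \<lbrakk>x \<in> vecs H; y \<in> vecs K\<rbrakk> \<Longrightarrow> vinner H (act B y) x = vinner K y (act A x)"
  shows "hadj A = B"
proof -
  interpret hilbert_space H by fact
  have "(THE x. x \<in> vecs (src A) \<and>
      (\<forall>z\<in>vecs (src A). vinner (src A) x z = vinner (tgt A) y (act A z))) = act B y"
    if y: "y \<in> vecs K" for y
    using y act_closed[OF B y]
    by (intro the_equality) (auto simp: bounded_maps_src[OF A] bounded_maps_tgt[OF A] eq
        intro!: vec_eqI_left)
  then have "act (hadj A) y = act B y" for y
    using B by (auto simp: hadj_def bounded_maps_tgt[OF A] bounded_maps_def PiE_def extensional_def)
  then show ?thesis
    using A B by (intro hmap.equality)
      (auto simp: hadj_def bounded_maps_tgt bounded_maps_src)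
qed

lemma
  assumes H: "hilbert_space H" and K: "hilbert_space K" and A: "A \<in> bounded_maps H K"
  shows hadj_bounded: "hadj A \<in> bounded_maps K H"
    and inner_hadj_left: "\<lbrakk>x \<in> vecs H; y \<in> vecs K\<rbrakk>
      \<Longrightarrow> vinner H (act (hadj A) y) x = vinner K y (act A x)"
proof -
  interpret H: hilbert_space H by fact
  interpret K: hilbert_space K by fact
  obtain C where C: "\<And>x. x \<in> vecs H \<Longrightarrow> vnorm K (act A x) \<le> C * vnorm H x"
    using bounded_maps_bound[OF A H] by blast
  have "cmod (vinner K y (act A x)) \<le> C * vnorm K y * vnorm H x"
    if "y \<in> vecs K" "x \<in> vecs H" for x y
    using K.Cauchy_Schwarz[OF that(1) act_closed[OF A that(2)]]
      mult_left_mono[OF C[OF that(2)] K.nrm_nonneg[OF that(1)]] by (simp add: mult_ac)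
  then have "\<exists>B\<in>bounded_maps K H. \<forall>y\<in>vecs K. \<forall>x\<in>vecs H. vinner H (act B y) x = vinner K y (act A x)"
    by (intro bounded_map_of_form[OF K H])
      (auto simp: act_closed[OF A] act_add[OF A] act_scale[OF A] K.inner_simps)
  then obtain B where "B \<in> bounded_maps K H"
    "\<And>y x. \<lbrakk>y \<in> vecs K; x \<in> vecs H\<rbrakk> \<Longrightarrow> vinner H (act B y) x = vinner K y (act A x)"
    by blast
  moreover from this have "hadj A = B" by (intro hadj_eqI[OF H A]) auto
  ultimately show "hadj A \<in> bounded_maps K H"
    and "\<lbrakk>x \<in> vecs H; y \<in> vecs K\<rbrakk> \<Longrightarrow> vinner H (act (hadj A) y) x = vinner K y (act A x)"
    by auto
qed

lemma inner_hadj_right: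
  assumes H: "hilbert_space H" and K: "hilbert_space K" and A: "A \<in> bounded_maps H K"
    and x: "x \<in> vecs H" and y: "y \<in> vecs K"
  shows "vinner H x (act (hadj A) y) = vinner K (act A x) y"
  using inner_hadj_left[OF H K A x y] x y act_closed[OF A x] act_closed[OF hadj_bounded[OF H K A] y]
    hilbert_space.inner_commute[OF H] hilbert_space.inner_commute[OF K] by metis

lemma hadj_hadj:
  assumes "hilbert_space H" "hilbert_space K" "A \<in> bounded_maps H K"
  shows "hadj (hadj A) = A"
  using assms by (intro hadj_eqI[where H = K and K = H]) (simp_all add: hadj_bounded inner_hadj_right)

lemma hadj_hcomp:
  assumes "hilbert_space H" "hilbert_space K" "hilbert_space L"
    and "A \<in> bounded_maps K L" "B \<in> bounded_maps H K"
  shows "hadj (A \<circ>\<^sub>H B) = hadj B \<circ>\<^sub>H hadj A"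
proof (rule hadj_eqI)
  show "hadj B \<circ>\<^sub>H hadj A \<in> bounded_maps L H"
    using assms by (intro hcomp_bounded[where K = K] hadj_bounded)
  show "vinner H (act (hadj B \<circ>\<^sub>H hadj A) y) x = vinner L y (act (A \<circ>\<^sub>H B) x)"
    if "x \<in> vecs H" "y \<in> vecs L" for x y
    using that assms
    by (simp add: act_hcomp[OF hadj_bounded] act_hcomp inner_hadj_left act_closed[OF hadj_bounded] act_closed)
qed (use assms in \<open>auto intro: hcomp_bounded\<close>)

section \<open>Square-summable coefficients, Bessel families and Parseval's identity\<close>

lemma product_l2:
  fixes f g :: "'i \<Rightarrow> complex"
  assumes f: "\<And>F. finite F \<Longrightarrow> F \<subseteq> I \<Longrightarrow> (\<Sum>i\<in>F. (cmod (f i))\<^sup>2) \<le> a\<^sup>2" and "a \<ge> 0"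
    and g: "\<And>F. finite F \<Longrightarrow> F \<subseteq> I \<Longrightarrow> (\<Sum>i\<in>F. (cmod (g i))\<^sup>2) \<le> b\<^sup>2" and "b \<ge> 0"
  shows "(\<lambda>i. cmod (f i * g i)) summable_on I" and "(\<lambda>i. f i * g i) summable_on I"
    and "cmod (\<Sum>\<^sub>\<infinity>i\<in>I. f i * g i) \<le> a * b"
proof -
  \<comment> \<open>Cauchy-Schwarz on finite index sets bounds the absolute sums uniformly. The
    hypotheses speak of finite sums because Bessel's inequality delivers them in this form.\<close>
  have fin: "(\<Sum>i\<in>F. cmod (f i * g i)) \<le> a * b" if "finite F" "F \<subseteq> I" for F
  proof -
    have "L2_set (cmod \<circ> f) F \<le> a" "L2_set (cmod \<circ> g) F \<le> b"
      using f[OF that] g[OF that] \<open>a \<ge> 0\<close> \<open>b \<ge> 0\<close> by (auto simp: L2_set_def intro: real_le_lsqrt)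
    then have "L2_set (cmod \<circ> f) F * L2_set (cmod \<circ> g) F \<le> a * b"
      using \<open>a \<ge> 0\<close> by (intro mult_mono) auto
    then show ?thesis
      using L2_set_mult_ineq[of "cmod \<circ> f" "cmod \<circ> g" F] by (simp add: norm_mult)
  qed
  show abs: "(\<lambda>i. cmod (f i * g i)) summable_on I"
    using fin by (intro nonneg_bdd_above_summable_on) (auto intro!: bdd_aboveI2)
  then show "(\<lambda>i. f i * g i) summable_on I" by (rule abs_summable_summable)
  have "cmod (\<Sum>\<^sub>\<infinity>i\<in>I. f i * g i) \<le> (\<Sum>\<^sub>\<infinity>i\<in>I. cmod (f i * g i))"
    using abs by (rule norm_infsum_bound)
  also have "\<dots> \<le> a * b" using abs fin by (rule infsum_le_finite_sums)
  finally show "cmod (\<Sum>\<^sub>\<infinity>i\<in>I. f i * g i) \<le> a * b" .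
qed

text \<open>A Bessel sequence in the sense of frame theory: the coefficient map of \<open>v\<close>
  is bounded into l2 with norm at most \<open>C\<close>, the square root of the customary Bessel
  bound. Families are used instead of sets since elementary tensors with different indices can
  coincide.\<close>

definition bessel_family :: "'a hilb \<Rightarrow> 'i set \<Rightarrow> ('i \<Rightarrow> 'a) \<Rightarrow> real \<Rightarrow> bool" where
  "bessel_family H I v C \<longleftrightarrow> (\<forall>i\<in>I. v i \<in> vecs H) \<and> C \<ge> 0 \<and>
     (\<forall>x\<in>vecs H. \<forall>F. finite F \<longrightarrow> F \<subseteq> I \<longrightarrow>
       (\<Sum>i\<in>F. (cmod (vinner H (v i) x))\<^sup>2) \<le> (C * vnorm H x)\<^sup>2)"

definition orthonormal_family :: "'a hilb \<Rightarrow> 'i set \<Rightarrow> ('i \<Rightarrow> 'a) \<Rightarrow> bool" where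
  "orthonormal_family H I v \<longleftrightarrow> (\<forall>i\<in>I. v i \<in> vecs H) \<and>
     (\<forall>i\<in>I. \<forall>j\<in>I. vinner H (v i) (v j) = (if i = j then 1 else 0))"

text \<open>Density of the span, expressed through a zero orthogonal complement as in
  \<open>is_onb\<close>.\<close>

definition total_family :: "'a hilb \<Rightarrow> 'i set \<Rightarrow> ('i \<Rightarrow> 'a) \<Rightarrow> bool" where
  "total_family H I v \<longleftrightarrow> (\<forall>i\<in>I. v i \<in> vecs H) \<and>
     (\<forall>x\<in>vecs H. (\<forall>i\<in>I. vinner H (v i) x = 0) \<longrightarrow> x = vzero H)"

lemma total_family_eqI:
  assumes "hilbert_space H" "total_family H I v" "x \<in> vecs H" "y \<in> vecs H"
    and eq: "\<And>i. i \<in> I \<Longrightarrow> vinner H (v i) x = vinner H (v i) y"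
  shows "x = y"
proof -
  interpret hilbert_space H by fact
  have v: "v i \<in> vecs H" if "i \<in> I" for i using assms(2) that by (simp add: total_family_def)
  have "vadd H x (vscale H (-1) y) = vzero H"
    using assms v by (auto simp: total_family_def inner_simps)
  then have "vinner H z (vadd H x (vscale H (-1) y)) = 0" if "z \<in> vecs H" for z
    using that by simp
  then show ?thesis using assms by (intro vec_eqI) (simp_all add: inner_simps)
qed

text \<open>Induction that peels off one vector: removing from \<open>x\<close> its component along
  \<open>v j\<close> leaves the other coefficients unchanged and lowers the square norm by exactly
  the square of the removed coefficient. The vector changes on the way, hence the induction over
  arbitrary \<open>x\<close>.\<close>

lemma orthonormal_family_bessel:
  assumes H: "hilbert_space H" and v: "orthonormal_family H I v"
  shows "bessel_family H I v 1"
proof -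
  interpret hilbert_space H by fact
  have "(\<Sum>i\<in>F. (cmod (vinner H (v i) x))\<^sup>2) \<le> (vnorm H x)\<^sup>2"
    if "finite F" "F \<subseteq> I" "x \<in> vecs H" for F x
    using that
  proof (induction F arbitrary: x rule: finite_induct)
    case (insert j F)
    define c where "c = vinner H (v j) x"
    define y where "y = vadd H x (vscale H (- c) (v j))"
    have vj: "v j \<in> vecs H" and y: "y \<in> vecs H" and vjj: "vinner H (v j) (v j) = 1"
      using insert.prems v by (auto simp: orthonormal_family_def y_def)
    have "vinner H (v i) y = vinner H (v i) x" if "i \<in> F" for i
    proof -
      have "v i \<in> vecs H" "vinner H (v i) (v j) = 0"
        using that insert.prems insert.hyps v by (auto simp: orthonormal_family_def subset_iff)
      then show ?thesis using vj insert.prems by (simp add: y_def inner_simps)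
    qed
    then have "(\<Sum>i\<in>F. (cmod (vinner H (v i) x))\<^sup>2) = (\<Sum>i\<in>F. (cmod (vinner H (v i) y))\<^sup>2)"
      by (intro sum.cong) simp_all
    also have "\<dots> \<le> (vnorm H y)\<^sup>2"
      using insert.prems by (intro insert.IH y) simp
    finally have "(\<Sum>i\<in>F. (cmod (vinner H (v i) x))\<^sup>2) \<le> (vnorm H y)\<^sup>2" .
    moreover have "(vnorm H y)\<^sup>2 = (vnorm H x)\<^sup>2 - (cmod c)\<^sup>2"
    proof -
      have "Re (c * cnj c) = (cmod c)\<^sup>2" by (simp flip: complex_norm_square)
      moreover have "(vnorm H (v j))\<^sup>2 = 1" using vj vjj by (simp add: vnorm_power2)
      ultimately show ?thesis
        using insert.prems vj inner_commute[of x "v j"]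
        by (simp add: y_def vnorm_add_power2 nrm_scl power_mult_distrib inner_scale flip: c_def)
    qed
    ultimately show ?case using insert.hyps by (simp add: c_def)
  qed simp
  then show ?thesis using v by (simp add: bessel_family_def orthonormal_family_def)
qed

text \<open>The sesquilinear form is absolutely summable by Cauchy-Schwarz for the two coefficient
  families. The conclusion is a \<open>has_sum\<close> so that the series can later be compared with
  Parseval's by uniqueness of sums.\<close>

lemma bounded_map_of_families:
  assumes H: "hilbert_space H" and K: "hilbert_space K"
    and v: "bessel_family H I v C" and w: "bessel_family K I w D"
  shows "\<exists>A\<in>bounded_maps H K. \<forall>x\<in>vecs H. \<forall>y\<in>vecs K.
    ((\<lambda>i. vinner H x (v i) * vinner K (w i) y) has_sum vinner K (act A x) y) I"
proof -
  interpret H: hilbert_space H by fact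
  interpret K: hilbert_space K by fact
  have vI: "v i \<in> vecs H" and wI: "w i \<in> vecs K" if "i \<in> I" for i
    using v w that by (auto simp: bessel_family_def)
  define \<phi> where "\<phi> x y = (\<Sum>\<^sub>\<infinity>i\<in>I. vinner H x (v i) * vinner K (w i) y)" for x y
  have sum_v: "(\<Sum>i\<in>F. (cmod (vinner H x (v i)))\<^sup>2) \<le> (C * vnorm H x)\<^sup>2"
    if "x \<in> vecs H" "finite F" "F \<subseteq> I" for x F
  proof -
    have "(\<Sum>i\<in>F. (cmod (vinner H x (v i)))\<^sup>2) = (\<Sum>i\<in>F. (cmod (vinner H (v i) x))\<^sup>2)"
      using that vI H.inner_commute[OF that(1)] by (intro sum.cong) (auto simp: subset_iff)
    then show ?thesis using v that by (simp add: bessel_family_def)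
  qed
  have sum_w: "(\<Sum>i\<in>F. (cmod (vinner K (w i) y))\<^sup>2) \<le> (D * vnorm K y)\<^sup>2"
    if "y \<in> vecs K" "finite F" "F \<subseteq> I" for y F
    using w that by (simp add: bessel_family_def)
  have pos: "0 \<le> C * vnorm H x" "0 \<le> D * vnorm K y" if "x \<in> vecs H" "y \<in> vecs K" for x y
    using v w that H.nrm_nonneg K.nrm_nonneg by (auto simp: bessel_family_def)
  have summable: "(\<lambda>i. vinner H x (v i) * vinner K (w i) y) summable_on I"
    and bound: "cmod (\<phi> x y) \<le> C * vnorm H x * (D * vnorm K y)"
    if "x \<in> vecs H" "y \<in> vecs K" for x y
    unfolding \<phi>_def using that pos
    by (auto intro!: product_l2[where a = "C * vnorm H x" and b = "D * vnorm K y"] sum_v sum_w)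
  have "\<phi> x (vadd K y y') = \<phi> x y + \<phi> x y'"
    if "x \<in> vecs H" "y \<in> vecs K" "y' \<in> vecs K" for x y y'
    unfolding \<phi>_def using that summable
    by (subst infsum_add[symmetric]) (auto intro!: infsum_cong simp: wI K.inner_add distrib_left)
  moreover have "\<phi> x (vscale K a y) = a * \<phi> x y" if "x \<in> vecs H" "y \<in> vecs K" for a x y
    unfolding \<phi>_def using that
    by (subst infsum_cmult_right'[symmetric]) (auto intro!: infsum_cong simp: wI K.inner_scale)
  moreover have "\<phi> (vadd H x x') y = \<phi> x y + \<phi> x' y"
    if "x \<in> vecs H" "x' \<in> vecs H" "y \<in> vecs K" for x x' y
    unfolding \<phi>_def using that summable
    by (subst infsum_add[symmetric]) (auto intro!: infsum_cong simp: vI H.inner_add_left distrib_right)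
  moreover have "\<phi> (vscale H a x) y = cnj a * \<phi> x y" if "x \<in> vecs H" "y \<in> vecs K" for a x y
    unfolding \<phi>_def using that
    by (subst infsum_cmult_right'[symmetric]) (auto intro!: infsum_cong simp: vI H.inner_scale_left)
  moreover have "cmod (\<phi> x y) \<le> C * D * vnorm H x * vnorm K y" if "x \<in> vecs H" "y \<in> vecs K" for x y
    using bound[OF that] by (simp add: mult_ac)
  ultimately have "\<exists>A\<in>bounded_maps H K. \<forall>x\<in>vecs H. \<forall>y\<in>vecs K. vinner K (act A x) y = \<phi> x y"
    by (rule bounded_map_of_form[OF H K])
  then obtain A where "A \<in> bounded_maps H K"
    and A: "\<And>x y. \<lbrakk>x \<in> vecs H; y \<in> vecs K\<rbrakk> \<Longrightarrow> vinner K (act A x) y = \<phi> x y"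
    by blast
  moreover have "((\<lambda>i. vinner H x (v i) * vinner K (w i) y) has_sum vinner K (act A x) y) I"
    if "x \<in> vecs H" "y \<in> vecs K" for x y
    unfolding A[OF that] \<phi>_def using summable[OF that] by (rule has_sum_infsum)
  ultimately show ?thesis by blast
qed

text \<open>The map \<open>bounded_map_of_families\<close> attaches to \<open>v\<close> and \<open>v\<close> preserves all coefficients, so it
  is the identity.\<close>

lemma Parseval:
  assumes H: "hilbert_space H" and v: "orthonormal_family H I v" and tot: "total_family H I v"
    and x: "x \<in> vecs H" and y: "y \<in> vecs H"
  shows "((\<lambda>i. vinner H x (v i) * vinner H (v i) y) has_sum vinner H x y) I"
proof -
  interpret hilbert_space H by fact
  have vI: "v i \<in> vecs H" if "i \<in> I" for i using tot that by (simp add: total_family_def)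
  note b = orthonormal_family_bessel[OF H v]
  obtain A where A: "A \<in> bounded_maps H H" and sum: "\<And>x y. \<lbrakk>x \<in> vecs H; y \<in> vecs H\<rbrakk>
      \<Longrightarrow> ((\<lambda>i. vinner H x (v i) * vinner H (v i) y) has_sum vinner H (act A x) y) I"
    using bounded_map_of_families[OF H H b b] by blast
  have "vinner H (act A x) (v j) = vinner H x (v j)" if j: "j \<in> I" for j
  proof -
    \<comment> \<open>By orthonormality only the term \<open>i = j\<close> survives.\<close>
    have "((\<lambda>i. vinner H x (v i) * vinner H (v i) (v j)) has_sum vinner H x (v j)) {j}"
      using j v by (simp add: has_sum_finite_iff orthonormal_family_def)
    then have "((\<lambda>i. vinner H x (v i) * vinner H (v i) (v j)) has_sum vinner H x (v j)) I"
      using j v by (subst (asm) has_sum_cong_neutral[where T = I]) (auto simp: orthonormal_family_def)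
    then show ?thesis using sum[OF x vI[OF j]] has_sum_unique by blast
  qed
  then have "act A x = x"
    using x vI act_closed[OF A x] inner_commute
    by (intro total_family_eqI[OF H tot]) metis+
  then show ?thesis using sum[OF x y] by simp
qed

lemma Parseval_norm:
  assumes "hilbert_space H" "orthonormal_family H I v" "total_family H I v" and x: "x \<in> vecs H"
  shows "((\<lambda>i. (cmod (vinner H (v i) x))\<^sup>2) has_sum (vnorm H x)\<^sup>2) I"
proof -
  interpret hilbert_space H by fact
  have vI: "v i \<in> vecs H" if "i \<in> I" for i using assms(3) that by (simp add: total_family_def)
  have "((\<lambda>i. vinner H x (v i) * vinner H (v i) x) has_sum of_real ((vnorm H x)\<^sup>2)) I"
    using Parseval[OF assms x] by (simp add: inner_self[OF x])
  moreover have "vinner H x (v i) * vinner H (v i) x = of_real ((cmod (vinner H (v i) x))\<^sup>2)"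
    if "i \<in> I" for i
    using inner_commute[OF x vI[OF that]] by (simp add: complex_norm_square[symmetric] mult.commute)
  ultimately have "((\<lambda>i. complex_of_real ((cmod (vinner H (v i) x))\<^sup>2)) has_sum of_real ((vnorm H x)\<^sup>2)) I"
    by (subst (asm) has_sum_cong)
  then show ?thesis by (simp only: has_sum_of_real_iff)
qed

text \<open>Zorn's lemma for orthonormal sets: if a nonzero vector were orthogonal to a maximal one,
  its normalisation could be added.\<close>

lemma is_onb_exists:
  assumes H: "hilbert_space H"
  shows "\<exists>B. is_onb H B"
proof -
  interpret hilbert_space H by fact
  define ON where "ON = {B. B \<subseteq> vecs H \<and> (\<forall>x\<in>B. \<forall>y\<in>B. vinner H x y = (if x = y then 1 else 0))}"
  have "\<Union>\<C> \<in> ON" if chain: "subset.chain ON \<C>" for \<C>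
  proof -
    have "vinner H x y = (if x = y then 1 else 0)"
      if xy: "X \<in> \<C>" "Y \<in> \<C>" "x \<in> X" "y \<in> Y" for x y X Y
    proof -
      \<comment> \<open>Two vectors of the union already lie in one member of the chain.\<close>
      have "X \<subseteq> Y \<or> Y \<subseteq> X" using chain xy unfolding subset_chain_def by blast
      then obtain Z where "Z \<in> \<C>" "x \<in> Z" "y \<in> Z" using xy by blast
      moreover from this have "Z \<in> ON" using chain unfolding subset_chain_def by blast
      ultimately show ?thesis unfolding ON_def by blast
    qed
    moreover have "\<Union>\<C> \<subseteq> vecs H" using chain unfolding subset_chain_def ON_def by blast
    ultimately show ?thesis unfolding ON_def by blast
  qed
  then obtain B where B: "B \<in> ON" and max: "\<And>X. X \<in> ON \<Longrightarrow> B \<subseteq> X \<Longrightarrow> X = B"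
    using subset_Zorn'[of ON] by blast
  have "x = vzero H" if x: "x \<in> vecs H" and orth: "\<forall>b\<in>B. vinner H b x = 0" for x
  proof (rule ccontr)
    assume "x \<noteq> vzero H"
    then have n: "vnorm H x \<noteq> 0" using x nrm_eq_zero by blast
    define e where "e = vscale H (1 / vnorm H x) x"
    have "vnorm H e = 1" using x n nrm_nonneg[OF x] by (simp add: e_def nrm_scl norm_divide)
    moreover have e: "e \<in> vecs H" using x by (simp add: e_def)
    ultimately have ee: "vinner H e e = 1" by (simp add: inner_self)
    have be: "vinner H b e = 0" "vinner H e b = 0" if "b \<in> B" for b
    proof -
      have "b \<in> vecs H" using B that by (auto simp: ON_def)
      then show "vinner H b e = 0" using orth that x by (simp add: e_def inner_scale)
      then show "vinner H e b = 0" using inner_commute[OF e \<open>b \<in> vecs H\<close>] by simp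
    qed
    then have "e \<notin> B" using ee by auto
    moreover have "insert e B \<in> ON" using B e ee be by (auto simp: ON_def)
    ultimately show False using max[of "insert e B"] by blast
  qed
  then have "is_onb H B" using B by (auto simp: is_onb_def ON_def)
  then show ?thesis by blast
qed

lemma
  assumes "hilbert_space H"
  shows onb_orthonormal: "orthonormal_family H (onb H) (\<lambda>b. b)"
    and onb_total: "total_family H (onb H) (\<lambda>b. b)"
    and onb_subset: "b \<in> onb H \<Longrightarrow> b \<in> vecs H"
proof -
  have "is_onb H (onb H)"
    unfolding onb_def using is_onb_exists[OF assms] by (rule someI_ex)
  then show "orthonormal_family H (onb H) (\<lambda>b. b)" "total_family H (onb H) (\<lambda>b. b)"
    "b \<in> onb H \<Longrightarrow> b \<in> vecs H"
    by (auto simp: is_onb_def orthonormal_family_def total_family_def)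
qed

section \<open>Tensor products\<close>

lemma vecs_htensor: "f \<in> vecs (H \<otimes>\<^sub>H K) \<longleftrightarrow> hs_form H K f"
  and vadd_htensor: "vadd (H \<otimes>\<^sub>H K) f g = (\<lambda>p\<in>vecs H \<times> vecs K. f p + g p)"
  and vzero_htensor: "vzero (H \<otimes>\<^sub>H K) = (\<lambda>p\<in>vecs H \<times> vecs K. 0)"
  and vscale_htensor: "vscale (H \<otimes>\<^sub>H K) a f = (\<lambda>p\<in>vecs H \<times> vecs K. a * f p)"
  and vinner_htensor: "vinner (H \<otimes>\<^sub>H K) f g = (\<Sum>\<^sub>\<infinity>p\<in>onb H \<times> onb K. cnj (f p) * g p)"
  by (simp_all add: htensor_def)

lemma hs_formD:
  assumes "hs_form H K f"
  shows "f \<in> extensional (vecs H \<times> vecs K)"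
    and "\<lbrakk>u \<in> vecs H; u' \<in> vecs H; v \<in> vecs K\<rbrakk> \<Longrightarrow> f (vadd H u u', v) = f (u, v) + f (u', v)"
    and "\<lbrakk>u \<in> vecs H; v \<in> vecs K; v' \<in> vecs K\<rbrakk> \<Longrightarrow> f (u, vadd K v v') = f (u, v) + f (u, v')"
    and "\<lbrakk>u \<in> vecs H; v \<in> vecs K\<rbrakk> \<Longrightarrow> f (vscale H a u, v) = cnj a * f (u, v)"
    and "\<lbrakk>u \<in> vecs H; v \<in> vecs K\<rbrakk> \<Longrightarrow> f (u, vscale K a v) = cnj a * f (u, v)"
    and "\<exists>C. \<forall>u\<in>vecs H. \<forall>v\<in>vecs K. cmod (f (u, v)) \<le> C * vnorm H u * vnorm K v"
    and "(\<lambda>p. (cmod (f p))\<^sup>2) summable_on (onb H \<times> onb K)"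
  using assms unfolding hs_form_def by blast+

lemma hs_formI:
  assumes "f \<in> extensional (vecs H \<times> vecs K)"
    and "\<And>u u' v. \<lbrakk>u \<in> vecs H; u' \<in> vecs H; v \<in> vecs K\<rbrakk> \<Longrightarrow> f (vadd H u u', v) = f (u, v) + f (u', v)"
    and "\<And>u v v'. \<lbrakk>u \<in> vecs H; v \<in> vecs K; v' \<in> vecs K\<rbrakk> \<Longrightarrow> f (u, vadd K v v') = f (u, v) + f (u, v')"
    and "\<And>a u v. \<lbrakk>u \<in> vecs H; v \<in> vecs K\<rbrakk> \<Longrightarrow> f (vscale H a u, v) = cnj a * f (u, v)"
    and "\<And>a u v. \<lbrakk>u \<in> vecs H; v \<in> vecs K\<rbrakk> \<Longrightarrow> f (u, vscale K a v) = cnj a * f (u, v)"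
    and "\<And>u v. \<lbrakk>u \<in> vecs H; v \<in> vecs K\<rbrakk> \<Longrightarrow> cmod (f (u, v)) \<le> C * vnorm H u * vnorm K v"
    and fin: "\<And>F. \<lbrakk>finite F; F \<subseteq> onb H \<times> onb K\<rbrakk> \<Longrightarrow> (\<Sum>p\<in>F. (cmod (f p))\<^sup>2) \<le> M"
  shows "hs_form H K f"
proof -
  have "(\<lambda>p. (cmod (f p))\<^sup>2) summable_on (onb H \<times> onb K)"
    using fin by (intro nonneg_bdd_above_summable_on) (auto intro!: bdd_aboveI2)
  then show ?thesis using assms(1-6) unfolding hs_form_def by blast
qed

locale hilbert_pair = H: hilbert_space H + K: hilbert_space K
  for H :: "'a hilb" and K :: "'b hilb"
begin

abbreviation "B \<equiv> onb H \<times> onb K"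

lemma H: "hilbert_space H" and K: "hilbert_space K"
  by unfold_locales

lemma B_vecs: "p \<in> B \<Longrightarrow> p \<in> vecs H \<times> vecs K"
  using onb_subset[OF H] onb_subset[OF K] by auto

lemma vinner_self_htensor:
  "vinner (H \<otimes>\<^sub>H K) f f = complex_of_real (\<Sum>\<^sub>\<infinity>p\<in>B. (cmod (f p))\<^sup>2)"
proof -
  have "vinner (H \<otimes>\<^sub>H K) f f = (\<Sum>\<^sub>\<infinity>p\<in>B. complex_of_real ((cmod (f p))\<^sup>2))"
    unfolding vinner_htensor by (intro infsum_cong) (metis complex_norm_square mult.commute)
  \<comment> \<open>The identity is stated for every \<open>f\<close>, so divergence must be
    covered: the two series are summable together, and otherwise both sums have the default value
    0.\<close>
  moreover have "(\<lambda>p. complex_of_real ((cmod (f p))\<^sup>2)) summable_on B \<longleftrightarrow> (\<lambda>p. (cmod (f p))\<^sup>2) summable_on B"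
    using summable_on_of_real summable_on_bounded_linear[OF bounded_linear_Re, of "\<lambda>p. complex_of_real ((cmod (f p))\<^sup>2)" B]
    by fastforce
  ultimately show ?thesis
    by (simp only: infsum_bounded_linear_strong[OF _ bounded_linear_of_real])
qed

lemma vnorm_htensor_power2: "(vnorm (H \<otimes>\<^sub>H K) f)\<^sup>2 = (\<Sum>\<^sub>\<infinity>p\<in>B. (cmod (f p))\<^sup>2)"
  by (simp add: vnorm_def vinner_self_htensor infsum_nonneg)

lemma vnorm_htensor_nonneg: "vnorm (H \<otimes>\<^sub>H K) f \<ge> 0"
  by (simp add: vnorm_def vinner_self_htensor infsum_nonneg)

lemma sum_le_vnorm_htensor:
  assumes "hs_form H K f" "finite F" "F \<subseteq> B"
  shows "(\<Sum>p\<in>F. (cmod (f p))\<^sup>2) \<le> (vnorm (H \<otimes>\<^sub>H K) f)\<^sup>2"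
  unfolding vnorm_htensor_power2
  using assms hs_formD(7)[OF assms(1)] by (intro finite_sum_le_infsum) auto

lemma vnorm_htensor_le:
  assumes "hs_form H K f" "b \<ge> 0"
    and "\<And>F. \<lbrakk>finite F; F \<subseteq> B\<rbrakk> \<Longrightarrow> (\<Sum>p\<in>F. (cmod (f p))\<^sup>2) \<le> b\<^sup>2"
  shows "vnorm (H \<otimes>\<^sub>H K) f \<le> b"
proof (rule power2_le_imp_le)
  show "(vnorm (H \<otimes>\<^sub>H K) f)\<^sup>2 \<le> b\<^sup>2"
    unfolding vnorm_htensor_power2
    using assms hs_formD(7)[OF assms(1)] by (intro infsum_le_finite_sums) auto
qed fact

text \<open>A slice of a form is conjugate-linear, so Riesz applies to its complex conjugate. Slices
  reduce statements on forms to Parseval's identity and totality in one variable at a time.\<close>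

lemma hs_form_left_vector:
  assumes f: "hs_form H K f" and v: "v \<in> vecs K"
  shows "\<exists>h\<in>vecs H. \<forall>u\<in>vecs H. f (u, v) = vinner H u h"
proof -
  obtain C where C: "\<And>u v. u \<in> vecs H \<Longrightarrow> v \<in> vecs K \<Longrightarrow> cmod (f (u, v)) \<le> C * vnorm H u * vnorm K v"
    using hs_formD(6)[OF f] by blast
  have "\<exists>h\<in>vecs H. \<forall>u\<in>vecs H. cnj (f (u, v)) = vinner H h u"
    using C[OF _ v] by (intro H.Riesz[where C = "C * vnorm K v"])
      (auto simp: hs_formD(2,4)[OF f] v mult_ac)
  then show ?thesis by (metis H.inner_commute complex_cnj_cnj)
qed

lemma hs_form_right_vector:
  assumes f: "hs_form H K f" and u: "u \<in> vecs H"
  shows "\<exists>k\<in>vecs K. \<forall>v\<in>vecs K. f (u, v) = vinner K v k"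
proof -
  obtain C where C: "\<And>u v. u \<in> vecs H \<Longrightarrow> v \<in> vecs K \<Longrightarrow> cmod (f (u, v)) \<le> C * vnorm H u * vnorm K v"
    using hs_formD(6)[OF f] by blast
  have "\<exists>k\<in>vecs K. \<forall>v\<in>vecs K. cnj (f (u, v)) = vinner K k v"
    using C[OF u] by (intro K.Riesz[where C = "C * vnorm H u"])
      (auto simp: hs_formD(3,5)[OF f] u mult_ac)
  then show ?thesis by (metis K.inner_commute complex_cnj_cnj)
qed

text \<open>Two successive slices: for fixed \<open>w j\<close> the slice vanishes on the total
  family \<open>v\<close>, hence everywhere; then for fixed \<open>x\<close> the other slice
  vanishes on \<open>w\<close>.\<close>

lemma hs_form_eq_zero:
  assumes f: "hs_form H K f" and v: "total_family H I v" and w: "total_family K J w"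
    and zero: "\<And>i j. \<lbrakk>i \<in> I; j \<in> J\<rbrakk> \<Longrightarrow> f (v i, w j) = 0"
  shows "f = vzero (H \<otimes>\<^sub>H K)"
proof -
  have vI: "i \<in> I \<Longrightarrow> v i \<in> vecs H" and wJ: "j \<in> J \<Longrightarrow> w j \<in> vecs K" for i j
    using v w by (auto simp: total_family_def)
  have left: "f (x, w j) = 0" if x: "x \<in> vecs H" and j: "j \<in> J" for x j
  proof -
    obtain h where h: "h \<in> vecs H" "\<And>u. u \<in> vecs H \<Longrightarrow> f (u, w j) = vinner H u h"
      using hs_form_left_vector[OF f wJ[OF j]] by blast
    then have "h = vzero H" using v zero[OF _ j] vI by (auto simp: total_family_def)
    then show ?thesis using h x by simp
  qed
  have "f (x, y) = 0" if x: "x \<in> vecs H" and y: "y \<in> vecs K" for x y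
  proof -
    obtain k where k: "k \<in> vecs K" "\<And>v. v \<in> vecs K \<Longrightarrow> f (x, v) = vinner K v k"
      using hs_form_right_vector[OF f x] by blast
    then have "k = vzero K" using w left[OF x] wJ by (auto simp: total_family_def)
    then show ?thesis using k y by simp
  qed
  then show ?thesis
    using hs_formD(1)[OF f] unfolding vzero_htensor
    by (intro extensionalityI[where A = "vecs H \<times> vecs K"]) auto
qed

lemma vtensor_apply: "\<lbrakk>u \<in> vecs H; v \<in> vecs K\<rbrakk> \<Longrightarrow> vtensor H K x y (u, v) = vinner H u x * vinner K v y"
  by (simp add: vtensor_def)

lemma
  assumes x: "x \<in> vecs H" and y: "y \<in> vecs K"
  shows hs_form_vtensor: "hs_form H K (vtensor H K x y)"
    and sum_vtensor_le: "\<lbrakk>finite F; F \<subseteq> B\<rbrakk>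
      \<Longrightarrow> (\<Sum>p\<in>F. (cmod (vtensor H K x y p))\<^sup>2) \<le> (vnorm H x * vnorm K y)\<^sup>2"
proof -
  have fin: "(\<Sum>p\<in>F. (cmod (vtensor H K x y p))\<^sup>2) \<le> (vnorm H x * vnorm K y)\<^sup>2"
    if F: "finite F" "F \<subseteq> B" for F
  proof -
    \<comment> \<open>Enlarging \<open>F\<close> to the rectangle spanned by its projections factors
      the sum, and Bessel's inequality applies to each factor.\<close>
    have F': "fst ` F \<subseteq> onb H" "snd ` F \<subseteq> onb K" using F by auto
    have "(\<Sum>p\<in>F. (cmod (vtensor H K x y p))\<^sup>2)
        = (\<Sum>p\<in>F. (cmod (vinner H (fst p) x))\<^sup>2 * (cmod (vinner K (snd p) y))\<^sup>2)"
    proof (rule sum.cong[OF refl])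
      fix p assume "p \<in> F"
      then obtain u v where "p = (u, v)" "u \<in> vecs H" "v \<in> vecs K" using F(2) B_vecs by blast
      then show "(cmod (vtensor H K x y p))\<^sup>2
          = (cmod (vinner H (fst p) x))\<^sup>2 * (cmod (vinner K (snd p) y))\<^sup>2"
        by (simp add: vtensor_apply norm_mult power_mult_distrib)
    qed
    also have "\<dots> \<le> (\<Sum>p\<in>fst ` F \<times> snd ` F. (cmod (vinner H (fst p) x))\<^sup>2 * (cmod (vinner K (snd p) y))\<^sup>2)"
      using F by (intro sum_mono2) force+
    also have "\<dots> = (\<Sum>b\<in>fst ` F. (cmod (vinner H b x))\<^sup>2) * (\<Sum>c\<in>snd ` F. (cmod (vinner K c y))\<^sup>2)"
      by (simp add: sum_product sum.cartesian_product case_prod_beta)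
    also have "\<dots> \<le> (vnorm H x)\<^sup>2 * (vnorm K y)\<^sup>2"
      using orthonormal_family_bessel[OF H onb_orthonormal[OF H]]
        orthonormal_family_bessel[OF K onb_orthonormal[OF K]] x y F F'
      by (intro mult_mono sum_nonneg) (auto simp: bessel_family_def)
    finally show ?thesis by (simp add: power_mult_distrib)
  qed
  then show "\<lbrakk>finite F; F \<subseteq> B\<rbrakk>
      \<Longrightarrow> (\<Sum>p\<in>F. (cmod (vtensor H K x y p))\<^sup>2) \<le> (vnorm H x * vnorm K y)\<^sup>2" .
  have "cmod (vtensor H K x y (u, v)) \<le> vnorm H x * vnorm K y * vnorm H u * vnorm K v"
    if "u \<in> vecs H" "v \<in> vecs K" for u v
  proof -
    have "cmod (vinner H u x) * cmod (vinner K v y) \<le> (vnorm H u * vnorm H x) * (vnorm K v * vnorm K y)"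
      using that x y by (intro mult_mono H.Cauchy_Schwarz K.Cauchy_Schwarz) (auto simp: H.nrm_nonneg)
    then show ?thesis using that by (simp add: vtensor_apply norm_mult mult_ac)
  qed
  then show "hs_form H K (vtensor H K x y)"
    by (intro hs_formI[where C = "vnorm H x * vnorm K y" and M = "(vnorm H x * vnorm K y)\<^sup>2"] fin)
      (auto simp: vtensor_apply H.inner_simps K.inner_simps x y algebra_simps, auto simp: vtensor_def)
qed

text \<open>The reproducing property: evaluation of forms is represented by elementary tensors.
  Cauchy-Schwarz justifies summing over \<open>onb K\<close> first; Parseval for a slice in
  \<open>K\<close> and then for a slice in \<open>H\<close> replaces the basis vectors by
  \<open>y\<close> and \<open>x\<close>.\<close>

lemma
  assumes f: "hs_form H K f" and x: "x \<in> vecs H" and y: "y \<in> vecs K"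
  shows vinner_vtensor_left: "vinner (H \<otimes>\<^sub>H K) (vtensor H K x y) f = f (x, y)"
    and hs_form_bound: "cmod (f (x, y)) \<le> vnorm H x * vnorm K y * vnorm (H \<otimes>\<^sub>H K) f"
proof -
  let ?g = "\<lambda>p. cnj (vtensor H K x y p) * f p"
  have v: "(\<Sum>p\<in>F. (cmod (cnj (vtensor H K x y p)))\<^sup>2) \<le> (vnorm H x * vnorm K y)\<^sup>2"
    if "finite F" "F \<subseteq> B" for F
    using sum_vtensor_le[OF x y that] by simp
  have nn: "0 \<le> vnorm H x * vnorm K y" using x y by (simp add: H.nrm_nonneg K.nrm_nonneg)
  have l2: "?g summable_on B"
      "cmod (\<Sum>\<^sub>\<infinity>p\<in>B. ?g p) \<le> vnorm H x * vnorm K y * vnorm (H \<otimes>\<^sub>H K) f"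
    by (rule product_l2(2,3)[OF v nn sum_le_vnorm_htensor[OF f] vnorm_htensor_nonneg]; assumption)+
  have eq: "?g (b, c) = vinner H x b * (vinner K y c * f (b, c))" if "b \<in> onb H" "c \<in> onb K" for b c
  proof -
    have "b \<in> vecs H" "c \<in> vecs K" using onb_subset[OF H that(1)] onb_subset[OF K that(2)] .
    then show ?thesis
      using x y H.inner_commute[of x b] K.inner_commute[of y c] by (simp add: vtensor_apply)
  qed
  have inner: "(\<Sum>\<^sub>\<infinity>c\<in>onb K. ?g (b, c)) = vinner H x b * f (b, y)" if b: "b \<in> onb H" for b
  proof -
    obtain k where k: "k \<in> vecs K" "\<And>v. v \<in> vecs K \<Longrightarrow> f (b, v) = vinner K v k"
      using hs_form_right_vector[OF f onb_subset[OF H b]] by blast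
    have "(\<Sum>\<^sub>\<infinity>c\<in>onb K. ?g (b, c)) = vinner H x b * (\<Sum>\<^sub>\<infinity>c\<in>onb K. vinner K y c * vinner K c k)"
      unfolding infsum_cmult_right'[symmetric]
      by (intro infsum_cong) (metis eq[OF b] k(2) onb_subset[OF K])
    also have "(\<Sum>\<^sub>\<infinity>c\<in>onb K. vinner K y c * vinner K c k) = f (b, y)"
      using Parseval[OF K onb_orthonormal[OF K] onb_total[OF K] y k(1)] k(2)[OF y]
      by (simp add: infsumI)
    finally show ?thesis .
  qed
  obtain h where h: "h \<in> vecs H" "\<And>u. u \<in> vecs H \<Longrightarrow> f (u, y) = vinner H u h"
    using hs_form_left_vector[OF f y] by blast
  have "vinner (H \<otimes>\<^sub>H K) (vtensor H K x y) f = (\<Sum>\<^sub>\<infinity>b\<in>onb H. \<Sum>\<^sub>\<infinity>c\<in>onb K. ?g (b, c))"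
    unfolding vinner_htensor by (rule infsum_Sigma_banach[OF l2(1), symmetric])
  also have "\<dots> = (\<Sum>\<^sub>\<infinity>b\<in>onb H. vinner H x b * vinner H b h)"
    by (intro infsum_cong) (simp only: inner h(2) onb_subset[OF H])
  also have "\<dots> = f (x, y)"
    using Parseval[OF H onb_orthonormal[OF H] onb_total[OF H] x h(1)] h(2)[OF x]
    by (simp add: infsumI)
  finally show "vinner (H \<otimes>\<^sub>H K) (vtensor H K x y) f = f (x, y)" .
  then show "cmod (f (x, y)) \<le> vnorm H x * vnorm K y * vnorm (H \<otimes>\<^sub>H K) f"
    using l2(2) by (simp add: vinner_htensor)
qed

lemma hs_form_vadd:
  assumes f: "hs_form H K f" and g: "hs_form H K g"
  shows "hs_form H K (vadd (H \<otimes>\<^sub>H K) f g)"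
    and "vnorm (H \<otimes>\<^sub>H K) (vadd (H \<otimes>\<^sub>H K) f g) \<le> vnorm (H \<otimes>\<^sub>H K) f + vnorm (H \<otimes>\<^sub>H K) g"
proof -
  let ?s = "vadd (H \<otimes>\<^sub>H K) f g" and ?N = "vnorm (H \<otimes>\<^sub>H K)"
  have fin: "(\<Sum>p\<in>F. (cmod (?s p))\<^sup>2) \<le> (?N f + ?N g)\<^sup>2" if F: "finite F" "F \<subseteq> B" for F
  proof -
    have "L2_set (\<lambda>p. cmod (?s p)) F \<le> L2_set (\<lambda>p. cmod (f p) + cmod (g p)) F"
      using F B_vecs by (intro L2_set_mono) (auto simp: vadd_htensor subset_iff norm_triangle_ineq)
    also have "\<dots> \<le> L2_set (\<lambda>p. cmod (f p)) F + L2_set (\<lambda>p. cmod (g p)) F"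
      by (rule L2_set_triangle_ineq)
    also have "\<dots> \<le> ?N f + ?N g"
      unfolding L2_set_def using F f g
      by (intro add_mono real_le_lsqrt sum_le_vnorm_htensor) (auto simp: vnorm_htensor_nonneg sum_nonneg)
    finally have "(L2_set (\<lambda>p. cmod (?s p)) F)\<^sup>2 \<le> (?N f + ?N g)\<^sup>2" by (simp add: power_mono)
    then show ?thesis by (simp add: L2_set_def sum_nonneg)
  qed
  obtain C D where "\<And>u v. u \<in> vecs H \<Longrightarrow> v \<in> vecs K \<Longrightarrow> cmod (f (u, v)) \<le> C * vnorm H u * vnorm K v"
    and "\<And>u v. u \<in> vecs H \<Longrightarrow> v \<in> vecs K \<Longrightarrow> cmod (g (u, v)) \<le> D * vnorm H u * vnorm K v"
    using hs_formD(6)[OF f] hs_formD(6)[OF g] by metis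
  then have bound: "cmod (?s (u, v)) \<le> (C + D) * vnorm H u * vnorm K v" if "u \<in> vecs H" "v \<in> vecs K" for u v
    using that norm_triangle_ineq[of "f (u, v)" "g (u, v)"]
    by (simp add: vadd_htensor distrib_right) (smt (verit))
  show s: "hs_form H K ?s"
    using hs_formD(2-5)[OF f] hs_formD(2-5)[OF g]
    by (intro hs_formI[OF _ _ _ _ _ bound fin]) (auto simp: vadd_htensor algebra_simps extensional_def)
  show "?N ?s \<le> ?N f + ?N g"
    by (rule vnorm_htensor_le[OF s _ fin]) (auto simp: vnorm_htensor_nonneg)
qed

lemma hs_form_vscale:
  assumes f: "hs_form H K f"
  shows "hs_form H K (vscale (H \<otimes>\<^sub>H K) a f)"
    and "vnorm (H \<otimes>\<^sub>H K) (vscale (H \<otimes>\<^sub>H K) a f) = cmod a * vnorm (H \<otimes>\<^sub>H K) f"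
proof -
  let ?s = "vscale (H \<otimes>\<^sub>H K) a f" and ?N = "vnorm (H \<otimes>\<^sub>H K)"
  have eq: "(cmod (?s p))\<^sup>2 = (cmod a)\<^sup>2 * (cmod (f p))\<^sup>2" if "p \<in> B" for p
    using B_vecs[OF that] by (simp add: vscale_htensor norm_mult power_mult_distrib)
  have fin: "(\<Sum>p\<in>F. (cmod (?s p))\<^sup>2) \<le> (cmod a)\<^sup>2 * (?N f)\<^sup>2" if F: "finite F" "F \<subseteq> B" for F
  proof -
    have "(\<Sum>p\<in>F. (cmod (?s p))\<^sup>2) = (cmod a)\<^sup>2 * (\<Sum>p\<in>F. (cmod (f p))\<^sup>2)"
      unfolding sum_distrib_left using F by (intro sum.cong eq) auto
    then show ?thesis using sum_le_vnorm_htensor[OF f F] by (simp add: mult_left_mono)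
  qed
  obtain C where "\<And>u v. u \<in> vecs H \<Longrightarrow> v \<in> vecs K \<Longrightarrow> cmod (f (u, v)) \<le> C * vnorm H u * vnorm K v"
    using hs_formD(6)[OF f] by metis
  then have bound: "cmod (?s (u, v)) \<le> cmod a * C * vnorm H u * vnorm K v" if "u \<in> vecs H" "v \<in> vecs K" for u v
    using that by (simp add: vscale_htensor norm_mult mult_left_mono mult.assoc)
  show "hs_form H K ?s"
    using hs_formD(2-5)[OF f]
    by (intro hs_formI[OF _ _ _ _ _ bound fin]) (auto simp: vscale_htensor algebra_simps extensional_def)
  have "(?N ?s)\<^sup>2 = (\<Sum>\<^sub>\<infinity>p\<in>B. (cmod a)\<^sup>2 * (cmod (f p))\<^sup>2)"
    unfolding vnorm_htensor_power2 by (intro infsum_cong eq)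
  also have "\<dots> = (cmod a * ?N f)\<^sup>2"
    unfolding power_mult_distrib vnorm_htensor_power2 by (rule infsum_cmult_right')
  finally show "?N ?s = cmod a * ?N f"
    by (simp add: vnorm_htensor_nonneg)
qed

lemma hs_form_vzero: "hs_form H K (vzero (H \<otimes>\<^sub>H K))"
  unfolding vzero_htensor
  by (rule hs_formI[where C = 0 and M = 0]) (use B_vecs in \<open>auto intro!: sum_nonpos\<close>)

lemma vinner_htensor_summable:
  assumes "hs_form H K f" "hs_form H K g"
  shows "(\<lambda>p. cnj (f p) * g p) summable_on B"
  using sum_le_vnorm_htensor[OF assms(1)] sum_le_vnorm_htensor[OF assms(2)]
  by (intro product_l2[where a = "vnorm (H \<otimes>\<^sub>H K) f" and b = "vnorm (H \<otimes>\<^sub>H K) g"])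
    (auto simp: vnorm_htensor_nonneg)

text \<open>By \<open>hs_form_bound\<close> evaluation at a point is continuous, so a Cauchy
  sequence converges pointwise. The estimates for the limit are obtained on finite sets of basis
  pairs, where limits and sums commute.\<close>

lemma htensor_complete:
  assumes X: "\<And>n::nat. hs_form H K (X n)"
    and Cauchy: "\<And>e. e > 0 \<Longrightarrow> \<exists>N. \<forall>m\<ge>N. \<forall>n\<ge>N.
      vnorm (H \<otimes>\<^sub>H K) (vadd (H \<otimes>\<^sub>H K) (X m) (vscale (H \<otimes>\<^sub>H K) (-1) (X n))) < e"
  shows "\<exists>f. hs_form H K f \<and>
    (\<lambda>n. vnorm (H \<otimes>\<^sub>H K) (vadd (H \<otimes>\<^sub>H K) (X n) (vscale (H \<otimes>\<^sub>H K) (-1) f))) \<longlonglongrightarrow> 0"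
proof -
  let ?N = "vnorm (H \<otimes>\<^sub>H K)"
  define D where "D f g = vadd (H \<otimes>\<^sub>H K) f (vscale (H \<otimes>\<^sub>H K) (-1) g)" for f g
  have D_hs: "hs_form H K (D f g)" if "hs_form H K f" "hs_form H K g" for f g
    unfolding D_def using that by (intro hs_form_vadd hs_form_vscale)
  have D_apply: "D f g p = f p - g p" if "p \<in> vecs H \<times> vecs K" for f g p
    using that by (simp add: D_def vadd_htensor vscale_htensor)
  have Cauchy': "\<exists>N. \<forall>m\<ge>N. \<forall>n\<ge>N. ?N (D (X m) (X n)) < e" if "e > 0" for e
    unfolding D_def using Cauchy[OF that] .
  have conv: "convergent (\<lambda>n. X n (u, v))" if uv: "u \<in> vecs H" "v \<in> vecs K" for u v
  proof (rule Cauchy_convergent, rule metric_CauchyI)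
    fix e :: real assume "e > 0"
    define c where "c = vnorm H u * vnorm K v"
    have c: "c \<ge> 0" using uv by (simp add: c_def H.nrm_nonneg K.nrm_nonneg)
    \<comment> \<open>The denominator \<open>c + 1\<close> stays positive when \<open>u\<close> or
      \<open>v\<close> is zero.\<close>
    obtain N where N: "\<And>m n. m \<ge> N \<Longrightarrow> n \<ge> N \<Longrightarrow> ?N (D (X m) (X n)) < e / (c + 1)"
      using Cauchy'[of "e / (c + 1)"] c \<open>e > 0\<close> by auto
    have "dist (X m (u, v)) (X n (u, v)) < e" if "m \<ge> N" "n \<ge> N" for m n
    proof -
      have "dist (X m (u, v)) (X n (u, v)) \<le> c * ?N (D (X m) (X n))"
        using hs_form_bound[OF D_hs[OF X X] uv, of m n] uv by (simp add: dist_norm D_apply c_def)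
      also have "\<dots> \<le> c * (e / (c + 1))"
        using N[OF that] c by (intro mult_left_mono) auto
      also have "\<dots> < e" using c \<open>e > 0\<close> by (simp add: field_simps)
      finally show ?thesis .
    qed
    then show "\<exists>N. \<forall>m\<ge>N. \<forall>n\<ge>N. dist (X m (u, v)) (X n (u, v)) < e" by blast
  qed
  define f where "f = (\<lambda>p\<in>vecs H \<times> vecs K. lim (\<lambda>n. X n p))"
  have lim: "(\<lambda>n. X n p) \<longlonglongrightarrow> f p" if "p \<in> vecs H \<times> vecs K" for p
    using conv that by (auto simp: f_def convergent_LIMSEQ_iff)
  have tail: "(\<Sum>p\<in>F. (cmod (X n p - f p))\<^sup>2) \<le> e\<^sup>2"
    if F: "finite F" "F \<subseteq> B" and N: "\<And>m. m \<ge> N \<Longrightarrow> ?N (D (X n) (X m)) < e" for F n N e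
  proof (rule LIMSEQ_le_const2)
    show "(\<lambda>m. \<Sum>p\<in>F. (cmod (X n p - X m p))\<^sup>2) \<longlonglongrightarrow> (\<Sum>p\<in>F. (cmod (X n p - f p))\<^sup>2)"
      using F B_vecs by (intro tendsto_intros lim) auto
    have "(\<Sum>p\<in>F. (cmod (X n p - X m p))\<^sup>2) \<le> e\<^sup>2" if "m \<ge> N" for m
    proof -
      have "(\<Sum>p\<in>F. (cmod (X n p - X m p))\<^sup>2) = (\<Sum>p\<in>F. (cmod (D (X n) (X m) p))\<^sup>2)"
        using F B_vecs by (intro sum.cong refl) (metis D_apply subsetD)
      also have "\<dots> \<le> (?N (D (X n) (X m)))\<^sup>2"
        using F by (intro sum_le_vnorm_htensor D_hs X)
      also have "\<dots> \<le> e\<^sup>2" using N[OF that] by (intro power_mono) (auto simp: vnorm_htensor_nonneg)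
      finally show ?thesis .
    qed
    then show "\<exists>N. \<forall>m\<ge>N. (\<Sum>p\<in>F. (cmod (X n p - X m p))\<^sup>2) \<le> e\<^sup>2" by blast
  qed
  obtain N1 where N1: "\<And>m n. m \<ge> N1 \<Longrightarrow> n \<ge> N1 \<Longrightarrow> ?N (D (X m) (X n)) < 1"
    using Cauchy'[of 1] by auto
  \<comment> \<open>The estimates are available for differences only, so membership is proved for
    the difference of \<open>X N1\<close> and \<open>f\<close> and then transferred to
    \<open>f\<close>. The tolerance 1 of \<open>N1\<close> is the origin of the bounds 1 for the
    form and for its square sums.\<close>
  define g where "g = D (X N1) f"
  have g_apply: "g p = X N1 p - f p" if "p \<in> vecs H \<times> vecs K" for p
    using D_apply[OF that] by (simp add: g_def)
  have g_lim: "(\<lambda>m. D (X N1) (X m) p) \<longlonglongrightarrow> g p" if "p \<in> vecs H \<times> vecs K" for p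
    using lim[OF that] that by (simp add: D_apply g_apply tendsto_diff)
  have g: "hs_form H K g"
  proof (rule hs_formI)
    show "g \<in> extensional (vecs H \<times> vecs K)" by (simp add: g_def D_def vadd_htensor)
    show "(\<Sum>p\<in>F. (cmod (g p))\<^sup>2) \<le> 1\<^sup>2" if "finite F" "F \<subseteq> B" for F
    proof -
      have "(\<Sum>p\<in>F. (cmod (g p))\<^sup>2) = (\<Sum>p\<in>F. (cmod (X N1 p - f p))\<^sup>2)"
        using that B_vecs by (intro sum.cong refl) (metis g_apply subsetD)
      then show ?thesis using tail[OF that N1, of N1] by simp
    qed
    fix u v assume uv: "u \<in> vecs H" "v \<in> vecs K"
    note hs = D_hs[OF X X, of N1]
    show "cmod (g (u, v)) \<le> 1 * vnorm H u * vnorm K v"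
    proof (rule LIMSEQ_le_const2)
      show "(\<lambda>m. cmod (D (X N1) (X m) (u, v))) \<longlonglongrightarrow> cmod (g (u, v))"
        using uv by (intro tendsto_norm g_lim) simp
      have "cmod (D (X N1) (X m) (u, v)) \<le> 1 * vnorm H u * vnorm K v" if "m \<ge> N1" for m
      proof -
        have "vnorm H u * vnorm K v * ?N (D (X N1) (X m)) \<le> vnorm H u * vnorm K v * 1"
          using N1[OF _ that, of N1] uv
          by (intro mult_left_mono) (auto simp: H.nrm_nonneg K.nrm_nonneg)
        then show ?thesis using hs_form_bound[OF hs uv, of m] by simp
      qed
      then show "\<exists>N. \<forall>m\<ge>N. cmod (D (X N1) (X m) (u, v)) \<le> 1 * vnorm H u * vnorm K v" by blast
    qed
    have sm: "(\<lambda>m. D (X N1) (X m) (u, v)) \<longlonglongrightarrow> g (u, v)" using uv by (intro g_lim) simp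
    show "g (vscale H a u, v) = cnj a * g (u, v)" for a
      using g_lim[of "(vscale H a u, v)"] tendsto_mult_left[OF sm, of "cnj a"] uv
      by (simp add: hs_formD(4)[OF hs] LIMSEQ_unique)
    show "g (u, vscale K a v) = cnj a * g (u, v)" for a
      using g_lim[of "(u, vscale K a v)"] tendsto_mult_left[OF sm, of "cnj a"] uv
      by (simp add: hs_formD(5)[OF hs] LIMSEQ_unique)
    show "g (vadd H u u', v) = g (u, v) + g (u', v)" if "u' \<in> vecs H" for u'
      using g_lim[of "(vadd H u u', v)"] tendsto_add[OF sm g_lim[of "(u', v)"]] uv that
      by (simp add: hs_formD(2)[OF hs] LIMSEQ_unique)
    show "g (u, vadd K v v') = g (u, v) + g (u, v')" if "v' \<in> vecs K" for v'
      using g_lim[of "(u, vadd K v v')"] tendsto_add[OF sm g_lim[of "(u, v')"]] uv that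
      by (simp add: hs_formD(3)[OF hs] LIMSEQ_unique)
  qed
  have "f = D (X N1) g"
    by (rule extensionalityI[where A = "vecs H \<times> vecs K"])
      (auto simp: f_def D_apply g_apply, auto simp: D_def vadd_htensor)
  then have f: "hs_form H K f" using D_hs[OF X g] by metis
  have "(\<lambda>n. ?N (D (X n) f)) \<longlonglongrightarrow> 0"
  proof (rule LIMSEQ_I)
    fix e :: real assume "e > 0"
    \<comment> \<open>With \<open>e / 2\<close> the weak inequality that survives the limit still
      yields the strict one.\<close>
    then obtain N where N: "\<And>m n. m \<ge> N \<Longrightarrow> n \<ge> N \<Longrightarrow> ?N (D (X m) (X n)) < e / 2"
      using Cauchy'[of "e / 2"] by auto
    have "?N (D (X n) f) \<le> e / 2" if n: "n \<ge> N" for n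
    proof (rule vnorm_htensor_le[OF D_hs[OF X f]])
      fix F assume F: "finite F" "F \<subseteq> B"
      have "(\<Sum>p\<in>F. (cmod (D (X n) f p))\<^sup>2) = (\<Sum>p\<in>F. (cmod (X n p - f p))\<^sup>2)"
        using F B_vecs by (intro sum.cong refl) (metis D_apply subsetD)
      also have "\<dots> \<le> (e / 2)\<^sup>2" by (rule tail[OF F N[OF n]])
      finally show "(\<Sum>p\<in>F. (cmod (D (X n) f p))\<^sup>2) \<le> (e / 2)\<^sup>2" .
    qed (use \<open>e > 0\<close> in simp)
    then have "norm (?N (D (X n) f) - 0) < e" if "n \<ge> N" for n
      using that \<open>e > 0\<close> vnorm_htensor_nonneg[of "D (X n) f"] by fastforce
    then show "\<exists>N. \<forall>n\<ge>N. norm (?N (D (X n) f) - 0) < e" by blast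
  qed
  then show ?thesis using f unfolding D_def by blast
qed

lemma hilbert_space_htensor: "hilbert_space (H \<otimes>\<^sub>H K)"
\<comment> \<open>Cases 1 to 11 are the vector space axioms, 12 to 16 those of the norm and 17 to 21
  those of the inner product.\<close>
proof (intro hilbert_space.intro cbanach_space.intro cvector_space.intro cbanach_space_axioms.intro, goal_cases)
  case 1 show ?case using hs_form_vzero by (simp add: vecs_htensor)
next
  case 2 then show ?case using hs_form_vadd by (simp add: vecs_htensor)
next
  case 3 then show ?case using hs_form_vscale by (simp add: vecs_htensor)
next
  case (4 x y z) then show ?case by (auto simp: vadd_htensor)
next
  case (5 x y) then show ?case by (auto simp: vadd_htensor add.commute)
next
  case (6 x) then show ?case
    by (intro extensionalityI[where A = "vecs H \<times> vecs K"])
      (auto simp: vadd_htensor vzero_htensor vecs_htensor hs_formD(1))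
next
  case (7 x)
  then have "vscale (H \<otimes>\<^sub>H K) (-1) x \<in> vecs (H \<otimes>\<^sub>H K)" using hs_form_vscale by (simp add: vecs_htensor)
  moreover have "vadd (H \<otimes>\<^sub>H K) x (vscale (H \<otimes>\<^sub>H K) (-1) x) = vzero (H \<otimes>\<^sub>H K)"
    by (auto simp: vadd_htensor vscale_htensor vzero_htensor)
  ultimately show ?case by blast
next
  case (8 x) then show ?case
    by (intro extensionalityI[where A = "vecs H \<times> vecs K"])
      (auto simp: vscale_htensor vecs_htensor hs_formD(1))
next
  case 9 then show ?case by (auto simp: vscale_htensor)
next
  case 10 then show ?case by (auto simp: vscale_htensor vadd_htensor distrib_left)
next
  case 11 then show ?case by (auto simp: vscale_htensor vadd_htensor distrib_right)
next
  case 12 show ?case by (rule vnorm_htensor_nonneg)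
next
  case (13 f)
  then have f: "hs_form H K f" by (simp add: vecs_htensor)
  \<comment> \<open>A single term is bounded by the whole square sum, so all basis coefficients
    vanish.\<close>
  have "f p = 0" if "p \<in> B" for p
    using sum_le_vnorm_htensor[OF f, of "{p}"] that 13(2) by simp
  then show ?case
    by (intro hs_form_eq_zero[OF f onb_total[OF H] onb_total[OF K]]) auto
next
  case 14 then show ?case using hs_form_vscale by (simp add: vecs_htensor)
next
  case 15 then show ?case using hs_form_vadd by (simp add: vecs_htensor)
next
  case (16 X) then show ?case using htensor_complete[of X] by (auto simp: vecs_htensor)
next
  case (17 f g h)
  then have "vinner (H \<otimes>\<^sub>H K) f g + vinner (H \<otimes>\<^sub>H K) f h
      = (\<Sum>\<^sub>\<infinity>p\<in>B. cnj (f p) * g p + cnj (f p) * h p)"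
    unfolding vinner_htensor
    by (intro infsum_add[symmetric] vinner_htensor_summable) (simp_all add: vecs_htensor)
  also have "\<dots> = vinner (H \<otimes>\<^sub>H K) f (vadd (H \<otimes>\<^sub>H K) g h)"
    unfolding vinner_htensor
    using B_vecs by (intro infsum_cong) (auto simp: vadd_htensor distrib_left)
  finally show ?case by simp
next
  case (18 f g a)
  have "a * vinner (H \<otimes>\<^sub>H K) f g = (\<Sum>\<^sub>\<infinity>p\<in>B. a * (cnj (f p) * g p))"
    unfolding vinner_htensor by (rule infsum_cmult_right'[symmetric])
  also have "\<dots> = vinner (H \<otimes>\<^sub>H K) f (vscale (H \<otimes>\<^sub>H K) a g)"
    unfolding vinner_htensor using B_vecs by (intro infsum_cong) (auto simp: vscale_htensor)
  finally show ?case by simp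
next
  case (19 f g)
  show ?case unfolding vinner_htensor infsum_cnj[symmetric]
    by (intro infsum_cong) (simp add: mult.commute)
next
  case (20 f) then show ?case by (simp add: vinner_self_htensor infsum_nonneg)
next
  case (21 f)
  then have f: "hs_form H K f" by (simp add: vecs_htensor)
  have "vnorm (H \<otimes>\<^sub>H K) f = 0" using 21 by (simp add: vnorm_def)
  then have "f p = 0" if "p \<in> B" for p
    using sum_le_vnorm_htensor[OF f, of "{p}"] that by simp
  then show ?case
    by (intro hs_form_eq_zero[OF f onb_total[OF H] onb_total[OF K]]) auto
qed

end

section \<open>Elementary tensors and their totality\<close>

lemma htensor_hilbert_space: "\<lbrakk>hilbert_space H; hilbert_space K\<rbrakk> \<Longrightarrow> hilbert_space (H \<otimes>\<^sub>H K)"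
  by (rule hilbert_pair.hilbert_space_htensor[OF hilbert_pair.intro])

lemma vtensor_closed:
  "\<lbrakk>hilbert_space H; hilbert_space K; x \<in> vecs H; y \<in> vecs K\<rbrakk> \<Longrightarrow> vtensor H K x y \<in> vecs (H \<otimes>\<^sub>H K)"
  by (simp add: vecs_htensor hilbert_pair.hs_form_vtensor[OF hilbert_pair.intro])

lemma vinner_vtensor_eval:
  "\<lbrakk>hilbert_space H; hilbert_space K; x \<in> vecs H; y \<in> vecs K; f \<in> vecs (H \<otimes>\<^sub>H K)\<rbrakk>
    \<Longrightarrow> vinner (H \<otimes>\<^sub>H K) (vtensor H K x y) f = f (x, y)"
  by (simp add: vecs_htensor hilbert_pair.vinner_vtensor_left[OF hilbert_pair.intro])

lemma vinner_vtensor: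
  "\<lbrakk>hilbert_space H; hilbert_space K; x \<in> vecs H; y \<in> vecs K; x' \<in> vecs H; y' \<in> vecs K\<rbrakk>
    \<Longrightarrow> vinner (H \<otimes>\<^sub>H K) (vtensor H K x y) (vtensor H K x' y') = vinner H x x' * vinner K y y'"
  by (simp add: vinner_vtensor_eval vtensor_closed hilbert_pair.vtensor_apply[OF hilbert_pair.intro])

lemma vnorm_vtensor:
  assumes H: "hilbert_space H" and K: "hilbert_space K" and x: "x \<in> vecs H" and y: "y \<in> vecs K"
  shows "vnorm (H \<otimes>\<^sub>H K) (vtensor H K x y) = vnorm H x * vnorm K y"
proof -
  \<comment> \<open>The norm takes the real part of a product, which splits because both factors are
    real.\<close>
  have "Im (vinner H x x) = 0" "Im (vinner K y y) = 0"
    by (simp_all add: hilbert_space.inner_self[OF H x] hilbert_space.inner_self[OF K y])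
  then show ?thesis by (simp add: vnorm_def vinner_vtensor assms real_sqrt_mult)
qed

lemma
  assumes "hilbert_space H" "hilbert_space K" "x \<in> vecs H" "y \<in> vecs K"
  shows vtensor_add_left: "x' \<in> vecs H
      \<Longrightarrow> vtensor H K (vadd H x x') y = vadd (H \<otimes>\<^sub>H K) (vtensor H K x y) (vtensor H K x' y)"
    and vtensor_add_right: "y' \<in> vecs K
      \<Longrightarrow> vtensor H K x (vadd K y y') = vadd (H \<otimes>\<^sub>H K) (vtensor H K x y) (vtensor H K x y')"
    and vtensor_scale_left: "vtensor H K (vscale H a x) y = vscale (H \<otimes>\<^sub>H K) a (vtensor H K x y)"
    and vtensor_scale_right: "vtensor H K x (vscale K a y) = vscale (H \<otimes>\<^sub>H K) a (vtensor H K x y)"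
  using assms
  by (auto simp: vtensor_def vadd_htensor vscale_htensor fun_eq_iff algebra_simps
      hilbert_space.inner_add hilbert_space.inner_scale)

text \<open>Because elementary tensors represent evaluation, orthogonality to all of them says that
  the form vanishes at all pairs \<open>(v i, w j)\<close>.\<close>

lemma total_vtensor:
  assumes H: "hilbert_space H" and K: "hilbert_space K"
    and v: "total_family H I v" and w: "total_family K J w"
  shows "total_family (H \<otimes>\<^sub>H K) (I \<times> J) (\<lambda>(i, j). vtensor H K (v i) (w j))"
proof -
  have vI: "i \<in> I \<Longrightarrow> v i \<in> vecs H" and wJ: "j \<in> J \<Longrightarrow> w j \<in> vecs K" for i j
    using v w by (auto simp: total_family_def)
  have "f = vzero (H \<otimes>\<^sub>H K)"
    if f: "f \<in> vecs (H \<otimes>\<^sub>H K)"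
      and z: "\<forall>p\<in>I \<times> J. vinner (H \<otimes>\<^sub>H K) (case p of (i, j) \<Rightarrow> vtensor H K (v i) (w j)) f = 0" for f
  proof (rule hilbert_pair.hs_form_eq_zero[OF hilbert_pair.intro[OF H K] _ v w])
    show "hs_form H K f" using f by (simp add: vecs_htensor)
    show "f (v i, w j) = 0" if "i \<in> I" "j \<in> J" for i j
      using z that f by (force simp: vinner_vtensor_eval H K vI wJ)
  qed
  then show ?thesis by (auto simp: total_family_def vtensor_closed H K vI wJ)
qed

lemma total_vecs:
  assumes "hilbert_space H" shows "total_family H (vecs H) (\<lambda>x. x)"
  using hilbert_space.inner_eq_zero[OF assms] by (auto simp: total_family_def)

lemma orthonormal_vtensor:
  assumes "hilbert_space H" "hilbert_space K"
    and "orthonormal_family H I v" "orthonormal_family K J w"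
  shows "orthonormal_family (H \<otimes>\<^sub>H K) (I \<times> J) (\<lambda>(i, j). vtensor H K (v i) (w j))"
  using assms by (auto simp: orthonormal_family_def vtensor_closed vinner_vtensor)

lemma htensor_eqI:
  assumes H: "hilbert_space H" and K: "hilbert_space K"
    and "f \<in> vecs (H \<otimes>\<^sub>H K)" "g \<in> vecs (H \<otimes>\<^sub>H K)"
    and "\<And>x y. \<lbrakk>x \<in> vecs H; y \<in> vecs K\<rbrakk>
      \<Longrightarrow> vinner (H \<otimes>\<^sub>H K) (vtensor H K x y) f = vinner (H \<otimes>\<^sub>H K) (vtensor H K x y) g"
  shows "f = g"
  using assms(3-)
  by (intro total_family_eqI[OF htensor_hilbert_space[OF H K]
        total_vtensor[OF H K total_vecs[OF H] total_vecs[OF K]]]) auto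

text \<open>Totality speaks of orthogonality, so the question is moved to the adjoints: the
  coefficient of \<open>A^* y\<close> at \<open>v i\<close> is the inner product of
  \<open>A (v i)\<close> with \<open>y\<close>.\<close>

lemma bounded_maps_total_eqI:
  assumes H: "hilbert_space H" and K: "hilbert_space K" and v: "total_family H I v"
    and A: "A \<in> bounded_maps H K" and B: "B \<in> bounded_maps H K"
    and eq: "\<And>i. i \<in> I \<Longrightarrow> act A (v i) = act B (v i)"
  shows "A = B"
proof -
  have "v i \<in> vecs H" if "i \<in> I" for i using v that by (simp add: total_family_def)
  then have "act (hadj A) y = act (hadj B) y" if "y \<in> vecs K" for y
    using that act_closed[OF hadj_bounded[OF H K A]] act_closed[OF hadj_bounded[OF H K B]]
    by (intro total_family_eqI[OF H v]) (auto simp: inner_hadj_right[OF H K] A B eq)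
  then have "hadj A = hadj B" by (intro bounded_maps_eqI[OF hadj_bounded[OF H K A] hadj_bounded[OF H K B]])
  then show ?thesis by (metis hadj_hadj[OF H K] A B)
qed

section \<open>Tensor products of operators\<close>

lemma bounded_maps_htensor_eqI:
  assumes "hilbert_space H" "hilbert_space K" "hilbert_space L"
    and "A \<in> bounded_maps (H \<otimes>\<^sub>H K) L" "B \<in> bounded_maps (H \<otimes>\<^sub>H K) L"
    and "\<And>x y. \<lbrakk>x \<in> vecs H; y \<in> vecs K\<rbrakk> \<Longrightarrow> act A (vtensor H K x y) = act B (vtensor H K x y)"
  shows "A = B"
  using assms(4-)
  by (intro bounded_maps_total_eqI[OF htensor_hilbert_space[OF assms(1,2)] assms(3)
        total_vtensor[OF assms(1,2) total_vecs[OF assms(1)] total_vecs[OF assms(2)]]]) auto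

text \<open>Since \<open><A b, h> = <b, A^* h>\<close>, this is Bessel's inequality for the vector
  \<open>A^* h\<close>. The square norm of \<open>h\<close> is written as a sum over
  \<open>onb H'\<close> so that the estimate can be followed by one in the second tensor
  factor.\<close>

lemma sum_image_onb_le:
  assumes H: "hilbert_space H" and H': "hilbert_space H'" and A: "A \<in> bounded_maps H H'"
    and C: "\<And>h. h \<in> vecs H' \<Longrightarrow> vnorm H (act (hadj A) h) \<le> C * vnorm H' h"
    and h: "h \<in> vecs H'" and F: "finite F" "F \<subseteq> onb H"
  shows "(\<Sum>b\<in>F. (cmod (vinner H' (act A b) h))\<^sup>2) \<le> C\<^sup>2 * (\<Sum>\<^sub>\<infinity>e\<in>onb H'. (cmod (vinner H' e h))\<^sup>2)"
proof -
  interpret H: hilbert_space H by fact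
  have A': "act (hadj A) h \<in> vecs H" by (rule act_closed[OF hadj_bounded[OF H H' A] h])
  have "(\<Sum>b\<in>F. (cmod (vinner H' (act A b) h))\<^sup>2) = (\<Sum>b\<in>F. (cmod (vinner H b (act (hadj A) h)))\<^sup>2)"
    using F onb_subset[OF H] by (intro sum.cong) (auto simp: inner_hadj_right[OF H H' A _ h])
  also have "\<dots> \<le> (vnorm H (act (hadj A) h))\<^sup>2"
    using orthonormal_family_bessel[OF H onb_orthonormal[OF H]] F A' by (simp add: bessel_family_def)
  also have "\<dots> \<le> (C * vnorm H' h)\<^sup>2"
    using C[OF h] H.nrm_nonneg[OF A'] by (rule power_mono)
  also have "\<dots> = C\<^sup>2 * (\<Sum>\<^sub>\<infinity>e\<in>onb H'. (cmod (vinner H' e h))\<^sup>2)"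
    using Parseval_norm[OF H' onb_orthonormal[OF H'] onb_total[OF H'] h]
    by (simp add: power_mult_distrib infsumI)
  finally show ?thesis .
qed

lemma has_sum_finite_sum:
  fixes f :: "'j \<Rightarrow> 'i \<Rightarrow> 'b::{topological_comm_monoid_add}"
  assumes "finite J" "\<And>j. j \<in> J \<Longrightarrow> (f j has_sum s j) A"
  shows "((\<lambda>i. \<Sum>j\<in>J. f j i) has_sum (\<Sum>j\<in>J. s j)) A"
  using assms by (induction J rule: finite_induct) (auto intro!: has_sum_add)

text \<open>The estimate behind the boundedness of the tensor product of \<open>A\<close> and
  \<open>B\<close>. The factors are treated one at a time: the images \<open>A b\<close> are
  replaced by the basis of \<open>H'\<close> at the cost of \<open>C^2\<close>, then the images
  \<open>B c\<close> by the basis of \<open>K'\<close> at the cost of \<open>D^2\<close>, so that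
  \<open>C * D\<close> is a Bessel constant.\<close>

lemma bessel_family_map_tensor:
  assumes H: "hilbert_space H" and K: "hilbert_space K"
    and H': "hilbert_space H'" and K': "hilbert_space K'"
    and A: "A \<in> bounded_maps H H'" and B: "B \<in> bounded_maps K K'"
  shows "\<exists>M. bessel_family (H' \<otimes>\<^sub>H K') (onb H \<times> onb K)
    (\<lambda>(b, c). vtensor H' K' (act A b) (act B c)) M"
proof -
  interpret T: hilbert_pair H' K' by (rule hilbert_pair.intro[OF H' K'])
  obtain C where C: "C \<ge> 0" "\<And>h. h \<in> vecs H' \<Longrightarrow> vnorm H (act (hadj A) h) \<le> C * vnorm H' h"
    using bounded_maps_bound[OF hadj_bounded[OF H H' A] H'] by blast
  obtain D where D: "D \<ge> 0" "\<And>h. h \<in> vecs K' \<Longrightarrow> vnorm K (act (hadj B) h) \<le> D * vnorm K' h"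
    using bounded_maps_bound[OF hadj_bounded[OF K K' B] K'] by blast
  have Ab: "act A b \<in> vecs H'" if "b \<in> onb H" for b using act_closed[OF A onb_subset[OF H that]] .
  have Bc: "act B c \<in> vecs K'" if "c \<in> onb K" for c using act_closed[OF B onb_subset[OF K that]] .
  note subH = onb_subset[OF H'] and subK = onb_subset[OF K']
  have "(\<Sum>p\<in>F. (cmod (vinner (H' \<otimes>\<^sub>H K') (case p of (b, c) \<Rightarrow> vtensor H' K' (act A b) (act B c)) g))\<^sup>2)
      \<le> (C * D * vnorm (H' \<otimes>\<^sub>H K') g)\<^sup>2"
    if g': "g \<in> vecs (H' \<otimes>\<^sub>H K')" and F: "finite F" "F \<subseteq> onb H \<times> onb K" for g F
  proof -
    have g: "hs_form H' K' g" using g' by (simp add: vecs_htensor)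
    define I J where "I = fst ` F" and "J = snd ` F"
    have I: "finite I" "I \<subseteq> onb H" and J: "finite J" "J \<subseteq> onb K" using F by (auto simp: I_def J_def)
    have left: "(\<Sum>b\<in>I. (cmod (g (act A b, y)))\<^sup>2) \<le> C\<^sup>2 * (\<Sum>\<^sub>\<infinity>e\<in>onb H'. (cmod (g (e, y)))\<^sup>2)"
      and left_summable: "(\<lambda>e. (cmod (g (e, y)))\<^sup>2) summable_on onb H'" if y: "y \<in> vecs K'" for y
    proof -
      obtain h where h: "h \<in> vecs H'" "\<And>u. u \<in> vecs H' \<Longrightarrow> g (u, y) = vinner H' u h"
        using T.hs_form_left_vector[OF g y] by blast
      have "(\<Sum>b\<in>I. (cmod (g (act A b, y)))\<^sup>2) = (\<Sum>b\<in>I. (cmod (vinner H' (act A b) h))\<^sup>2)"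
        using I Ab by (intro sum.cong) (auto simp: h)
      also have "\<dots> \<le> C\<^sup>2 * (\<Sum>\<^sub>\<infinity>e\<in>onb H'. (cmod (vinner H' e h))\<^sup>2)"
        by (rule sum_image_onb_le[OF H H' A C(2) h(1) I])
      also have "(\<Sum>\<^sub>\<infinity>e\<in>onb H'. (cmod (vinner H' e h))\<^sup>2) = (\<Sum>\<^sub>\<infinity>e\<in>onb H'. (cmod (g (e, y)))\<^sup>2)"
        by (intro infsum_cong) (simp add: h subH)
      finally show "(\<Sum>b\<in>I. (cmod (g (act A b, y)))\<^sup>2) \<le> C\<^sup>2 * (\<Sum>\<^sub>\<infinity>e\<in>onb H'. (cmod (g (e, y)))\<^sup>2)" .
      have "(\<lambda>e. (cmod (vinner H' e h))\<^sup>2) summable_on onb H'"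
        using Parseval_norm[OF H' onb_orthonormal[OF H'] onb_total[OF H'] h(1)] has_sum_imp_summable by blast
      then show "(\<lambda>e. (cmod (g (e, y)))\<^sup>2) summable_on onb H'"
        by (rule summable_on_cong[THEN iffD1, rotated]) (simp add: h subH)
    qed
    have right: "(\<Sum>c\<in>J. (cmod (g (x, act B c)))\<^sup>2) \<le> D\<^sup>2 * (\<Sum>\<^sub>\<infinity>e\<in>onb K'. (cmod (g (x, e)))\<^sup>2)"
      if x: "x \<in> vecs H'" for x
    proof -
      obtain k where k: "k \<in> vecs K'" "\<And>v. v \<in> vecs K' \<Longrightarrow> g (x, v) = vinner K' v k"
        using T.hs_form_right_vector[OF g x] by blast
      have "(\<Sum>c\<in>J. (cmod (g (x, act B c)))\<^sup>2) = (\<Sum>c\<in>J. (cmod (vinner K' (act B c) k))\<^sup>2)"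
        using J Bc by (intro sum.cong) (auto simp: k)
      also have "\<dots> \<le> D\<^sup>2 * (\<Sum>\<^sub>\<infinity>e\<in>onb K'. (cmod (vinner K' e k))\<^sup>2)"
        by (rule sum_image_onb_le[OF K K' B D(2) k(1) J])
      also have "(\<Sum>\<^sub>\<infinity>e\<in>onb K'. (cmod (vinner K' e k))\<^sup>2) = (\<Sum>\<^sub>\<infinity>e\<in>onb K'. (cmod (g (x, e)))\<^sup>2)"
        by (intro infsum_cong) (simp add: k subK)
      finally show ?thesis .
    qed
    \<comment> \<open>As \<open>J\<close> is finite, the sum over it can be moved inside the
      infinite sum, where \<open>right\<close> applies for each \<open>e\<close>.\<close>
    have sumJ: "((\<lambda>e. \<Sum>c\<in>J. (cmod (g (e, act B c)))\<^sup>2) has_sum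
        (\<Sum>c\<in>J. \<Sum>\<^sub>\<infinity>e\<in>onb H'. (cmod (g (e, act B c)))\<^sup>2)) (onb H')"
      using J Bc by (intro has_sum_finite_sum has_sum_infsum left_summable) auto
    have gB: "(\<lambda>(e, e'). (cmod (g (e, e')))\<^sup>2) summable_on (onb H' \<times> onb K')"
      using hs_formD(7)[OF g] by (simp add: case_prod_unfold)
    have "(\<Sum>p\<in>F. (cmod (vinner (H' \<otimes>\<^sub>H K') (case p of (b, c) \<Rightarrow> vtensor H' K' (act A b) (act B c)) g))\<^sup>2)
        = (\<Sum>p\<in>F. (cmod (g (act A (fst p), act B (snd p))))\<^sup>2)"
      using F Ab Bc g' by (intro sum.cong refl) (force simp: vinner_vtensor_eval H' K')
    also have "\<dots> \<le> (\<Sum>p\<in>I \<times> J. (cmod (g (act A (fst p), act B (snd p))))\<^sup>2)"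
      using F(1) by (intro sum_mono2) (force simp: I_def J_def)+
    also have "\<dots> = (\<Sum>c\<in>J. \<Sum>b\<in>I. (cmod (g (act A b, act B c)))\<^sup>2)"
      by (subst sum.swap) (simp add: sum.cartesian_product case_prod_unfold)
    also have "\<dots> \<le> (\<Sum>c\<in>J. C\<^sup>2 * (\<Sum>\<^sub>\<infinity>e\<in>onb H'. (cmod (g (e, act B c)))\<^sup>2))"
      using J Bc by (intro sum_mono left) auto
    also have "\<dots> = C\<^sup>2 * (\<Sum>\<^sub>\<infinity>e\<in>onb H'. \<Sum>c\<in>J. (cmod (g (e, act B c)))\<^sup>2)"
      using infsumI[OF sumJ] by (simp add: sum_distrib_left)
    also have "\<dots> \<le> C\<^sup>2 * (\<Sum>\<^sub>\<infinity>e\<in>onb H'. D\<^sup>2 * (\<Sum>\<^sub>\<infinity>e'\<in>onb K'. (cmod (g (e, e')))\<^sup>2))"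
      using has_sum_imp_summable[OF sumJ] summable_on_Sigma_banach[OF gB] subH
      by (intro mult_left_mono infsum_mono right summable_on_cmult_right) auto
    also have "\<dots> = C\<^sup>2 * (D\<^sup>2 * (\<Sum>\<^sub>\<infinity>e\<in>onb H'. \<Sum>\<^sub>\<infinity>e'\<in>onb K'. (cmod (g (e, e')))\<^sup>2))"
      by (simp only: infsum_cmult_right')
    also have "\<dots> = (C * D * vnorm (H' \<otimes>\<^sub>H K') g)\<^sup>2"
      using infsum_Sigma'_banach[OF gB]
      by (simp add: power_mult_distrib T.vnorm_htensor_power2 case_prod_unfold)
    finally show ?thesis .
  qed
  then have "bessel_family (H' \<otimes>\<^sub>H K') (onb H \<times> onb K)
      (\<lambda>(b, c). vtensor H' K' (act A b) (act B c)) (C * D)"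
    using C(1) D(1) Ab Bc by (auto simp: bessel_family_def vtensor_closed H' K')
  then show ?thesis ..
qed

text \<open>The candidate sends the product basis to its image family. Its value on an elementary
  tensor is found by pairing with the tensor of \<open>u\<close> and \<open>v\<close>: adjoints move
  \<open>A\<close> and \<open>B\<close> to \<open>u\<close> and \<open>v\<close>, and Parseval for
  the product basis sums the series. Uniqueness holds because elementary tensors are total.\<close>

lemma
  assumes H: "hilbert_space H" and K: "hilbert_space K"
    and H': "hilbert_space H'" and K': "hilbert_space K'"
    and A: "A \<in> bounded_maps H H'" and B: "B \<in> bounded_maps K K'"
  shows map_tensor_bounded: "A \<otimes>\<^sub>M B \<in> bounded_maps (H \<otimes>\<^sub>H K) (H' \<otimes>\<^sub>H K')"
    and act_map_tensor: "\<lbrakk>x \<in> vecs H; y \<in> vecs K\<rbrakk>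
      \<Longrightarrow> act (A \<otimes>\<^sub>M B) (vtensor H K x y) = vtensor H' K' (act A x) (act B y)"
proof -
  note HK = htensor_hilbert_space[OF H K] and HK' = htensor_hilbert_space[OF H' K']
  interpret HK': hilbert_space "H' \<otimes>\<^sub>H K'" by (rule HK')
  note on = orthonormal_vtensor[OF H K onb_orthonormal[OF H] onb_orthonormal[OF K]]
  note tot = total_vtensor[OF H K onb_total[OF H] onb_total[OF K]]
  obtain M where M: "bessel_family (H' \<otimes>\<^sub>H K') (onb H \<times> onb K)
      (\<lambda>(b, c). vtensor H' K' (act A b) (act B c)) M"
    using bessel_family_map_tensor[OF assms] by blast
  obtain T where T: "T \<in> bounded_maps (H \<otimes>\<^sub>H K) (H' \<otimes>\<^sub>H K')"
    and sum: "\<And>f g. \<lbrakk>f \<in> vecs (H \<otimes>\<^sub>H K); g \<in> vecs (H' \<otimes>\<^sub>H K')\<rbrakk> \<Longrightarrow>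
      ((\<lambda>p. vinner (H \<otimes>\<^sub>H K) f (case p of (b, c) \<Rightarrow> vtensor H K b c) *
        vinner (H' \<otimes>\<^sub>H K') (case p of (b, c) \<Rightarrow> vtensor H' K' (act A b) (act B c)) g)
      has_sum vinner (H' \<otimes>\<^sub>H K') (act T f) g) (onb H \<times> onb K)"
    using bounded_map_of_families[OF HK HK' orthonormal_family_bessel[OF HK on] M] by blast
  have T_act: "act T (vtensor H K x y) = vtensor H' K' (act A x) (act B y)"
    if x: "x \<in> vecs H" and y: "y \<in> vecs K" for x y
  proof (rule htensor_eqI[OF H' K'])
    note xy = vtensor_closed[OF H K x y]
    show Txy: "act T (vtensor H K x y) \<in> vecs (H' \<otimes>\<^sub>H K')" by (rule act_closed[OF T xy])
    show Axy: "vtensor H' K' (act A x) (act B y) \<in> vecs (H' \<otimes>\<^sub>H K')"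
      by (intro vtensor_closed H' K' act_closed[OF A] act_closed[OF B] x y)
    fix u v assume u: "u \<in> vecs H'" and v: "v \<in> vecs K'"
    let ?u = "act (hadj A) u" and ?v = "act (hadj B) v"
    have uv: "?u \<in> vecs H" "?v \<in> vecs K"
      using act_closed[OF hadj_bounded[OF H H' A] u] act_closed[OF hadj_bounded[OF K K' B] v] .
    note uvt = vtensor_closed[OF H' K' u v]
    have "vinner (H' \<otimes>\<^sub>H K') (case p of (b, c) \<Rightarrow> vtensor H' K' (act A b) (act B c)) (vtensor H' K' u v)
        = vinner (H \<otimes>\<^sub>H K) (case p of (b, c) \<Rightarrow> vtensor H K b c) (vtensor H K ?u ?v)"
      if "p \<in> onb H \<times> onb K" for p
      using that onb_subset[OF H] onb_subset[OF K] uv u v act_closed[OF A] act_closed[OF B]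
      by (auto simp: vinner_vtensor H K H' K' inner_hadj_right[OF H H' A] inner_hadj_right[OF K K' B])
    then have "((\<lambda>p. vinner (H \<otimes>\<^sub>H K) (vtensor H K x y) (case p of (b, c) \<Rightarrow> vtensor H K b c) *
        vinner (H \<otimes>\<^sub>H K) (case p of (b, c) \<Rightarrow> vtensor H K b c) (vtensor H K ?u ?v))
      has_sum vinner (H' \<otimes>\<^sub>H K') (act T (vtensor H K x y)) (vtensor H' K' u v)) (onb H \<times> onb K)"
      using sum[OF xy uvt] by (simp cong: has_sum_cong)
    then have "vinner (H' \<otimes>\<^sub>H K') (act T (vtensor H K x y)) (vtensor H' K' u v)
        = vinner (H \<otimes>\<^sub>H K) (vtensor H K x y) (vtensor H K ?u ?v)"
      using Parseval[OF HK on tot xy vtensor_closed[OF H K uv]] has_sum_unique by blast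
    also have "\<dots> = vinner (H' \<otimes>\<^sub>H K') (vtensor H' K' (act A x) (act B y)) (vtensor H' K' u v)"
      using u v x y uv act_closed[OF A] act_closed[OF B]
      by (simp add: vinner_vtensor H K H' K' inner_hadj_right[OF H H' A] inner_hadj_right[OF K K' B])
    finally show "vinner (H' \<otimes>\<^sub>H K') (vtensor H' K' u v) (act T (vtensor H K x y))
        = vinner (H' \<otimes>\<^sub>H K') (vtensor H' K' u v) (vtensor H' K' (act A x) (act B y))"
      using HK'.inner_commute[OF uvt] Txy Axy by simp
  qed
  have "A \<otimes>\<^sub>M B = T"
    unfolding map_tensor_def bounded_maps_src[OF A] bounded_maps_src[OF B]
      bounded_maps_tgt[OF A] bounded_maps_tgt[OF B]
    using T T_act by (intro the_equality) (auto intro: bounded_maps_htensor_eqI[OF H K HK'])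
  then show "A \<otimes>\<^sub>M B \<in> bounded_maps (H \<otimes>\<^sub>H K) (H' \<otimes>\<^sub>H K')"
    and "\<lbrakk>x \<in> vecs H; y \<in> vecs K\<rbrakk>
      \<Longrightarrow> act (A \<otimes>\<^sub>M B) (vtensor H K x y) = vtensor H' K' (act A x) (act B y)"
    using T T_act by auto
qed

lemma act_hadj_map_tensor:
  assumes H: "hilbert_space H" and K: "hilbert_space K"
    and H': "hilbert_space H'" and K': "hilbert_space K'"
    and A: "A \<in> bounded_maps H H'" and B: "B \<in> bounded_maps K K'"
    and x: "x \<in> vecs H'" and y: "y \<in> vecs K'"
  shows "act (hadj (A \<otimes>\<^sub>M B)) (vtensor H' K' x y) = vtensor H K (act (hadj A) x) (act (hadj B) y)"
proof -
  note HK = htensor_hilbert_space[OF H K] and HK' = htensor_hilbert_space[OF H' K']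
  note AB = map_tensor_bounded[OF assms(1-6)]
  have "act (hadj A) x \<in> vecs H" "act (hadj B) y \<in> vecs K"
    using act_closed[OF hadj_bounded[OF H H' A] x] act_closed[OF hadj_bounded[OF K K' B] y] .
  then show ?thesis
    using act_closed[OF hadj_bounded[OF HK HK' AB] vtensor_closed[OF H' K' x y]]
      act_closed[OF A] act_closed[OF B]
    by (intro htensor_eqI[OF H K])
      (simp_all add: vtensor_closed vinner_vtensor inner_hadj_right[OF HK HK' AB]
        inner_hadj_right[OF H H' A] inner_hadj_right[OF K K' B] act_map_tensor[OF assms(1-6)]
        H K H' K' x y)
qed

section \<open>The complex numbers as unit, and the canonical unitaries\<close>

lemma complex_hilb_simps [simp]:
  "vecs complex_hilb = UNIV" "vadd complex_hilb = (+)" "vzero complex_hilb = 0"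
  "vscale complex_hilb = (*)" "vinner complex_hilb a b = cnj a * b"
  by (simp_all add: complex_hilb_def)

lemma vnorm_complex_hilb [simp]: "vnorm complex_hilb a = cmod a"
  by (simp add: vnorm_def cmod_def power2_eq_square)

lemma hilbert_space_complex_hilb: "hilbert_space complex_hilb"
proof -
  have lim: "\<exists>x. (\<lambda>n. cmod (X n - x)) \<longlonglongrightarrow> 0"
    if C: "\<And>e. e > 0 \<Longrightarrow> \<exists>N. \<forall>m\<ge>N. \<forall>n\<ge>N. cmod (X m - X n) < e" for X :: "nat \<Rightarrow> complex"
  proof -
    have "Cauchy X" using C by (intro metric_CauchyI) (simp add: dist_norm)
    then obtain x where "X \<longlonglongrightarrow> x" using Cauchy_convergent convergent_def by blast
    then show ?thesis by (intro exI[where x = x] tendsto_norm_zero) (simp add: LIM_zero_iff)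
  qed
  have neg: "\<exists>y. x + y = 0" for x :: complex by (rule exI[where x = "- x"]) simp
  show ?thesis
    by (intro hilbert_space.intro cbanach_space.intro cvector_space.intro cbanach_space_axioms.intro)
      (simp_all add: algebra_simps norm_mult norm_triangle_ineq neg lim)
qed

abbreviation "CC \<equiv> complex_hilb"
lemmas CC = hilbert_space_complex_hilb

text \<open>The map that tensors a vector with 1 starts from \<open>H\<close> and is explicit and
  isometric, so it is built first. Its adjoint has the property that defines \<open>lunit\<close>,
  and the adjoint of \<open>lunit\<close> is known at the same time.\<close>

lemma
  assumes H: "hilbert_space H"
  shows lunit_bounded: "lunit H \<in> bounded_maps (CC \<otimes>\<^sub>H H) H"
    and act_lunit: "x \<in> vecs H \<Longrightarrow> act (lunit H) (vtensor CC H a x) = vscale H a x"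
    and act_hadj_lunit: "x \<in> vecs H \<Longrightarrow> act (hadj (lunit H)) x = vtensor CC H 1 x"
proof -
  interpret H: hilbert_space H by fact
  note CH = htensor_hilbert_space[OF CC H]
  define L where "L = \<lparr>src = H, tgt = CC \<otimes>\<^sub>H H, act = restrict (vtensor CC H 1) (vecs H)\<rparr>"
  have L: "L \<in> bounded_maps H (CC \<otimes>\<^sub>H H)" unfolding L_def
    by (rule restrict_bounded_maps[where C = 1])
      (simp_all add: vtensor_closed vtensor_add_right vtensor_scale_right vnorm_vtensor CC H)
  have L_act: "act L x = vtensor CC H 1 x" if "x \<in> vecs H" for x using that by (simp add: L_def)
  note L' = hadj_bounded[OF H CH L]
  have L'_act: "act (hadj L) (vtensor CC H a x) = vscale H a x" if x: "x \<in> vecs H" for a x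
    using act_closed[OF L' vtensor_closed[OF CC H _ x]] x
    by (intro H.vec_eqI)
      (simp_all add: inner_hadj_right[OF H CH L] vtensor_closed L_act vinner_vtensor H.inner_scale CC H)
  have "lunit H = hadj L"
    unfolding lunit_def using L' L'_act
    by (intro the_equality) (auto intro: bounded_maps_htensor_eqI[OF CC H H])
  then show "lunit H \<in> bounded_maps (CC \<otimes>\<^sub>H H) H"
    and "x \<in> vecs H \<Longrightarrow> act (lunit H) (vtensor CC H a x) = vscale H a x"
    and "x \<in> vecs H \<Longrightarrow> act (hadj (lunit H)) x = vtensor CC H 1 x"
    using L' L'_act L_act hadj_hadj[OF H CH L] by simp_all
qed

lemma
  assumes H: "hilbert_space H"
  shows runit_bounded: "runit H \<in> bounded_maps (H \<otimes>\<^sub>H CC) H"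
    and act_runit: "x \<in> vecs H \<Longrightarrow> act (runit H) (vtensor H CC x a) = vscale H a x"
    and act_hadj_runit: "x \<in> vecs H \<Longrightarrow> act (hadj (runit H)) x = vtensor H CC x 1"
proof -
  interpret H: hilbert_space H by fact
  note HC = htensor_hilbert_space[OF H CC]
  define L where "L = \<lparr>src = H, tgt = H \<otimes>\<^sub>H CC, act = restrict (\<lambda>x. vtensor H CC x 1) (vecs H)\<rparr>"
  have L: "L \<in> bounded_maps H (H \<otimes>\<^sub>H CC)" unfolding L_def
    by (rule restrict_bounded_maps[where C = 1])
      (simp_all add: vtensor_closed vtensor_add_left vtensor_scale_left vnorm_vtensor CC H)
  have L_act: "act L x = vtensor H CC x 1" if "x \<in> vecs H" for x using that by (simp add: L_def)
  note L' = hadj_bounded[OF H HC L]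
  have L'_act: "act (hadj L) (vtensor H CC x a) = vscale H a x" if x: "x \<in> vecs H" for a x
    using act_closed[OF L' vtensor_closed[OF H CC x]] x
    by (intro H.vec_eqI)
      (simp_all add: inner_hadj_right[OF H HC L] vtensor_closed L_act vinner_vtensor H.inner_scale CC H)
  have "runit H = hadj L"
    unfolding runit_def using L' L'_act
    by (intro the_equality) (auto intro: bounded_maps_htensor_eqI[OF H CC H])
  then show "runit H \<in> bounded_maps (H \<otimes>\<^sub>H CC) H"
    and "x \<in> vecs H \<Longrightarrow> act (runit H) (vtensor H CC x a) = vscale H a x"
    and "x \<in> vecs H \<Longrightarrow> act (hadj (runit H)) x = vtensor H CC x 1"
    using L' L'_act L_act hadj_hadj[OF H HC L] by simp_all
qed

text \<open>Elementary tensors of basis vectors, bracketed in the two ways, are orthonormal families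
  over one index set, and the map attached to them carries \<open>v\<close> to \<open>w\<close>. On
  general elementary tensors it is identified by matrix elements, as both bracketings have the same
  inner products.\<close>

lemma
  assumes H: "hilbert_space H" and K: "hilbert_space K" and L: "hilbert_space L"
  shows hassoc_bounded: "hassoc H K L \<in> bounded_maps ((H \<otimes>\<^sub>H K) \<otimes>\<^sub>H L) (H \<otimes>\<^sub>H (K \<otimes>\<^sub>H L))"
    and act_hassoc: "\<lbrakk>x \<in> vecs H; y \<in> vecs K; z \<in> vecs L\<rbrakk>
      \<Longrightarrow> act (hassoc H K L) (vtensor (H \<otimes>\<^sub>H K) L (vtensor H K x y) z)
        = vtensor H (K \<otimes>\<^sub>H L) x (vtensor K L y z)"
proof -
  note HK = htensor_hilbert_space[OF H K] and KL = htensor_hilbert_space[OF K L]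
  note HK_L = htensor_hilbert_space[OF HK L] and H_KL = htensor_hilbert_space[OF H KL]
  interpret H_KL: hilbert_space "H \<otimes>\<^sub>H (K \<otimes>\<^sub>H L)" by (rule H_KL)
  define I where "I = (onb H \<times> onb K) \<times> onb L"
  define v where "v = (\<lambda>(p, c). vtensor (H \<otimes>\<^sub>H K) L (case p of (a, b) \<Rightarrow> vtensor H K a b) c)"
  define w where "w = (\<lambda>((a, b), c). vtensor H (K \<otimes>\<^sub>H L) a (vtensor K L b c))"
  note ons = onb_orthonormal[OF H] onb_orthonormal[OF K] onb_orthonormal[OF L]
  note tots = onb_total[OF H] onb_total[OF K] onb_total[OF L]
  note subs = onb_subset[OF H] onb_subset[OF K] onb_subset[OF L]
  have v_on: "orthonormal_family ((H \<otimes>\<^sub>H K) \<otimes>\<^sub>H L) I v"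
    unfolding I_def v_def by (intro orthonormal_vtensor H K L HK ons)
  have v_tot: "total_family ((H \<otimes>\<^sub>H K) \<otimes>\<^sub>H L) I v"
    unfolding I_def v_def by (intro total_vtensor H K L HK tots)
  \<comment> \<open>The general lemma indexes this family by triples bracketed to the right; it is
    transported to \<open>I\<close> so that \<open>v\<close> and \<open>w\<close> share their
    indices.\<close>
  have "orthonormal_family (H \<otimes>\<^sub>H (K \<otimes>\<^sub>H L)) (onb H \<times> (onb K \<times> onb L))
      (\<lambda>(a, p). vtensor H (K \<otimes>\<^sub>H L) a (case p of (b, c) \<Rightarrow> vtensor K L b c))"
    by (intro orthonormal_vtensor H K L KL ons)
  then have w_on: "orthonormal_family (H \<otimes>\<^sub>H (K \<otimes>\<^sub>H L)) I w"
    by (fastforce simp: orthonormal_family_def I_def w_def)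
  obtain T where T: "T \<in> bounded_maps ((H \<otimes>\<^sub>H K) \<otimes>\<^sub>H L) (H \<otimes>\<^sub>H (K \<otimes>\<^sub>H L))"
    and sum: "\<And>f g. \<lbrakk>f \<in> vecs ((H \<otimes>\<^sub>H K) \<otimes>\<^sub>H L); g \<in> vecs (H \<otimes>\<^sub>H (K \<otimes>\<^sub>H L))\<rbrakk> \<Longrightarrow>
      ((\<lambda>i. vinner ((H \<otimes>\<^sub>H K) \<otimes>\<^sub>H L) f (v i) * vinner (H \<otimes>\<^sub>H (K \<otimes>\<^sub>H L)) (w i) g)
        has_sum vinner (H \<otimes>\<^sub>H (K \<otimes>\<^sub>H L)) (act T f) g) I"
    using bounded_map_of_families[OF HK_L H_KL orthonormal_family_bessel[OF HK_L v_on]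
        orthonormal_family_bessel[OF H_KL w_on]] by blast
  have T_act: "act T (vtensor (H \<otimes>\<^sub>H K) L (vtensor H K x y) z) = vtensor H (K \<otimes>\<^sub>H L) x (vtensor K L y z)"
    if xyz: "x \<in> vecs H" "y \<in> vecs K" "z \<in> vecs L" for x y z
  proof -
    let ?l = "vtensor (H \<otimes>\<^sub>H K) L (vtensor H K x y) z" and ?r = "vtensor H (K \<otimes>\<^sub>H L) x (vtensor K L y z)"
    have l: "?l \<in> vecs ((H \<otimes>\<^sub>H K) \<otimes>\<^sub>H L)" and r: "?r \<in> vecs (H \<otimes>\<^sub>H (K \<otimes>\<^sub>H L))"
      using xyz by (simp_all add: vtensor_closed H K L HK KL)
    have Tl: "act T ?l \<in> vecs (H \<otimes>\<^sub>H (K \<otimes>\<^sub>H L))" by (rule act_closed[OF T l])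
    have key: "vinner (H \<otimes>\<^sub>H (K \<otimes>\<^sub>H L)) (act T ?l) (vtensor H (K \<otimes>\<^sub>H L) a (vtensor K L b c))
        = vinner (H \<otimes>\<^sub>H (K \<otimes>\<^sub>H L)) ?r (vtensor H (K \<otimes>\<^sub>H L) a (vtensor K L b c))"
      if abc: "a \<in> vecs H" "b \<in> vecs K" "c \<in> vecs L" for a b c
    proof -
      let ?l' = "vtensor (H \<otimes>\<^sub>H K) L (vtensor H K a b) c" and ?r' = "vtensor H (K \<otimes>\<^sub>H L) a (vtensor K L b c)"
      have l': "?l' \<in> vecs ((H \<otimes>\<^sub>H K) \<otimes>\<^sub>H L)" and r': "?r' \<in> vecs (H \<otimes>\<^sub>H (K \<otimes>\<^sub>H L))"
        using abc by (simp_all add: vtensor_closed H K L HK KL)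
      have "vinner (H \<otimes>\<^sub>H (K \<otimes>\<^sub>H L)) (w i) ?r' = vinner ((H \<otimes>\<^sub>H K) \<otimes>\<^sub>H L) (v i) ?l'" if "i \<in> I" for i
        using that abc subs
        by (auto simp: I_def v_def w_def vinner_vtensor vtensor_closed H K L HK KL)
      then have "((\<lambda>i. vinner ((H \<otimes>\<^sub>H K) \<otimes>\<^sub>H L) ?l (v i) * vinner ((H \<otimes>\<^sub>H K) \<otimes>\<^sub>H L) (v i) ?l')
          has_sum vinner (H \<otimes>\<^sub>H (K \<otimes>\<^sub>H L)) (act T ?l) ?r') I"
        using sum[OF l r'] by (simp cong: has_sum_cong)
      then have "vinner (H \<otimes>\<^sub>H (K \<otimes>\<^sub>H L)) (act T ?l) ?r' = vinner ((H \<otimes>\<^sub>H K) \<otimes>\<^sub>H L) ?l ?l'"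
        using Parseval[OF HK_L v_on v_tot l l'] has_sum_unique by blast
      then show ?thesis
        using abc xyz by (simp add: vinner_vtensor vtensor_closed H K L HK KL)
    qed
    have tot: "total_family (H \<otimes>\<^sub>H (K \<otimes>\<^sub>H L)) (vecs H \<times> (vecs K \<times> vecs L))
        (\<lambda>(a, p). vtensor H (K \<otimes>\<^sub>H L) a (case p of (b, c) \<Rightarrow> vtensor K L b c))"
      by (intro total_vtensor total_vecs H K L KL)
    show ?thesis
    proof (rule total_family_eqI[OF H_KL tot Tl r], clarsimp)
      fix a b c assume abc: "a \<in> vecs H" "b \<in> vecs K" "c \<in> vecs L"
      then have "vtensor H (K \<otimes>\<^sub>H L) a (vtensor K L b c) \<in> vecs (H \<otimes>\<^sub>H (K \<otimes>\<^sub>H L))"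
        by (simp add: vtensor_closed H K L KL)
      then show "vinner (H \<otimes>\<^sub>H (K \<otimes>\<^sub>H L)) (vtensor H (K \<otimes>\<^sub>H L) a (vtensor K L b c)) (act T ?l)
          = vinner (H \<otimes>\<^sub>H (K \<otimes>\<^sub>H L)) (vtensor H (K \<otimes>\<^sub>H L) a (vtensor K L b c)) ?r"
        using key[OF abc] H_KL.inner_commute Tl r by metis
    qed
  qed
  have tot: "total_family ((H \<otimes>\<^sub>H K) \<otimes>\<^sub>H L) ((vecs H \<times> vecs K) \<times> vecs L)
      (\<lambda>(p, c). vtensor (H \<otimes>\<^sub>H K) L (case p of (a, b) \<Rightarrow> vtensor H K a b) c)"
    by (intro total_vtensor total_vecs H K L HK)
  have "hassoc H K L = T"
    unfolding hassoc_def using T T_act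
    by (intro the_equality) (auto intro!: bounded_maps_total_eqI[OF HK_L H_KL tot])
  then show "hassoc H K L \<in> bounded_maps ((H \<otimes>\<^sub>H K) \<otimes>\<^sub>H L) (H \<otimes>\<^sub>H (K \<otimes>\<^sub>H L))"
    and "\<lbrakk>x \<in> vecs H; y \<in> vecs K; z \<in> vecs L\<rbrakk>
      \<Longrightarrow> act (hassoc H K L) (vtensor (H \<otimes>\<^sub>H K) L (vtensor H K x y) z)
        = vtensor H (K \<otimes>\<^sub>H L) x (vtensor K L y z)"
    using T T_act by simp_all
qed

text \<open>The pairings of both sides with triple elementary tensors are the same product of three
  inner products, up to associativity of complex multiplication.\<close>

lemma act_hadj_hassoc:
  assumes H: "hilbert_space H" and K: "hilbert_space K" and L: "hilbert_space L"
    and xyz: "x \<in> vecs H" "y \<in> vecs K" "z \<in> vecs L"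
  shows "act (hadj (hassoc H K L)) (vtensor H (K \<otimes>\<^sub>H L) x (vtensor K L y z))
    = vtensor (H \<otimes>\<^sub>H K) L (vtensor H K x y) z"
proof -
  note HK = htensor_hilbert_space[OF H K] and KL = htensor_hilbert_space[OF K L]
  note HK_L = htensor_hilbert_space[OF HK L] and H_KL = htensor_hilbert_space[OF H KL]
  note a = hassoc_bounded[OF H K L]
  have tot: "total_family ((H \<otimes>\<^sub>H K) \<otimes>\<^sub>H L) ((vecs H \<times> vecs K) \<times> vecs L)
      (\<lambda>(p, c). vtensor (H \<otimes>\<^sub>H K) L (case p of (a, b) \<Rightarrow> vtensor H K a b) c)"
    by (intro total_vtensor total_vecs H K L HK)
  show ?thesis
    using xyz act_closed[OF hadj_bounded[OF HK_L H_KL a]]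
    by (intro total_family_eqI[OF HK_L tot])
      (auto simp: vtensor_closed inner_hadj_right[OF HK_L H_KL a] act_hassoc vinner_vtensor
        H K L HK KL mult.assoc)
qed

section \<open>Isometries, and the trace argument for finite dimension\<close>

lemma isometry_act:
  assumes A: "A \<in> bounded_maps H K" and iso: "isometry A" and x: "x \<in> vecs H"
  shows "act (hadj A) (act A x) = x"
proof -
  have "act (hadj A \<circ>\<^sub>H A) x = act (hid H) x"
    using iso unfolding isometry_def bounded_maps_src[OF A] by (rule arg_cong)
  then show ?thesis by (simp only: act_hcomp[OF A x] act_hid[OF x])
qed

lemma hadj_hid: "hilbert_space H \<Longrightarrow> hadj (hid H) = hid H"
  by (rule hadj_eqI[OF _ hid_bounded hid_bounded]) (simp_all add: act_hid)

lemma map_tensor_hid_isometry: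
  assumes H: "hilbert_space H" and K: "hilbert_space K" and L: "hilbert_space L"
    and A: "A \<in> bounded_maps H K" "isometry A" and z: "z \<in> vecs (H \<otimes>\<^sub>H L)"
  shows "act (hadj (A \<otimes>\<^sub>M hid L)) (act (A \<otimes>\<^sub>M hid L) z) = z"
proof -
  note HL = htensor_hilbert_space[OF H L] and KL = htensor_hilbert_space[OF K L]
  note AL = map_tensor_bounded[OF H L K L A(1) hid_bounded[OF L]]
  have "hadj (A \<otimes>\<^sub>M hid L) \<circ>\<^sub>H (A \<otimes>\<^sub>M hid L) = hid (H \<otimes>\<^sub>H L)"
    using act_closed[OF A(1)] isometry_act[OF A]
    by (intro bounded_maps_htensor_eqI[OF H L HL] hcomp_bounded[OF hadj_bounded[OF HL KL AL] AL HL KL]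
        hid_bounded HL)
      (simp add: act_hcomp[OF AL] vtensor_closed act_map_tensor[OF H L K L A(1) hid_bounded[OF L]]
        act_hadj_map_tensor[OF H L K L A(1) hid_bounded[OF L]] act_hid hadj_hid H L)
  then show ?thesis using z by (metis act_hcomp[OF AL] act_hid)
qed

text \<open>For fixed \<open>x\<close> and \<open>z\<close> the left-hand side is a bounded functional of \<open>r\<close>, and its representing
  vector is determined by its values on elementary tensors.\<close>

lemma has_sum_pairing:
  assumes H: "hilbert_space H" and K: "hilbert_space K"
    and rb: "rb \<in> vecs (H \<otimes>\<^sub>H K)" and r: "r \<in> vecs (K \<otimes>\<^sub>H H)" and e: "e \<in> onb H"
  shows "((\<lambda>c. cnj (rb (e, c)) * r (c, e)) has_sum
    vinner ((H \<otimes>\<^sub>H K) \<otimes>\<^sub>H H) (vtensor (H \<otimes>\<^sub>H K) H rb e)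
      (act (hadj (hassoc H K H)) (vtensor H (K \<otimes>\<^sub>H H) e r))) (onb K)"
proof -
  note HK = htensor_hilbert_space[OF H K] and KH = htensor_hilbert_space[OF K H]
  note HK_H = htensor_hilbert_space[OF HK H] and H_KH = htensor_hilbert_space[OF H KH]
  interpret KH: hilbert_pair K H by (rule hilbert_pair.intro[OF K H])
  interpret V: hilbert_space "H \<otimes>\<^sub>H (K \<otimes>\<^sub>H H)" by (rule H_KH)
  note a = hassoc_bounded[OF H K H]
  have eH: "e \<in> vecs H" using onb_subset[OF H e] .
  \<comment> \<open>Applying the associator in the left argument leaves \<open>g\<close> only inside
    an elementary tensor, where linearity and the norm bound of the functional \<open>\<phi>\<close>
    are explicit.\<close>
  define p where "p = act (hassoc H K H) (vtensor (H \<otimes>\<^sub>H K) H rb e)"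
  define \<phi> where "\<phi> g = vinner (H \<otimes>\<^sub>H (K \<otimes>\<^sub>H H)) p (vtensor H (K \<otimes>\<^sub>H H) e g)" for g
  have rbe: "vtensor (H \<otimes>\<^sub>H K) H rb e \<in> vecs ((H \<otimes>\<^sub>H K) \<otimes>\<^sub>H H)"
    using eH rb by (simp add: vtensor_closed H HK)
  have p: "p \<in> vecs (H \<otimes>\<^sub>H (K \<otimes>\<^sub>H H))"
    unfolding p_def by (rule act_closed[OF a rbe])
  have \<phi>: "\<phi> g = vinner ((H \<otimes>\<^sub>H K) \<otimes>\<^sub>H H) (vtensor (H \<otimes>\<^sub>H K) H rb e)
      (act (hadj (hassoc H K H)) (vtensor H (K \<otimes>\<^sub>H H) e g))" if "g \<in> vecs (K \<otimes>\<^sub>H H)" for g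
    unfolding \<phi>_def p_def
    using that eH rbe by (simp add: inner_hadj_right[OF HK_H H_KH a] vtensor_closed H KH)
  have "\<exists>w\<in>vecs (K \<otimes>\<^sub>H H). \<forall>g\<in>vecs (K \<otimes>\<^sub>H H). \<phi> g = vinner (K \<otimes>\<^sub>H H) w g"
  proof (rule hilbert_space.Riesz[OF KH])
    show "cmod (\<phi> g) \<le> (vnorm (H \<otimes>\<^sub>H (K \<otimes>\<^sub>H H)) p * vnorm H e) * vnorm (K \<otimes>\<^sub>H H) g"
      if "g \<in> vecs (K \<otimes>\<^sub>H H)" for g
      using V.Cauchy_Schwarz[OF p vtensor_closed[OF H KH eH that]] that eH
      by (simp add: \<phi>_def vnorm_vtensor H KH mult.assoc)
  qed (use eH p in \<open>simp_all add: \<phi>_def vtensor_add_right vtensor_scale_right vtensor_closed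
      V.inner_add V.inner_scale H KH\<close>)
  then obtain w where w: "w \<in> vecs (K \<otimes>\<^sub>H H)"
    and \<phi>w: "\<And>g. g \<in> vecs (K \<otimes>\<^sub>H H) \<Longrightarrow> \<phi> g = vinner (K \<otimes>\<^sub>H H) w g" by blast
  \<comment> \<open>In effect \<open>w\<close> is the elementary tensor of \<open>k\<close> and
    \<open>e\<close>, where \<open>k\<close> represents the slice of \<open>rb\<close> at
    \<open>e\<close>. Its values at basis pairs \<open>(c, b)\<close> with \<open>b\<close>
    different from \<open>e\<close> vanish, and the double sum collapses to one over
    \<open>onb K\<close>.\<close>
  have w_apply: "cnj (w (c, b)) = cnj (rb (e, c)) * vinner H e b" if cb: "c \<in> vecs K" "b \<in> vecs H" for c b
  proof -
    note cb' = vtensor_closed[OF K H cb] and ec' = vtensor_closed[OF H K eH cb(1)]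
    have "cnj (w (c, b)) = cnj (vinner (K \<otimes>\<^sub>H H) (vtensor K H c b) w)"
      using cb w by (simp add: vinner_vtensor_eval K H)
    also have "\<dots> = \<phi> (vtensor K H c b)"
      unfolding \<phi>w[OF cb'] by (rule hilbert_space.inner_commute[OF KH w cb', symmetric])
    also have "\<dots> = vinner (H \<otimes>\<^sub>H K) rb (vtensor H K e c) * vinner H e b"
      using eH cb rb ec' by (simp add: \<phi>[OF cb'] act_hadj_hassoc vinner_vtensor H K HK)
    also have "vinner (H \<otimes>\<^sub>H K) rb (vtensor H K e c) = cnj (rb (e, c))"
      using hilbert_space.inner_commute[OF HK rb ec'] eH cb rb by (simp add: vinner_vtensor_eval H K)
    finally show ?thesis .
  qed
  have "((\<lambda>p. cnj (w p) * r p) has_sum \<phi> r) (onb K \<times> onb H)"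
    unfolding \<phi>w[OF r] vinner_htensor
    using w r by (intro has_sum_infsum KH.vinner_htensor_summable) (simp_all add: vecs_htensor)
  moreover have "((\<lambda>p. cnj (w p) * r p) has_sum \<phi> r) (onb K \<times> onb H)
      \<longleftrightarrow> ((\<lambda>p. cnj (w p) * r p) has_sum \<phi> r) (onb K \<times> {e})"
  proof (rule has_sum_cong_neutral)
    fix p assume "p \<in> onb K \<times> onb H - onb K \<times> {e}"
    then obtain c b where p: "p = (c, b)" "c \<in> onb K" "b \<in> onb H" "b \<noteq> e" by blast
    have "vinner H e b = 0"
      using p e onb_orthonormal[OF H] unfolding orthonormal_family_def by metis
    then show "cnj (w p) * r p = 0"
      using w_apply[OF onb_subset[OF K p(2)] onb_subset[OF H p(3)]] p(1) by simp
  qed (use e in auto)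
  ultimately have "((\<lambda>p. cnj (w p) * r p) has_sum \<phi> r) (onb K \<times> {e})" by blast
  moreover have "onb K \<times> {e} = (\<lambda>c. (c, e)) ` onb K" by auto
  ultimately have "((\<lambda>c. cnj (w (c, e)) * r (c, e)) has_sum \<phi> r) (onb K)"
    by (simp add: has_sum_reindex inj_on_def o_def)
  moreover have "cnj (w (c, e)) * r (c, e) = cnj (rb (e, c)) * r (c, e)" if "c \<in> onb K" for c
    using that e onb_orthonormal[OF H] onb_subset[OF K] eH
    by (auto simp: w_apply orthonormal_family_def)
  ultimately show ?thesis unfolding \<phi>[OF r, symmetric] by (simp cong: has_sum_cong)
qed

lemma finite_onb:
  assumes H: "hilbert_space H" and K: "hilbert_space K"
    and rb: "rb \<in> vecs (H \<otimes>\<^sub>H K)" and r: "r \<in> vecs (K \<otimes>\<^sub>H H)"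
    and eq: "\<And>e. e \<in> onb H \<Longrightarrow> vinner ((H \<otimes>\<^sub>H K) \<otimes>\<^sub>H H) (vtensor (H \<otimes>\<^sub>H K) H rb e)
      (act (hadj (hassoc H K H)) (vtensor H (K \<otimes>\<^sub>H H) e r)) = 1"
  shows "finite (onb H)"
    and "of_nat (card (onb H)) = (\<Sum>\<^sub>\<infinity>(e, c)\<in>onb H \<times> onb K. cnj (rb (e, c)) * r (c, e))"
proof -
  interpret HK: hilbert_pair H K by (rule hilbert_pair.intro[OF H K])
  interpret KH: hilbert_pair K H by (rule hilbert_pair.intro[OF K H])
  \<comment> \<open>Transposing \<open>r\<close> puts both families on the same index set, where
    Cauchy-Schwarz makes the double sum absolutely convergent.\<close>
  define f g where "f p = cnj (rb p)" and "g p = r (prod.swap p)" for p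
  have "(\<Sum>p\<in>F. (cmod (g p))\<^sup>2) \<le> (vnorm (K \<otimes>\<^sub>H H) r)\<^sup>2" if "finite F" "F \<subseteq> onb H \<times> onb K" for F
  proof -
    have "(\<Sum>p\<in>F. (cmod (g p))\<^sup>2) = (\<Sum>p\<in>prod.swap ` F. (cmod (r p))\<^sup>2)"
      by (subst sum.reindex) (auto simp: g_def)
    also have "\<dots> \<le> (vnorm (K \<otimes>\<^sub>H H) r)\<^sup>2"
      using that r by (intro KH.sum_le_vnorm_htensor) (auto simp: vecs_htensor)
    finally show ?thesis .
  qed
  moreover have "(\<Sum>p\<in>F. (cmod (f p))\<^sup>2) \<le> (vnorm (H \<otimes>\<^sub>H K) rb)\<^sup>2"
    if "finite F" "F \<subseteq> onb H \<times> onb K" for F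
    using HK.sum_le_vnorm_htensor[of rb F] that rb by (simp add: f_def vecs_htensor)
  ultimately have summable: "(\<lambda>p. f p * g p) summable_on (onb H \<times> onb K)"
    by (intro product_l2(2)[where a = "vnorm (H \<otimes>\<^sub>H K) rb" and b = "vnorm (K \<otimes>\<^sub>H H) r"])
      (auto simp: HK.vnorm_htensor_nonneg KH.vnorm_htensor_nonneg)
  then have summable': "(\<lambda>(e, c). f (e, c) * g (e, c)) summable_on (onb H \<times> onb K)"
    by (simp add: case_prod_unfold)
  have one: "(\<Sum>\<^sub>\<infinity>c\<in>onb K. f (e, c) * g (e, c)) = 1" if "e \<in> onb H" for e
    using has_sum_pairing[OF H K rb r that] eq[OF that] by (simp add: f_def g_def infsumI)
  have "(\<lambda>e. \<Sum>\<^sub>\<infinity>c\<in>onb K. f (e, c) * g (e, c)) summable_on onb H"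
    using summable_on_Sigma_banach[OF summable'] .
  \<comment> \<open>The row sums of a summable double family are summable. All of them are 1, and a
    nonzero constant is summable only over a finite set.\<close>
  then have "(\<lambda>_. 1 :: complex) summable_on onb H"
    by (rule summable_on_cong[THEN iffD1, rotated]) (simp add: one)
  then have "(\<lambda>_. Re 1) summable_on onb H"
    by (rule summable_on_Re)
  then show fin: "finite (onb H)"
    using infsum_diverge_constant[of "onb H" "1 :: real"] by auto
  have "(\<Sum>\<^sub>\<infinity>(e, c)\<in>onb H \<times> onb K. f (e, c) * g (e, c)) = (\<Sum>\<^sub>\<infinity>e\<in>onb H. 1)"
    unfolding infsum_Sigma'_banach[OF summable', symmetric] by (intro infsum_cong one)
  then show "of_nat (card (onb H)) = (\<Sum>\<^sub>\<infinity>(e, c)\<in>onb H \<times> onb K. cnj (rb (e, c)) * r (c, e))"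
    using fin by (simp add: f_def g_def)
qed

text \<open>Writing the two vectors as matrices \<open>A\<close> and \<open>B\<close>, the equations give \<open>A B = 1\<close> and
  \<open>cnj B cnj A = 1\<close>, so both cardinalities are the trace of \<open>A B\<close>.\<close>

lemma card_onb_eq:
  assumes H: "hilbert_space H" and K: "hilbert_space K"
    and rb: "rb \<in> vecs (H \<otimes>\<^sub>H K)" and r: "r \<in> vecs (K \<otimes>\<^sub>H H)"
    and eq: "\<And>e. e \<in> onb H \<Longrightarrow> vinner ((H \<otimes>\<^sub>H K) \<otimes>\<^sub>H H) (vtensor (H \<otimes>\<^sub>H K) H rb e)
      (act (hadj (hassoc H K H)) (vtensor H (K \<otimes>\<^sub>H H) e r)) = 1"
    and eq': "\<And>c. c \<in> onb K \<Longrightarrow> vinner ((K \<otimes>\<^sub>H H) \<otimes>\<^sub>H K) (vtensor (K \<otimes>\<^sub>H H) K r c)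
      (act (hadj (hassoc K H K)) (vtensor K (H \<otimes>\<^sub>H K) c rb)) = 1"
  shows "card (onb H) = card (onb K)"
proof -
  have "(of_nat (card (onb K)) :: complex) = (\<Sum>\<^sub>\<infinity>(c, e)\<in>onb K \<times> onb H. cnj (r (c, e)) * rb (e, c))"
    by (rule finite_onb(2)[OF K H r rb eq'])
  also have "\<dots> = (\<Sum>\<^sub>\<infinity>(e, c)\<in>onb H \<times> onb K. cnj (r (c, e)) * rb (e, c))"
    by (rule infsum_reindex_bij_witness[where i = prod.swap and j = prod.swap]) auto
  \<comment> \<open>Up to conjugation this is the sum for \<open>H\<close>. That sum is a
    cardinality, hence real, and the conjugation disappears in the last step.\<close>
  also have "\<dots> = cnj (\<Sum>\<^sub>\<infinity>(e, c)\<in>onb H \<times> onb K. cnj (rb (e, c)) * r (c, e))"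
    unfolding infsum_cnj[symmetric] by (intro infsum_cong) (auto simp: mult.commute)
  also have "\<dots> = of_nat (card (onb H))"
    by (simp flip: finite_onb(2)[OF H K rb r eq])
  finally show ?thesis by simp
qed

text \<open>The star of the identity equals its product with the identity, which has the
  self-adjoint form \<open>A^* A\<close>.\<close>

lemma (in cstar_category) star_ident:
  assumes "\<rho> \<in> Obj T" shows "Star T (Ident T \<rho>) = Ident T \<rho>"
proof -
  note i = ident_closed[OF assms] and si = star_closed[OF assms assms ident_closed[OF assms]]
  have "Star T (Star T (Ident T \<rho>) \<cdot> Ident T \<rho>) = Star T (Ident T \<rho>) \<cdot> Star T (Star T (Ident T \<rho>))"
    by (rule star_comp[OF assms assms assms si i])
  then show ?thesis
    using ident_right[OF assms assms si] star_star[OF assms assms i] by simp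
qed

section \<open>Quasitensor functors and conjugates\<close>

context quasitensor_functor
begin

text \<open>Let \<open>W\<close> be the isometry \<open>S\<^bsub>\<rho>,\<sigma>,\<tau>\<^esub>\<close>. A vector \<open>y\<close> in the range of \<open>S2\<close> with \<open>W\<^sup>* y = 0\<close> satisfies
  \<open>0 \<le> -\<parallel>S1\<^sup>* y\<parallel>\<^sup>2\<close> by the range condition. It is applied to \<open>y = S2 g - W W\<^sup>* S2 g\<close>.\<close>

lemma hadj_S_S:
  assumes \<rho>: "\<rho> \<in> Obj T" and \<sigma>: "\<sigma> \<in> Obj T" and \<tau>: "\<tau> \<in> Obj T"
    and g: "g \<in> vecs (Fo \<rho> \<otimes>\<^sub>H Fo (\<sigma> \<otimes>\<^sub>o \<tau>))"
  shows "act (hadj (S (\<rho> \<otimes>\<^sub>o \<sigma>) \<tau>)) (act (S \<rho> (\<sigma> \<otimes>\<^sub>o \<tau>)) g)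
    = act (S \<rho> \<sigma> \<otimes>\<^sub>M hid (Fo \<tau>)) (act (hadj (hassoc (Fo \<rho>) (Fo \<sigma>) (Fo \<tau>)))
        (act (hadj (hid (Fo \<rho>) \<otimes>\<^sub>M S \<sigma> \<tau>)) g))"
proof -
  define H K L X where "H = Fo \<rho>" and "K = Fo \<sigma>" and "L = Fo \<tau>" and "X = Fo (\<rho> \<otimes>\<^sub>o \<sigma> \<otimes>\<^sub>o \<tau>)"
  define M N where "M = Fo (\<rho> \<otimes>\<^sub>o \<sigma>)" and "N = Fo (\<sigma> \<otimes>\<^sub>o \<tau>)"
  note \<rho>\<sigma> = otensor_closed[OF \<rho> \<sigma>] and \<sigma>\<tau> = otensor_closed[OF \<sigma> \<tau>]
  have H: "hilbert_space H" and K: "hilbert_space K" and L: "hilbert_space L"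
    and X: "hilbert_space X" and M: "hilbert_space M" and N: "hilbert_space N"
    unfolding H_def K_def L_def X_def M_def N_def
    by (intro F_obj \<rho> \<sigma> \<tau> otensor_closed)+
  note HK = htensor_hilbert_space[OF H K] and KL = htensor_hilbert_space[OF K L]
  note HKL = htensor_hilbert_space[OF HK L] and H_KL = htensor_hilbert_space[OF H KL]
  note LM = htensor_hilbert_space[OF M L] and HN = htensor_hilbert_space[OF H N]
  define S1 S2 where "S1 = S (\<rho> \<otimes>\<^sub>o \<sigma>) \<tau>" and "S2 = S \<rho> (\<sigma> \<otimes>\<^sub>o \<tau>)"
  define s t a where "s = S \<rho> \<sigma> \<otimes>\<^sub>M hid L" and "t = hid H \<otimes>\<^sub>M S \<sigma> \<tau>" and "a = hassoc H K L"
  define W where "W = S1 \<circ>\<^sub>H s"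
  have S1: "S1 \<in> bounded_maps (M \<otimes>\<^sub>H L) X"
    unfolding S1_def M_def L_def X_def using S_map[OF \<rho>\<sigma> \<tau>] unfolding otensor_assoc[OF \<rho> \<sigma> \<tau>] .
  have S2: "S2 \<in> bounded_maps (H \<otimes>\<^sub>H N) X"
    unfolding S2_def H_def N_def X_def by (rule S_map[OF \<rho> \<sigma>\<tau>])
  have S1_iso: "isometry S1" and S2_iso: "isometry S2"
    unfolding S1_def S2_def by (intro S_isometry \<rho> \<sigma> \<tau> otensor_closed)+
  have S\<rho>\<sigma>: "S \<rho> \<sigma> \<in> bounded_maps (H \<otimes>\<^sub>H K) M" and S\<sigma>\<tau>: "S \<sigma> \<tau> \<in> bounded_maps (K \<otimes>\<^sub>H L) N"
    unfolding H_def K_def L_def M_def N_def by (intro S_map \<rho> \<sigma> \<tau>)+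
  have s: "s \<in> bounded_maps ((H \<otimes>\<^sub>H K) \<otimes>\<^sub>H L) (M \<otimes>\<^sub>H L)"
    unfolding s_def by (rule map_tensor_bounded[OF HK L M L S\<rho>\<sigma> hid_bounded[OF L]])
  have t: "t \<in> bounded_maps (H \<otimes>\<^sub>H (K \<otimes>\<^sub>H L)) (H \<otimes>\<^sub>H N)"
    unfolding t_def by (rule map_tensor_bounded[OF H KL H N hid_bounded[OF H] S\<sigma>\<tau>])
  have a: "a \<in> bounded_maps ((H \<otimes>\<^sub>H K) \<otimes>\<^sub>H L) (H \<otimes>\<^sub>H (K \<otimes>\<^sub>H L))"
    unfolding a_def by (rule hassoc_bounded[OF H K L])
  have W: "W \<in> bounded_maps ((H \<otimes>\<^sub>H K) \<otimes>\<^sub>H L) X"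
    unfolding W_def by (rule hcomp_bounded[OF S1 s HKL LM])
  \<comment> \<open>The two factorisations of \<open>W\<close> have different tasks: since
    \<open>S1\<close> and \<open>S2\<close> are isometries, the first gives
    \<open>S1^* W = s\<close> and the second gives \<open>W^* S2 = a^* t^*\<close>.\<close>
  have W_alt: "W = S2 \<circ>\<^sub>H t \<circ>\<^sub>H a"
    unfolding W_def S1_def S2_def s_def t_def a_def H_def K_def L_def by (rule S_assoc[OF \<rho> \<sigma> \<tau>])
  have W_S1: "act W z = act S1 (act s z)" if "z \<in> vecs ((H \<otimes>\<^sub>H K) \<otimes>\<^sub>H L)" for z
    unfolding W_def using that by (simp add: act_hcomp[OF s])
  have W_S2: "act W z = act S2 (act t (act a z))" if "z \<in> vecs ((H \<otimes>\<^sub>H K) \<otimes>\<^sub>H L)" for z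
    unfolding W_alt using that act_closed[OF a] by (simp add: act_hcomp[OF a] act_hcomp[OF t])
  have adj_W_S1: "act (hadj W) x = act (hadj s) (act (hadj S1) x)" if "x \<in> vecs X" for x
    unfolding W_def hadj_hcomp[OF HKL LM X S1 s]
    using that by (simp add: act_hcomp[OF hadj_bounded[OF LM X S1]])
  have adj_W_S2: "act (hadj W) x = act (hadj a) (act (hadj t) (act (hadj S2) x))" if "x \<in> vecs X" for x
    unfolding W_alt hadj_hcomp[OF HKL H_KL X hcomp_bounded[OF S2 t H_KL HN] a]
      hadj_hcomp[OF H_KL HN X S2 t]
    using that act_closed[OF hadj_bounded[OF HN X S2]]
    by (simp add: act_hcomp[OF hcomp_bounded[OF hadj_bounded[OF H_KL HN t] hadj_bounded[OF HN X S2] X HN]]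
        act_hcomp[OF hadj_bounded[OF HN X S2]])
  have W_iso: "act (hadj W) (act W z) = z" if z: "z \<in> vecs ((H \<otimes>\<^sub>H K) \<otimes>\<^sub>H L)" for z
  proof -
    have "act (hadj W) (act W z) = act (hadj s) (act s z)"
      using z act_closed[OF s z] act_closed[OF W z]
      by (simp add: adj_W_S1 W_S1[OF z] isometry_act[OF S1 S1_iso] act_closed[OF S1])
    also have "\<dots> = z"
      using z S_isometry[OF \<rho> \<sigma>] unfolding s_def
      by (intro map_tensor_hid_isometry[OF HK M L S\<rho>\<sigma>])
    finally show ?thesis .
  qed
  have g': "g \<in> vecs (H \<otimes>\<^sub>H N)" using g by (simp add: H_def N_def)
  interpret HKL: hilbert_space "(H \<otimes>\<^sub>H K) \<otimes>\<^sub>H L" by (rule HKL)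
  interpret HN: hilbert_space "H \<otimes>\<^sub>H N" by (rule HN)
  interpret LM: hilbert_space "M \<otimes>\<^sub>H L" by (rule LM)
  interpret X: hilbert_space X by (rule X)
  \<comment> \<open>The vector \<open>k\<close> is chosen such that
    \<open>S2 k = W W^* S2 g\<close>. Hence \<open>y = S2 h\<close> is the part of
    \<open>S2 g\<close> orthogonal to the range of \<open>W\<close>, and it still lies in the range
    of \<open>S2\<close>.\<close>
  define m where "m = act (hadj W) (act S2 g)"
  define k where "k = act t (act a m)"
  define h where "h = vadd (H \<otimes>\<^sub>H N) g (vscale (H \<otimes>\<^sub>H N) (-1) k)"
  define y where "y = act S2 h"
  have m: "m \<in> vecs ((H \<otimes>\<^sub>H K) \<otimes>\<^sub>H L)"
    unfolding m_def by (rule act_closed[OF hadj_bounded[OF HKL X W] act_closed[OF S2 g']])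
  have k: "k \<in> vecs (H \<otimes>\<^sub>H N)" unfolding k_def by (intro act_closed[OF t] act_closed[OF a] m)
  have h: "h \<in> vecs (H \<otimes>\<^sub>H N)" unfolding h_def using g' k by simp
  have y: "y \<in> vecs X" unfolding y_def by (rule act_closed[OF S2 h])
  have S2k: "act S2 k = act W m" unfolding k_def by (rule W_S2[OF m, symmetric])
  have y_eq: "y = vadd X (act S2 g) (vscale X (-1) (act W m))"
    unfolding y_def h_def using g' k by (simp add: act_add[OF S2] act_scale[OF S2] S2k)
  note Wm = act_closed[OF W m] and S2g = act_closed[OF S2 g']
  have adjW_y: "act (hadj W) y = vzero ((H \<otimes>\<^sub>H K) \<otimes>\<^sub>H L)"
  proof -
    have "act (hadj W) y = vadd ((H \<otimes>\<^sub>H K) \<otimes>\<^sub>H L) m (vscale ((H \<otimes>\<^sub>H K) \<otimes>\<^sub>H L) (-1) m)"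
      unfolding y_eq using Wm S2g
      by (simp add: act_add[OF hadj_bounded[OF HKL X W]] act_scale[OF hadj_bounded[OF HKL X W]]
          W_iso[OF m] flip: m_def)
    also have "\<dots> = vzero ((H \<otimes>\<^sub>H K) \<otimes>\<^sub>H L)"
      using m by (intro HKL.vec_eqI) (simp_all add: HKL.inner_simps)
    finally show ?thesis .
  qed
  have le: "op_le (range_proj S1 \<circ>\<^sub>H range_proj S2) (range_proj W)"
    unfolding W_def S1_def S2_def s_def L_def by (rule S_range[OF \<rho> \<sigma> \<tau>])
  have "src (range_proj W) = X"
    by (simp add: range_proj_def hcomp_def hadj_def bounded_maps_tgt[OF W])
  then obtain c where c: "c \<ge> 0"
      "vinner X y (act (range_proj W) y) - vinner X y (act (range_proj S1 \<circ>\<^sub>H range_proj S2) y) = of_real c"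
    using le y unfolding op_le_def by auto
  have "act (range_proj W) y = vzero X"
  proof -
    \<comment> \<open>The zero vector is written as a multiple by 0, to which homogeneity of
      \<open>W\<close> applies.\<close>
    have "act (range_proj W) y = act W (vscale ((H \<otimes>\<^sub>H K) \<otimes>\<^sub>H L) 0 (vzero ((H \<otimes>\<^sub>H K) \<otimes>\<^sub>H L)))"
      unfolding range_proj_def using y adjW_y
      by (simp add: act_hcomp[OF hadj_bounded[OF HKL X W]] HKL.scl_zero)
    also have "\<dots> = vzero X"
      using act_closed[OF W] by (simp add: act_scale[OF W] X.scl_zero del: HKL.scl_zero)
    finally show ?thesis .
  qed
  \<comment> \<open>The range projection of \<open>S2\<close> fixes \<open>y\<close>, so only that
    of \<open>S1\<close> remains, and its quadratic form is a square norm.\<close>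
  moreover have "act (range_proj S1 \<circ>\<^sub>H range_proj S2) y = act S1 (act (hadj S1) y)"
  proof -
    have P2: "range_proj S2 \<in> bounded_maps X X"
      unfolding range_proj_def by (rule hcomp_bounded[OF S2 hadj_bounded[OF HN X S2] X HN])
    have "act (range_proj S2) y = y"
      unfolding range_proj_def using y h
      by (simp add: act_hcomp[OF hadj_bounded[OF HN X S2]]) (simp add: y_def isometry_act[OF S2 S2_iso])
    then show ?thesis
      using y by (simp add: act_hcomp[OF P2]) (simp add: range_proj_def act_hcomp[OF hadj_bounded[OF LM X S1]])
  qed
  moreover note S1y = act_closed[OF hadj_bounded[OF LM X S1] y]
  ultimately have "- vinner (M \<otimes>\<^sub>H L) (act (hadj S1) y) (act (hadj S1) y) = of_real c"
    using c(2) y by (simp add: inner_hadj_left[OF LM X S1 _ y])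
  then have "(vnorm (M \<otimes>\<^sub>H L) (act (hadj S1) y))\<^sup>2 = - c"
    unfolding LM.vnorm_power2[OF S1y] by (metis Re_complex_of_real minus_minus uminus_complex.sel(1))
  then have "vnorm (M \<otimes>\<^sub>H L) (act (hadj S1) y) = 0"
    using c(1) by (smt (verit) zero_le_power2 power2_eq_iff zero_power2)
  then have zero: "act (hadj S1) y = vzero (M \<otimes>\<^sub>H L)"
    using S1y by (rule LM.nrm_eq_zero[rotated])
  have sm: "act s m \<in> vecs (M \<otimes>\<^sub>H L)" by (rule act_closed[OF s m])
  have S1Wm: "act (hadj S1) (act W m) = act s m"
    using isometry_act[OF S1 S1_iso sm] by (simp add: W_S1[OF m])
  have S1S2g: "act (hadj S1) (act S2 g) \<in> vecs (M \<otimes>\<^sub>H L)"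
    by (rule act_closed[OF hadj_bounded[OF LM X S1] S2g])
  \<comment> \<open>With \<open>y\<close> spelled out as the difference of \<open>S2 g\<close> and
    \<open>W m\<close>, the vanishing of \<open>S1^* y\<close> becomes
    \<open>S1^* S2 g = s m\<close>.\<close>
  have "vadd (M \<otimes>\<^sub>H L) (act (hadj S1) (act S2 g)) (vscale (M \<otimes>\<^sub>H L) (-1) (act s m)) = vzero (M \<otimes>\<^sub>H L)"
    using zero Wm S2g unfolding y_eq
    by (simp add: act_add[OF hadj_bounded[OF LM X S1]] act_scale[OF hadj_bounded[OF LM X S1]] S1Wm)
  then have diff: "vinner (M \<otimes>\<^sub>H L) z (act (hadj S1) (act S2 g)) - vinner (M \<otimes>\<^sub>H L) z (act s m) = 0"
    if "z \<in> vecs (M \<otimes>\<^sub>H L)" for z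
    using that sm S1S2g LM.inner_zero_right[OF that]
      LM.inner_add[OF that S1S2g, of "vscale (M \<otimes>\<^sub>H L) (-1) (act s m)"]
    by (simp add: LM.inner_scale)
  have "act (hadj S1) (act S2 g) = act s m"
    using diff by (intro LM.vec_eqI S1S2g sm) simp
  also have "m = act (hadj a) (act (hadj t) g)"
    unfolding m_def using S2g g' by (simp add: adj_W_S2 isometry_act[OF S2 S2_iso])
  finally show ?thesis
    unfolding S1_def S2_def s_def a_def t_def H_def K_def L_def .
qed

lemma act_u: "act u 1 \<in> vecs (Fo (Unit T))"
  by (rule act_closed[OF u_map]) simp

text \<open>The unit law at the tensor of 1 and \<open>z\<close>: the vector \<open>act u 1\<close>
  plays the role of 1 in \<open>Fo (Unit T)\<close>.\<close>

lemma act_S_unit_left: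
  assumes \<rho>: "\<rho> \<in> Obj T" and z: "z \<in> vecs (Fo \<rho>)"
  shows "act (S (Unit T) \<rho>) (vtensor (Fo (Unit T)) (Fo \<rho>) (act u 1) z) = z"
proof -
  note H = F_obj[OF \<rho>] and U = F_obj[OF unit_obj]
  note CH = htensor_hilbert_space[OF CC H]
  note uH = map_tensor_bounded[OF CC H U H u_map hid_bounded[OF H]]
  have z': "vtensor CC (Fo \<rho>) 1 z \<in> vecs (CC \<otimes>\<^sub>H Fo \<rho>)" using z by (simp add: vtensor_closed CC H)
  have "act (S (Unit T) \<rho> \<circ>\<^sub>H (u \<otimes>\<^sub>M hid (Fo \<rho>))) (vtensor CC (Fo \<rho>) 1 z) = z"
    using z unfolding S_unit_left[OF \<rho>]
    by (simp add: act_lunit[OF H] cvector_space.scl_one[OF cbanach_space.axioms(1)[OF hilbert_space.banach[OF H]]])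
  then show ?thesis
    using z by (simp add: act_hcomp[OF uH z'] act_map_tensor[OF CC H U H u_map hid_bounded[OF H]] act_hid)
qed

lemma act_S_unit_right:
  assumes \<rho>: "\<rho> \<in> Obj T" and z: "z \<in> vecs (Fo \<rho>)"
  shows "act (S \<rho> (Unit T)) (vtensor (Fo \<rho>) (Fo (Unit T)) z (act u 1)) = z"
proof -
  note H = F_obj[OF \<rho>] and U = F_obj[OF unit_obj]
  note HC = htensor_hilbert_space[OF H CC]
  note Hu = map_tensor_bounded[OF H CC H U hid_bounded[OF H] u_map]
  have z': "vtensor (Fo \<rho>) CC z 1 \<in> vecs (Fo \<rho> \<otimes>\<^sub>H CC)" using z by (simp add: vtensor_closed CC H)
  have "act (S \<rho> (Unit T) \<circ>\<^sub>H (hid (Fo \<rho>) \<otimes>\<^sub>M u)) (vtensor (Fo \<rho>) CC z 1) = z"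
    using z unfolding S_unit_right[OF \<rho>]
    by (simp add: act_runit[OF H] cvector_space.scl_one[OF cbanach_space.axioms(1)[OF hilbert_space.banach[OF H]]])
  then show ?thesis
    using z by (simp add: act_hcomp[OF Hu z'] act_map_tensor[OF H CC H U hid_bounded[OF H] u_map] act_hid)
qed

lemma act_S_natural:
  assumes obj: "\<rho> \<in> Obj T" "\<rho>' \<in> Obj T" "\<sigma> \<in> Obj T" "\<sigma>' \<in> Obj T"
    and A: "A \<in> Hom T \<rho> \<rho>'" and B: "B \<in> Hom T \<sigma> \<sigma>'"
    and x: "x \<in> vecs (Fo \<rho>)" and y: "y \<in> vecs (Fo \<sigma>)"
  shows "act (S \<rho>' \<sigma>') (vtensor (Fo \<rho>') (Fo \<sigma>') (act (F A) x) (act (F B) y))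
    = act (F (A \<otimes>\<^sub>a B)) (act (S \<rho> \<sigma>) (vtensor (Fo \<rho>) (Fo \<sigma>) x y))"
proof -
  note hs = F_obj[OF obj(1)] F_obj[OF obj(3)] F_obj[OF obj(2)] F_obj[OF obj(4)]
  note FA = F_arr[OF obj(1,2) A] and FB = F_arr[OF obj(3,4) B]
  note FAB = map_tensor_bounded[OF hs FA FB]
  note xy = vtensor_closed[OF hs(1,2) x y]
  have "act (F (A \<otimes>\<^sub>a B) \<circ>\<^sub>H S \<rho> \<sigma>) (vtensor (Fo \<rho>) (Fo \<sigma>) x y)
      = act (S \<rho>' \<sigma>' \<circ>\<^sub>H (F A \<otimes>\<^sub>M F B)) (vtensor (Fo \<rho>) (Fo \<sigma>) x y)"
    by (simp only: S_natural[OF obj A B])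
  then show ?thesis
    by (simp only: act_hcomp[OF S_map[OF obj(1,3)] xy] act_hcomp[OF FAB xy]
        act_map_tensor[OF hs FA FB x y])
qed

section \<open>Hatted vectors, conjugate equations and dimensions\<close>

lemma conjugate_eqs_sym:
  "conjugate_eqs T \<rho> \<rho>b R Rb \<Longrightarrow> conjugate_eqs T \<rho>b \<rho> Rb R"
  by (auto simp: conjugate_eqs_def)

text \<open>Composing with \<open>u\<close> turns an arrow out of \<open>Fo (Unit T)\<close> into
  one out of the complex numbers, so that the hatted vector is its value at 1.\<close>

abbreviation hat :: "'o \<Rightarrow> 'o \<Rightarrow> 'm \<Rightarrow> (complex, 'h \<times> 'h \<Rightarrow> complex) hmap" where
  "hat \<sigma> \<tau> A \<equiv> hadj (S \<sigma> \<tau>) \<circ>\<^sub>H F A \<circ>\<^sub>H u"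

lemma
  assumes obj: "\<sigma> \<in> Obj T" "\<tau> \<in> Obj T" and A: "A \<in> Hom T (Unit T) (\<sigma> \<otimes>\<^sub>o \<tau>)"
  shows hat_bounded: "hat \<sigma> \<tau> A \<in> bounded_maps CC (Fo \<sigma> \<otimes>\<^sub>H Fo \<tau>)"
    and act_hat: "act (hat \<sigma> \<tau> A) 1 = act (hadj (S \<sigma> \<tau>)) (act (F A) (act u 1))"
proof -
  note st = otensor_closed[OF obj]
  note U = F_obj[OF unit_obj] and X = F_obj[OF st]
  note V = htensor_hilbert_space[OF F_obj[OF obj(1)] F_obj[OF obj(2)]]
  note S' = hadj_bounded[OF V X S_map[OF obj]] and FA = F_arr[OF unit_obj st A]
  note SF = hcomp_bounded[OF S' FA U X]
  show "hat \<sigma> \<tau> A \<in> bounded_maps CC (Fo \<sigma> \<otimes>\<^sub>H Fo \<tau>)"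
    by (rule hcomp_bounded[OF SF u_map CC U])
  show "act (hat \<sigma> \<tau> A) 1 = act (hadj (S \<sigma> \<tau>)) (act (F A) (act u 1))"
    by (simp add: act_hcomp[OF u_map] act_hcomp[OF FA act_u])
qed

text \<open>With \<open>A = Rb (x) 1\<close> and \<open>B = 1 (x) R\<close> the first conjugate
  equation reads \<open>A^* B = 1\<close>, so \<open><z, x> = <F A z, F B x>\<close>. By naturality
  and the unit laws these two vectors are \<open>S1 (rb (x) z)\<close> and
  \<open>S2 (x (x) r)\<close>. The factors of \<open>S1^* S2\<close> provided by
  \<open>hadj_S_S\<close> are then distributed over both arguments, where they turn
  \<open>rb\<close> and \<open>r\<close> into the hatted vectors.\<close>

lemma pairing:
  assumes \<rho>: "\<rho> \<in> Obj T" and \<rho>b: "\<rho>b \<in> Obj T" and conj: "conjugate_eqs T \<rho> \<rho>b R Rb"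
    and x: "x \<in> vecs (Fo \<rho>)" and z: "z \<in> vecs (Fo \<rho>)"
  shows "vinner ((Fo \<rho> \<otimes>\<^sub>H Fo \<rho>b) \<otimes>\<^sub>H Fo \<rho>)
      (vtensor (Fo \<rho> \<otimes>\<^sub>H Fo \<rho>b) (Fo \<rho>) (act (hat \<rho> \<rho>b Rb) 1) z)
      (act (hadj (hassoc (Fo \<rho>) (Fo \<rho>b) (Fo \<rho>)))
        (vtensor (Fo \<rho>) (Fo \<rho>b \<otimes>\<^sub>H Fo \<rho>) x (act (hat \<rho>b \<rho> R) 1))) = vinner (Fo \<rho>) z x"
proof -
  define H K X where "H = Fo \<rho>" and "K = Fo \<rho>b" and "X = Fo (\<rho> \<otimes>\<^sub>o \<rho>b \<otimes>\<^sub>o \<rho>)"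
  define M N where "M = Fo (\<rho> \<otimes>\<^sub>o \<rho>b)" and "N = Fo (\<rho>b \<otimes>\<^sub>o \<rho>)"
  note \<rho>\<rho>b = otensor_closed[OF \<rho> \<rho>b] and \<rho>b\<rho> = otensor_closed[OF \<rho>b \<rho>]
  note \<rho>\<rho>b\<rho> = otensor_closed[OF \<rho> \<rho>b\<rho>]
  have H: "hilbert_space H" and K: "hilbert_space K" and X: "hilbert_space X"
    and M: "hilbert_space M" and N: "hilbert_space N"
    unfolding H_def K_def X_def M_def N_def by (intro F_obj \<rho> \<rho>b otensor_closed)+
  note HK = htensor_hilbert_space[OF H K] and KH = htensor_hilbert_space[OF K H]
  note HKH = htensor_hilbert_space[OF HK H] and H_KH = htensor_hilbert_space[OF H KH]
  note MH = htensor_hilbert_space[OF M H] and HN = htensor_hilbert_space[OF H N]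
  have R: "R \<in> Hom T (Unit T) (\<rho>b \<otimes>\<^sub>o \<rho>)" and Rb: "Rb \<in> Hom T (Unit T) (\<rho> \<otimes>\<^sub>o \<rho>b)"
    and eq: "(Star T Rb \<otimes>\<^sub>a Ident T \<rho>) \<cdot> (Ident T \<rho> \<otimes>\<^sub>a R) = Ident T \<rho>"
    using conj by (auto simp: conjugate_eqs_def)
  note i\<rho> = ident_closed[OF \<rho>]
  define A B where "A = Rb \<otimes>\<^sub>a Ident T \<rho>" and "B = Ident T \<rho> \<otimes>\<^sub>a R"
  \<comment> \<open>Strictness of unit and associativity gives \<open>A\<close> and \<open>B\<close>
    the common source \<open>\<rho>\<close> and a common target, so that \<open>Star T A\<close> can
    be composed with \<open>B\<close>.\<close>
  have A: "A \<in> Hom T \<rho> (\<rho> \<otimes>\<^sub>o \<rho>b \<otimes>\<^sub>o \<rho>)"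
    using atensor_closed[OF unit_obj \<rho>\<rho>b \<rho> \<rho> Rb i\<rho>]
    unfolding A_def otensor_unit_left[OF \<rho>] otensor_assoc[OF \<rho> \<rho>b \<rho>] .
  have B: "B \<in> Hom T \<rho> (\<rho> \<otimes>\<^sub>o \<rho>b \<otimes>\<^sub>o \<rho>)"
    using atensor_closed[OF \<rho> \<rho> unit_obj \<rho>b\<rho> i\<rho> R]
    unfolding B_def otensor_unit_right[OF \<rho>] .
  have AB: "Star T A \<cdot> B = Ident T \<rho>"
    using eq unfolding A_def B_def atensor_star[OF unit_obj \<rho>\<rho>b \<rho> \<rho> Rb i\<rho>] star_ident[OF \<rho>] .
  note A' = star_closed[OF \<rho> \<rho>\<rho>b\<rho> A]
  have FA: "F A \<in> bounded_maps H X" and FB: "F B \<in> bounded_maps H X"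
    unfolding H_def X_def by (intro F_arr \<rho> \<rho>\<rho>b\<rho> A B)+
  define S1 S2 where "S1 = S (\<rho> \<otimes>\<^sub>o \<rho>b) \<rho>" and "S2 = S \<rho> (\<rho>b \<otimes>\<^sub>o \<rho>)"
  have S1: "S1 \<in> bounded_maps (M \<otimes>\<^sub>H H) X"
    using S_map[OF \<rho>\<rho>b \<rho>] unfolding S1_def M_def H_def X_def otensor_assoc[OF \<rho> \<rho>b \<rho>] .
  have S2: "S2 \<in> bounded_maps (H \<otimes>\<^sub>H N) X"
    using S_map[OF \<rho> \<rho>b\<rho>] unfolding S2_def H_def N_def X_def .
  have s: "S \<rho> \<rho>b \<in> bounded_maps (H \<otimes>\<^sub>H K) M" and t: "S \<rho>b \<rho> \<in> bounded_maps (K \<otimes>\<^sub>H H) N"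
    unfolding H_def K_def M_def N_def by (intro S_map \<rho> \<rho>b)+
  define r rb where "r = act (F R) (act u 1)" and "rb = act (F Rb) (act u 1)"
  have r: "r \<in> vecs N" and rb: "rb \<in> vecs M"
    unfolding r_def rb_def N_def M_def
    using act_closed[OF F_arr[OF unit_obj \<rho>b\<rho> R] act_u] act_closed[OF F_arr[OF unit_obj \<rho>\<rho>b Rb] act_u] .
  have xH: "x \<in> vecs H" and zH: "z \<in> vecs H" using x z by (simp_all add: H_def)
  have F_ident_act: "act (F (Ident T \<rho>)) v = v" if "v \<in> vecs H" for v
    using that unfolding F_ident[OF \<rho>] H_def by (rule act_hid)
  have S1z: "act S1 (vtensor M H rb z) = act (F A) z"
    using act_S_natural[OF unit_obj \<rho>\<rho>b \<rho> \<rho> Rb i\<rho> act_u z] act_S_unit_left[OF \<rho> z]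
      F_ident_act[OF zH] by (simp add: S1_def M_def H_def rb_def A_def)
  have S2x: "act S2 (vtensor H N x r) = act (F B) x"
    using act_S_natural[OF \<rho> \<rho> unit_obj \<rho>b\<rho> i\<rho> R x act_u] act_S_unit_right[OF \<rho> x]
      F_ident_act[OF xH] by (simp add: S2_def N_def H_def r_def B_def)
  have "vinner X (act S1 (vtensor M H rb z)) (act S2 (vtensor H N x r))
      = vinner H z (act (hadj (F A)) (act (F B) x))"
    unfolding S1z S2x by (rule inner_hadj_right[OF H X FA zH act_closed[OF FB xH], symmetric])
  also have "hadj (F A) = F (Star T A)" by (rule F_star[OF \<rho> \<rho>\<rho>b\<rho> A, symmetric])
  also have "act (F (Star T A)) (act (F B) x) = act (F (Star T A \<cdot> B)) x"
    unfolding F_comp[OF \<rho> \<rho>\<rho>b\<rho> \<rho> A' B] by (rule act_hcomp[OF FB xH, symmetric])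
  also have "\<dots> = x" unfolding AB by (rule F_ident_act[OF xH])
  finally have key: "vinner X (act S1 (vtensor M H rb z)) (act S2 (vtensor H N x r)) = vinner H z x" .
  define g p where "g = vtensor H N x r" and "p = vtensor M H rb z"
  have g: "g \<in> vecs (H \<otimes>\<^sub>H N)" and p: "p \<in> vecs (M \<otimes>\<^sub>H H)"
    unfolding g_def p_def by (intro vtensor_closed H N M xH zH r rb)+
  let ?a = "hassoc H K H" and ?s = "S \<rho> \<rho>b \<otimes>\<^sub>M hid H" and ?t = "hid H \<otimes>\<^sub>M S \<rho>b \<rho>"
  note a = hassoc_bounded[OF H K H]
  note s1 = map_tensor_bounded[OF HK H M H s hid_bounded[OF H]]
  note t1 = map_tensor_bounded[OF H KH H N hid_bounded[OF H] t]
  have tg: "act (hadj ?t) g = vtensor H (K \<otimes>\<^sub>H H) x (act (hadj (S \<rho>b \<rho>)) r)"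
    unfolding g_def act_hadj_map_tensor[OF H KH H N hid_bounded[OF H] t xH r] hadj_hid[OF H] act_hid[OF xH] ..
  have sp: "act (hadj ?s) p = vtensor (H \<otimes>\<^sub>H K) H (act (hadj (S \<rho> \<rho>b)) rb) z"
    unfolding p_def act_hadj_map_tensor[OF HK H M H s hid_bounded[OF H] rb zH] hadj_hid[OF H] act_hid[OF zH] ..
  note tg' = act_closed[OF hadj_bounded[OF H_KH HN t1] g]
  note atg' = act_closed[OF hadj_bounded[OF HKH H_KH a] tg']
  have "vinner H z x = vinner X (act S1 p) (act S2 g)" unfolding g_def p_def key ..
  also have "\<dots> = vinner (M \<otimes>\<^sub>H H) p (act (hadj S1) (act S2 g))"
    by (rule inner_hadj_right[OF MH X S1 p act_closed[OF S2 g], symmetric])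
  also have "act (hadj S1) (act S2 g) = act ?s (act (hadj ?a) (act (hadj ?t) g))"
    using hadj_S_S[OF \<rho> \<rho>b \<rho>, of g] g unfolding S1_def S2_def H_def K_def N_def by blast
  \<comment> \<open>The factor \<open>?s\<close> goes to the left argument and puts the hat on
    \<open>rb\<close>; the factor \<open>hadj ?t\<close>, which puts the hat on \<open>r\<close>,
    stays on the right.\<close>
  also have "vinner (M \<otimes>\<^sub>H H) p \<dots> = vinner ((H \<otimes>\<^sub>H K) \<otimes>\<^sub>H H) (act (hadj ?s) p) (act (hadj ?a) (act (hadj ?t) g))"
    by (rule inner_hadj_left[OF HKH MH s1 atg' p, symmetric])
  finally show ?thesis
    unfolding tg sp act_hat[OF \<rho> \<rho>b Rb] act_hat[OF \<rho>b \<rho> R] r_def[symmetric] rb_def[symmetric]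
    unfolding H_def K_def by (rule sym)
qed

text \<open>The composite is tested against \<open>z\<close>. Moving \<open>lunit\<close> and the
  factor with \<open>hadj rb\<close> to the other side turns \<open>z\<close> into the tensor of
  \<open>act rb 1\<close> and \<open>z\<close>, while the right half of the composite turns
  \<open>x\<close> into the tensor of \<open>x\<close> and \<open>act r 1\<close>. What remains is
  \<open>pairing\<close>.\<close>

lemma conjugate_equation:
  assumes \<rho>: "\<rho> \<in> Obj T" and \<rho>b: "\<rho>b \<in> Obj T" and conj: "conjugate_eqs T \<rho> \<rho>b R Rb"
  shows "lunit (Fo \<rho>) \<circ>\<^sub>H (hadj (hat \<rho> \<rho>b Rb) \<otimes>\<^sub>M hid (Fo \<rho>)) \<circ>\<^sub>H hadj (hassoc (Fo \<rho>) (Fo \<rho>b) (Fo \<rho>)) \<circ>\<^sub>H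
    (hid (Fo \<rho>) \<otimes>\<^sub>M hat \<rho>b \<rho> R) \<circ>\<^sub>H hadj (runit (Fo \<rho>)) = hid (Fo \<rho>)"
proof -
  define H K where "H = Fo \<rho>" and "K = Fo \<rho>b"
  have H: "hilbert_space H" and K: "hilbert_space K"
    unfolding H_def K_def by (intro F_obj \<rho> \<rho>b)+
  note HK = htensor_hilbert_space[OF H K] and KH = htensor_hilbert_space[OF K H]
  note HKH = htensor_hilbert_space[OF HK H] and H_KH = htensor_hilbert_space[OF H KH]
  note CH = htensor_hilbert_space[OF CC H] and HC = htensor_hilbert_space[OF H CC]
  define r rb where "r = hat \<rho>b \<rho> R" and "rb = hat \<rho> \<rho>b Rb"
  have r: "r \<in> bounded_maps CC (K \<otimes>\<^sub>H H)" and rb: "rb \<in> bounded_maps CC (H \<otimes>\<^sub>H K)"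
    unfolding r_def rb_def H_def K_def using conj
    by (auto simp: conjugate_eqs_def intro!: hat_bounded \<rho> \<rho>b)
  note rb' = hadj_bounded[OF CC HK rb]
  note i = hid_bounded[OF H]
  note l = lunit_bounded[OF H] and m = map_tensor_bounded[OF HK H CC H rb' i]
    and a = hadj_bounded[OF HKH H_KH hassoc_bounded[OF H K H]]
    and n = map_tensor_bounded[OF H CC H KH i r] and ru = hadj_bounded[OF HC H runit_bounded[OF H]]
  note lm = hcomp_bounded[OF l m HKH CH]
  note lma = hcomp_bounded[OF lm a H_KH HKH]
  note lman = hcomp_bounded[OF lma n HC H_KH]
  let ?W = "lunit H \<circ>\<^sub>H (hadj rb \<otimes>\<^sub>M hid H) \<circ>\<^sub>H hadj (hassoc H K H) \<circ>\<^sub>H (hid H \<otimes>\<^sub>M r) \<circ>\<^sub>H hadj (runit H)"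
  have W: "?W \<in> bounded_maps H H" by (rule hcomp_bounded[OF lman ru H HC])
  have "?W = hid H"
  proof (rule bounded_maps_eqI[OF W i])
    fix x assume x: "x \<in> vecs H"
    define g where "g = act (hadj (hassoc H K H)) (vtensor H (K \<otimes>\<^sub>H H) x (act r 1))"
    have x1: "vtensor H CC x 1 \<in> vecs (H \<otimes>\<^sub>H CC)" using x by (simp add: vtensor_closed H CC)
    have xr: "vtensor H (K \<otimes>\<^sub>H H) x (act r 1) \<in> vecs (H \<otimes>\<^sub>H (K \<otimes>\<^sub>H H))"
      using x act_closed[OF r] by (simp add: vtensor_closed H KH)
    have g: "g \<in> vecs ((H \<otimes>\<^sub>H K) \<otimes>\<^sub>H H)" unfolding g_def by (rule act_closed[OF a xr])
    have nx: "act (hid H \<otimes>\<^sub>M r) (vtensor H CC x 1) = vtensor H (K \<otimes>\<^sub>H H) x (act r 1)"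
      using x by (simp add: act_map_tensor[OF H CC H KH i r] act_hid)
    have Wx: "act ?W x = act (lunit H) (act (hadj rb \<otimes>\<^sub>M hid H) g)"
      unfolding g_def act_hcomp[OF ru x] act_hadj_runit[OF H x] act_hcomp[OF n x1] nx
        act_hcomp[OF a xr] act_hcomp[OF m act_closed[OF a xr]] ..
    show "act ?W x = act (hid H) x"
    proof (rule hilbert_space.vec_eqI[OF H act_closed[OF W x] act_closed[OF i x]])
      fix z assume z: "z \<in> vecs H"
      have z1: "vtensor CC H 1 z \<in> vecs (CC \<otimes>\<^sub>H H)" using z by (simp add: vtensor_closed H CC)
      have "vinner H z (act ?W x) = vinner (CC \<otimes>\<^sub>H H) (vtensor CC H 1 z) (act (hadj rb \<otimes>\<^sub>M hid H) g)"
        unfolding Wx act_hadj_lunit[OF H z, symmetric]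
        by (rule inner_hadj_left[OF CH H l act_closed[OF m g] z, symmetric])
      also have "\<dots> = vinner ((H \<otimes>\<^sub>H K) \<otimes>\<^sub>H H) (act (hadj (hadj rb \<otimes>\<^sub>M hid H)) (vtensor CC H 1 z)) g"
        by (rule inner_hadj_left[OF HKH CH m g z1, symmetric])
      also have "act (hadj (hadj rb \<otimes>\<^sub>M hid H)) (vtensor CC H 1 z) = vtensor (H \<otimes>\<^sub>H K) H (act rb 1) z"
        using z by (simp add: act_hadj_map_tensor[OF HK H CC H rb' i] hadj_hadj[OF CC HK rb] hadj_hid[OF H] act_hid)
      also have "vinner ((H \<otimes>\<^sub>H K) \<otimes>\<^sub>H H) (vtensor (H \<otimes>\<^sub>H K) H (act rb 1) z) g = vinner H z x"
        using pairing[OF \<rho> \<rho>b conj, of x z] x z unfolding g_def r_def rb_def H_def K_def by blast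
      finally show "vinner H z (act ?W x) = vinner H z (act (hid H) x)" by (simp add: act_hid[OF x])
    qed
  qed
  then show ?thesis unfolding H_def K_def r_def rb_def .
qed

text \<open>The second equation is the first with \<open>\<rho>\<close> and \<open>\<rho>b\<close>
  exchanged, an exchange under which the conjugate equations are symmetric.\<close>

lemma hilb_conjugate_eqs_hat:
  assumes \<rho>: "\<rho> \<in> Obj T" and \<rho>b: "\<rho>b \<in> Obj T" and conj: "conjugate_eqs T \<rho> \<rho>b R Rb"
  shows "hilb_conjugate_eqs (Fo \<rho>) (Fo \<rho>b) (hat \<rho>b \<rho> R) (hat \<rho> \<rho>b Rb)"
  using conjugate_equation[OF \<rho> \<rho>b conj] conjugate_equation[OF \<rho>b \<rho> conjugate_eqs_sym[OF conj]]
    hat_bounded[OF \<rho>b \<rho>, of R] hat_bounded[OF \<rho> \<rho>b, of Rb] conj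
  unfolding hilb_conjugate_eqs_def by (simp add: conjugate_eqs_def)

lemma finite_dimensional_conjugate:
  assumes \<rho>: "\<rho> \<in> Obj T" and \<rho>b: "\<rho>b \<in> Obj T" and conj: "conjugate_eqs T \<rho> \<rho>b R Rb"
  shows "finite_dimensional (Fo \<rho>)" and "finite_dimensional (Fo \<rho>b)" and "hdim (Fo \<rho>) = hdim (Fo \<rho>b)"
proof -
  note H = F_obj[OF \<rho>] and K = F_obj[OF \<rho>b]
  define r rb where "r = act (hat \<rho>b \<rho> R) 1" and "rb = act (hat \<rho> \<rho>b Rb) 1"
  have "R \<in> Hom T (Unit T) (\<rho>b \<otimes>\<^sub>o \<rho>)" "Rb \<in> Hom T (Unit T) (\<rho> \<otimes>\<^sub>o \<rho>b)"
    using conj by (auto simp: conjugate_eqs_def)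
  then have r: "r \<in> vecs (Fo \<rho>b \<otimes>\<^sub>H Fo \<rho>)" and rb: "rb \<in> vecs (Fo \<rho> \<otimes>\<^sub>H Fo \<rho>b)"
    unfolding r_def rb_def by (auto intro!: act_closed[OF hat_bounded] \<rho> \<rho>b)
  have unit: "vinner V e e = 1" if "hilbert_space V" "e \<in> onb V" for V :: "'h hilb" and e
    using onb_orthonormal[OF that(1)] that(2) by (simp add: orthonormal_family_def)
  \<comment> \<open>This is \<open>pairing\<close> with \<open>x = z = e\<close>, a unit
    vector.\<close>
  have eq: "vinner ((Fo \<rho> \<otimes>\<^sub>H Fo \<rho>b) \<otimes>\<^sub>H Fo \<rho>) (vtensor (Fo \<rho> \<otimes>\<^sub>H Fo \<rho>b) (Fo \<rho>) rb e)
      (act (hadj (hassoc (Fo \<rho>) (Fo \<rho>b) (Fo \<rho>))) (vtensor (Fo \<rho>) (Fo \<rho>b \<otimes>\<^sub>H Fo \<rho>) e r)) = 1"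
    if "e \<in> onb (Fo \<rho>)" for e
    using pairing[OF \<rho> \<rho>b conj onb_subset[OF H that] onb_subset[OF H that]] unit[OF H that]
    unfolding r_def rb_def by (rule trans)
  have eq': "vinner ((Fo \<rho>b \<otimes>\<^sub>H Fo \<rho>) \<otimes>\<^sub>H Fo \<rho>b) (vtensor (Fo \<rho>b \<otimes>\<^sub>H Fo \<rho>) (Fo \<rho>b) r c)
      (act (hadj (hassoc (Fo \<rho>b) (Fo \<rho>) (Fo \<rho>b))) (vtensor (Fo \<rho>b) (Fo \<rho> \<otimes>\<^sub>H Fo \<rho>b) c rb)) = 1"
    if "c \<in> onb (Fo \<rho>b)" for c
    using pairing[OF \<rho>b \<rho> conjugate_eqs_sym[OF conj] onb_subset[OF K that] onb_subset[OF K that]]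
      unit[OF K that] unfolding r_def rb_def by (rule trans)
  show "finite_dimensional (Fo \<rho>)"
    unfolding finite_dimensional_def by (rule finite_onb(1)[OF H K rb r eq])
  show "finite_dimensional (Fo \<rho>b)"
    unfolding finite_dimensional_def by (rule finite_onb(1)[OF K H r rb eq'])
  show "hdim (Fo \<rho>) = hdim (Fo \<rho>b)"
    unfolding hdim_def by (rule card_onb_eq[OF H K rb r eq eq'])
qed

end

theorem theorem3p7:
  fixes T :: "('o, 'm) tensor_category"
    and Fo :: "'o \<Rightarrow> 'h hilb"
    and F :: "'m \<Rightarrow> ('h, 'h) hmap"
    and u :: "(complex, 'h) hmap"
    and S :: "'o \<Rightarrow> 'o \<Rightarrow> ('h \<times> 'h \<Rightarrow> complex, 'h) hmap"
    and \<rho> \<rho>b :: 'o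
  assumes "quasitensor_functor T Fo F u S"
    and "\<rho> \<in> Obj T" and "\<rho>b \<in> Obj T"
    and "is_conjugate T \<rho> \<rho>b"
  shows "finite_dimensional (Fo \<rho>) \<and> finite_dimensional (Fo \<rho>b) \<and> hdim (Fo \<rho>) = hdim (Fo \<rho>b) \<and>
    (\<forall>R Rb. vecs (Fo \<rho>) \<noteq> {vzero (Fo \<rho>)} \<longrightarrow> conjugate_eqs T \<rho> \<rho>b R Rb \<longrightarrow>
       hilb_conjugate_eqs (Fo \<rho>) (Fo \<rho>b)
         (hadj (S \<rho>b \<rho>) \<circ>\<^sub>H F R \<circ>\<^sub>H u)
         (hadj (S \<rho> \<rho>b) \<circ>\<^sub>H F Rb \<circ>\<^sub>H u))"
proof -
  interpret quasitensor_functor T Fo F u S by fact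
  \<comment> \<open>One solution is enough for the dimensions; the last clause concerns all
    solutions and takes the lemma on hatted vectors for each of them.\<close>
  obtain R Rb where conj: "conjugate_eqs T \<rho> \<rho>b R Rb"
    using assms(4) by (auto simp: is_conjugate_def)
  show ?thesis
    using finite_dimensional_conjugate[OF assms(2,3) conj] hilb_conjugate_eqs_hat[OF assms(2,3)] by blast
qed

end
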